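(* Let $x,u$ be real numbers with $0<x<u$. As $c\to0$ (with $c\in(0,1)$), the probability measure $\mathbb Q^{(c)}_{x,u}$ on $C(\mathbb R_+)$ converges (weakly) towards the law of a standard Brownian motion started from $x$ and conditioned, in the sense of Doob, to remain in $[0,u]$.
   Context: For $(y,t)\in\mathbb R\times(0,\infty)$ put $\phi_0(y,t)=\sum_{k\in\mathbb Z}(y+2kt)e^{-2(ky+k^2t)}$, and for $c\in(0,1)$ put $\phi_0^{(c)}(y,t)=\phi_0(cy,c^2t)$. The function $\phi_0^{(c)}(\cdot,t)$ vanishes at $0$ and $ct$ and has constant sign, without zeros, on $(0,ct)$. $C(\mathbb R_+)$ is the space of real continuous functions on $\mathbb R_+=[0,\infty)$ (with the topology of uniform convergence on compact sets), $(X_t)_{t\ge0}$ is the coordinate process, $(\mathcal F_t)_{t\ge0}$ its natural filtration, and $\mathbb E_x$ is the expectation under the Wiener measure for which $X$ is a standard Brownian motion started at $x$. Let $T_u^{(c)}=\inf\{s\ge0:X_s=0\text{ or }X_s=cs+u\}$. For $0<x<u$, $\mathbb Q_{x,u}^{(c)}$ is the probability measure on $C(\mathbb R_+)$ determined by $$\mathbb Q^{(c)}_{x,u}(A)=\mathbb E_x\left(\frac{\phi^{(c)}_0(X_t,t+\frac uc)}{\phi^{(c)}_0(x,\frac uc)}\mathbf 1_{\{T^{(c)}_u>t\}\cap A}\right),\qquad A\in\mathcal F_t,\ t\ge0.$$ Brownian motion conditioned in the sense of Doob to remain in $[0,u]$ is the Markov process with semigroup given by the transition densities $$q_t(y,z)=\frac{h(z)}{h(y)}e^{\frac{\pi^2}{u^2}\frac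 t2}p_t^0(y,z),\qquad y,z\in(0,u),\ t>0,$$ where $h(y)=\sin(\pi y/u)$ and $p^0_t$ is the transition density of standard Brownian motion on $\mathbb R$ killed on the boundary of $[0,u]$. *)

theory Defs
  imports "HOL-Probability.Probability"
begin

section \<open>The path space\<close>

text \<open>
  Real continuous functions on the half-line. As functions are total, the irrelevant
  values at negative times are normalised by extensionality.
\<close>

typedef path = "{w :: real \<Rightarrow> real. continuous_on {0..} w \<and> w \<in> extensional {0..}}"
proof
  have "continuous_on {0..} (restrict (\<lambda>_. 0 :: real) {0..})"
    by (rule continuous_on_eq[OF continuous_on_const]) simp
  then show "restrict (\<lambda>_. 0) {0..} \<in>
      {w :: real \<Rightarrow> real. continuous_on {0..} w \<and> w \<in> extensional {0..}}"
    by simp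
qed

definition coord :: "real \<Rightarrow> path \<Rightarrow> real" where
  "coord t w = Rep_path w t"

text \<open>The topology of uniform convergence on compact subsets of the half-line.\<close>

definition unif_nbhd :: "path \<Rightarrow> real set \<Rightarrow> real \<Rightarrow> path set" where
  "unif_nbhd w K e = {v. \<forall>s\<in>K. dist (coord s v) (coord s w) < e}"

lemma unif_nbhd_Int: "unif_nbhd w (K \<union> L) (min d e) \<subseteq> unif_nbhd w K d \<inter> unif_nbhd w L e"
  by (auto simp: unif_nbhd_def)

instantiation path :: topological_space
begin

definition open_path :: "path set \<Rightarrow> bool" where
  "open_path U \<longleftrightarrow>
     (\<forall>w\<in>U. \<exists>K e. compact K \<and> K \<subseteq> {0..} \<and> 0 < e \<and> unif_nbhd w K e \<subseteq> U)"

instance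
proof
  show "open (UNIV :: path set)"
    unfolding open_path_def by (intro ballI exI[of _ "{}"] exI[of _ "1::real"]) simp
next
  fix U V :: "path set"
  assume U: "open U" and V: "open V"
  show "open (U \<inter> V)"
    unfolding open_path_def
  proof
    fix w assume w: "w \<in> U \<inter> V"
    obtain K d where K: "compact K" "K \<subseteq> {0..}" "0 < d" "unif_nbhd w K d \<subseteq> U"
      using U w unfolding open_path_def by blast
    obtain L e where L: "compact L" "L \<subseteq> {0..}" "0 < e" "unif_nbhd w L e \<subseteq> V"
      using V w unfolding open_path_def by blast
    have "compact (K \<union> L)" "K \<union> L \<subseteq> {0..}" "0 < min d e"
      using K(1-3) L(1-3) by (simp_all add: compact_Un)
    moreover have "unif_nbhd w (K \<union> L) (min d e) \<subseteq> U \<inter> V"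
      using unif_nbhd_Int[of w K L d e] K(4) L(4) by blast
    ultimately show "\<exists>K e. compact K \<and> K \<subseteq> {0..} \<and> 0 < e \<and> unif_nbhd w K e \<subseteq> U \<inter> V"
      by blast
  qed
next
  fix \<U> :: "path set set"
  assume \<U>: "\<forall>U\<in>\<U>. open U"
  show "open (\<Union>\<U>)"
    unfolding open_path_def
  proof
    fix w assume "w \<in> \<Union>\<U>"
    then obtain U where U: "U \<in> \<U>" "w \<in> U" by (rule UnionE)
    have "open U" using \<U> U(1) by (rule bspec)
    then obtain K e where K: "compact K" "K \<subseteq> {0..}" "0 < e" "unif_nbhd w K e \<subseteq> U"
      using U(2) unfolding open_path_def by blast
    have "unif_nbhd w K e \<subseteq> \<Union>\<U>"
      using K(4) Union_upper[OF U(1)] by (rule subset_trans)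
    with K(1-3) show "\<exists>K e. compact K \<and> K \<subseteq> {0..} \<and> 0 < e \<and> unif_nbhd w K e \<subseteq> \<Union>\<U>"
      by (intro exI conjI)
  qed
qed

end

definition nat_filtration :: "real \<Rightarrow> path measure" where
  "nat_filtration t = sigma UNIV {coord s -` B | s B. 0 \<le> s \<and> s \<le> t \<and> B \<in> sets borel}"

text \<open>
  The first time the path lies in a (time dependent) set; it is \<open>\<infinity>\<close> if this never happens.
\<close>

definition hit_time :: "(real \<Rightarrow> real set) \<Rightarrow> path \<Rightarrow> ereal" where
  "hit_time D w = Inf {ereal s | s. 0 \<le> s \<and> coord s w \<in> D s}"

definition weakly_converges ::
  "('i \<Rightarrow> 'a::topological_space measure) \<Rightarrow> 'a measure \<Rightarrow> 'i filter \<Rightarrow> bool" where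
  "weakly_converges M N F \<longleftrightarrow>
     (\<forall>f :: 'a \<Rightarrow> real. continuous_on UNIV f \<longrightarrow> bounded (range f) \<longrightarrow>
        ((\<lambda>i. \<integral>w. f w \<partial>M i) \<longlongrightarrow> (\<integral>w. f w \<partial>N)) F)"


section \<open>Wiener measure\<close>

definition wiener_measure :: "real \<Rightarrow> path measure \<Rightarrow> bool" where
  "wiener_measure x M \<longleftrightarrow>
     prob_space M \<and> sets M = sets borel \<and>
     (AE w in M. coord 0 w = x) \<and>
     (\<forall>s t. 0 \<le> s \<longrightarrow> s < t \<longrightarrow>
        distributed M lborel (\<lambda>w. coord t w - coord s w) (normal_density 0 (sqrt (t - s))) \<and>
        prob_space.indep_set M (sets (nat_filtration s))
          (sets (vimage_algebra UNIV (\<lambda>w. coord t w - coord s w) borel)))"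


section \<open>The measures indexed by \<open>c\<close>\<close>

definition phi0 :: "real \<Rightarrow> real \<Rightarrow> real" where
  "phi0 y t = (\<Sum>\<^sub>\<infinity>k\<in>(UNIV :: int set).
     (y + 2 * of_int k * t) * exp (- 2 * (of_int k * y + (of_int k)\<^sup>2 * t)))"

definition phi0c :: "real \<Rightarrow> real \<Rightarrow> real \<Rightarrow> real" where
  "phi0c c y t = phi0 (c * y) (c\<^sup>2 * t)"

definition Tc :: "real \<Rightarrow> real \<Rightarrow> path \<Rightarrow> ereal" where
  "Tc c u = hit_time (\<lambda>s. {0, c * s + u})"

text \<open>
  The relation \<open>is_Q Wx c x u M\<close> says that \<open>M\<close> is the probability measure with parameters
  \<open>c\<close>, \<open>x\<close>, \<open>u\<close>, where \<open>Wx\<close> is the Wiener measure started at \<open>x\<close>.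
\<close>

definition is_Q :: "path measure \<Rightarrow> real \<Rightarrow> real \<Rightarrow> real \<Rightarrow> path measure \<Rightarrow> bool" where
  "is_Q Wx c x u M \<longleftrightarrow>
     prob_space M \<and> sets M = sets borel \<and>
     (\<forall>t\<ge>0. \<forall>A\<in>sets (nat_filtration t).
        measure M A =
          (\<integral>w. phi0c c (coord t w) (t + u / c) / phi0c c x (u / c) *
                indicator ({w. ereal t < Tc c u w} \<inter> A) w \<partial>Wx))"


section \<open>Brownian motion conditioned to remain in an interval\<close>

text \<open>
  \<open>p t y z\<close> is a transition density of Brownian motion killed on the boundary of the interval
  from \<open>0\<close> to \<open>u\<close>, where \<open>W y\<close> is the Wiener measure started at \<open>y\<close>. This determines
  \<open>p t y\<close> up to null sets, which is all that the transition probabilities depend on.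
\<close>

definition killed_density ::
  "(real \<Rightarrow> path measure) \<Rightarrow> real \<Rightarrow> (real \<Rightarrow> real \<Rightarrow> real \<Rightarrow> real) \<Rightarrow> bool" where
  "killed_density W u p \<longleftrightarrow>
     (\<forall>t>0. \<forall>y\<in>{0<..<u}.
        p t y \<in> borel_measurable borel \<and> (\<forall>z. 0 \<le> p t y z) \<and>
        (\<forall>B\<in>sets borel. B \<subseteq> {0<..<u} \<longrightarrow>
           emeasure (W y) {w. coord t w \<in> B \<and> ereal t < hit_time (\<lambda>_. {0, u}) w} =
           (\<integral>\<^sup>+z\<in>B. ennreal (p t y z) \<partial>lborel)))"

definition doob_density ::
  "real \<Rightarrow> (real \<Rightarrow> real \<Rightarrow> real \<Rightarrow> real) \<Rightarrow> real \<Rightarrow> real \<Rightarrow> real \<Rightarrow> real" where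
  "doob_density u p t y z =
     sin (pi * z / u) / sin (pi * y / u) * exp (pi\<^sup>2 / u\<^sup>2 * (t / 2)) * p t y z"

text \<open>
  \<open>M\<close> is the law on path space of a Markov process with state space \<open>S\<close>, transition densities
  \<open>q t y z\<close> and starting point \<open>x\<close>.
\<close>

definition markov_law ::
  "real set \<Rightarrow> (real \<Rightarrow> real \<Rightarrow> real \<Rightarrow> real) \<Rightarrow> real \<Rightarrow> path measure \<Rightarrow> bool" where
  "markov_law S q x M \<longleftrightarrow>
     prob_space M \<and> sets M = sets borel \<and>
     (AE w in M. coord 0 w = x) \<and>
     (\<forall>t\<ge>0. AE w in M. coord t w \<in> S) \<and>
     (\<forall>s\<ge>0. \<forall>t>0. \<forall>B\<in>sets borel. AE w in M.
        real_cond_exp M (nat_filtration s) (indicator {w. coord (s + t) w \<in> B}) w =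
        (LINT z:B \<inter> S|lborel. q t (coord s w) z))"

end

theory Submission
  imports Defs
begin

text \<open>
  Up to the factor \<open>exp (y\<^sup>2 / (2 t))\<close>, the function \<open>phi0\<close> is a periodised derivative of a Gaussian,
  and its Fourier sine series in \<open>y\<close> shows that for small \<open>t\<close> it is equivalent, uniformly on the
  interval from \<open>0\<close> to \<open>t\<close>, to a multiple of \<open>exp (- pi\<^sup>2 / (2 t)) * sin (pi y / t)\<close>. Hence the densities of
  \<open>Q c\<close> on the sigma-algebra at time \<open>t\<close> stay bounded and converge to
  \<open>sin (pi X\<^sub>t / u) / sin (pi x / u) * exp (pi\<^sup>2 t / (2 u\<^sup>2))\<close> on the paths that stay between \<open>0\<close> and \<open>u\<close>, which
  gives convergence of the integrals of all bounded functionals of the path up to time \<open>t\<close>. By the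
  Markov property of Wiener measure, the limit is the Doob transform of the killed process.
\<close>

section \<open>Fourier sine series of a periodised Gaussian\<close>

text \<open>For small \<open>t\<close> many terms of the series \<open>phi0 y t\<close> have
  comparable size and cancel almost completely: what remains is exponentially small, so no single
  term can serve as a leading term. The dual sine series behaves in the opposite way, its first
  harmonic dominates. Since \<open>phi0\<close> vanishes at both ends of the interval and enters as
  a quotient, the error has to be controlled relative to the sine, up to the endpoints. The
  densities use \<open>phi0\<close> at the times \<open>c * (c * t + u)\<close> and
  \<open>c * u\<close>. The two exponents \<open>pi^2 / (2 * time)\<close> blow up as
  \<open>c\<close> tends to 0, but their difference tends to \<open>pi^2 * t / (2 * u^2)\<close>;
  this is the origin of the exponential factor of the Doob transform. A second obstacle is that the
  barrier \<open>c * s + u\<close> comes down to \<open>u\<close> from above, so the events of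
  survival shrink to one in which the path may touch \<open>u\<close>, whereas the conditioned
  process stays strictly below \<open>u\<close>.\<close>

text \<open>Product-to-sum formulas turn \<open>cos^k * sin (n * \<theta>)\<close> into sines, so
  \<open>D\<close> is orthogonal to every \<open>g (cos \<theta>) * sin \<theta>\<close> with
  \<open>g\<close> a polynomial. The substitution \<open>x = cos \<theta>\<close> lets Weierstrass
  approximate \<open>D\<close> itself by such \<open>g (cos \<theta>)\<close>. Hence the integral of
  \<open>D^2 * sin\<close> vanishes, and the weight \<open>sin\<close> is positive in the
  interior.\<close>

lemma fourier_sine_unique:
  fixes D :: "real \<Rightarrow> real"
  assumes D: "continuous_on {0..pi} D"
    and orth: "\<And>n::nat. integral {0..pi} (\<lambda>\<theta>. D \<theta> * sin (n * \<theta>)) = 0"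
    and \<theta>: "\<theta> \<in> {0<..<pi}"
  shows "D \<theta> = 0"
proof -
  have int: "(\<lambda>\<theta>. D \<theta> * g \<theta>) integrable_on {0..pi}" if "continuous_on {0..pi} g" for g
    by (intro integrable_continuous_real continuous_intros D that)
  have cos_orth: "integral {0..pi} (\<lambda>\<theta>. D \<theta> * (cos \<theta> ^ k * sin (n * \<theta>))) = 0" for k n :: nat
  proof (induction k arbitrary: n)
    case 0 then show ?case using orth[of n] by simp
  next
    case (Suc k)
    show ?case
    proof (cases n)
      case 0 then show ?thesis by simp
    next
      case (Suc m)
      have eq: "D \<theta> * (cos \<theta> ^ Suc k * sin (n * \<theta>)) =
         (D \<theta> * (cos \<theta> ^ k * sin (real (Suc n) * \<theta>))) * (1/2) + (D \<theta> * (cos \<theta> ^ k * sin (real m * \<theta>))) * (1/2)" for \<theta> :: real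
      proof -
        have "cos \<theta> * sin (n * \<theta>) = (sin (real (Suc n) * \<theta>) + sin (real m * \<theta>)) / 2"
          using sin_add[of "n * \<theta>" \<theta>] sin_diff[of "n * \<theta>" \<theta>] by (simp add: Suc algebra_simps)
        then have "D \<theta> * cos \<theta> ^ k * (cos \<theta> * sin (n * \<theta>)) =
          D \<theta> * cos \<theta> ^ k * ((sin (real (Suc n) * \<theta>) + sin (real m * \<theta>)) / 2)" by (rule arg_cong)
        then show ?thesis by (simp add: field_simps del: of_nat_Suc)
      qed
      have "integral {0..pi} (\<lambda>\<theta>. D \<theta> * (cos \<theta> ^ Suc k * sin (n * \<theta>))) =
        integral {0..pi} (\<lambda>\<theta>. D \<theta> * (cos \<theta> ^ k * sin (real (Suc n) * \<theta>))) * (1/2)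
        + integral {0..pi} (\<lambda>\<theta>. D \<theta> * (cos \<theta> ^ k * sin (real m * \<theta>))) * (1/2)"
        unfolding eq integral_mult_left[symmetric]
        by (rule integral_add; intro integrable_on_mult_left int continuous_intros)
      then show ?thesis using Suc.IH[of "Suc n"] Suc.IH[of m] by simp
    qed
  qed
  have sq0: "integral {0..pi} (\<lambda>\<theta>. D \<theta> * (D \<theta> * sin \<theta>)) = 0"
  proof -
    obtain B where B: "\<And>\<theta>. \<theta> \<in> {0..pi} \<Longrightarrow> \<bar>D \<theta>\<bar> \<le> B" "0 < B"
      using compact_imp_bounded[OF compact_continuous_image[OF D compact_Icc]]
      unfolding bounded_pos by (metis imageI real_norm_def)
    have "\<bar>integral {0..pi} (\<lambda>\<theta>. D \<theta> * (D \<theta> * sin \<theta>))\<bar> \<le> e * B * pi" if "e > 0" for e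
    proof -
      have "continuous_on {-1..1} (\<lambda>x. D (arccos x))"
        by (rule continuous_on_compose2[OF D]) (auto intro!: continuous_intros arccos_lbound arccos_ubound)
      from Stone_Weierstrass_polynomial_function[OF compact_Icc this that]
      obtain g where g: "polynomial_function g" "\<And>x. x \<in> {-1..1} \<Longrightarrow> \<bar>D (arccos x) - g x\<bar> < e"
        by (auto simp: real_norm_def)
      then obtain a m where gs: "g = (\<lambda>x. \<Sum>i\<le>m. a i * x^i)"
        using real_polynomial_function_iff_sum real_polynomial_function_eq by blast
      have "integral {0..pi} (\<lambda>\<theta>. D \<theta> * (g (cos \<theta>) * sin \<theta>)) =
        integral {0..pi} (\<lambda>\<theta>. \<Sum>i\<le>m. a i * (D \<theta> * (cos \<theta> ^ i * sin (real 1 * \<theta>))))"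
        by (simp add: gs sum_distrib_left sum_distrib_right mult_ac)
      also have "\<dots> = (\<Sum>i\<le>m. integral {0..pi} (\<lambda>\<theta>. a i * (D \<theta> * (cos \<theta> ^ i * sin (real 1 * \<theta>)))))"
        by (rule integral_sum) (auto intro!: integrable_on_mult_right int continuous_intros simp del: of_nat_1)
      also have "\<dots> = 0"
        using cos_orth[of _ 1] by (simp add: integral_mult_right)
      finally have 0: "integral {0..pi} (\<lambda>\<theta>. D \<theta> * (g (cos \<theta>) * sin \<theta>)) = 0" .
      have cg: "continuous_on {0..pi} (\<lambda>\<theta>. g (cos \<theta>))" unfolding gs by (intro continuous_intros)
      have "integral {0..pi} (\<lambda>\<theta>. D \<theta> * (D \<theta> * sin \<theta>)) =
        integral {0..pi} (\<lambda>\<theta>. D \<theta> * (D \<theta> * sin \<theta>)) - integral {0..pi} (\<lambda>\<theta>. D \<theta> * (g (cos \<theta>) * sin \<theta>))"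
        using 0 by simp
      also have "\<dots> = integral {0..pi} (\<lambda>\<theta>. D \<theta> * (D \<theta> * sin \<theta>) - D \<theta> * (g (cos \<theta>) * sin \<theta>))"
        by (rule integral_diff[symmetric]; intro int continuous_intros D cg)
      also have "norm \<dots> \<le> e * B * (pi - 0)"
      proof (rule integral_bound)
        show "continuous_on {0..pi} (\<lambda>\<theta>. D \<theta> * (D \<theta> * sin \<theta>) - D \<theta> * (g (cos \<theta>) * sin \<theta>))"
          by (intro continuous_intros D cg)
        show "norm (D t * (D t * sin t) - D t * (g (cos t) * sin t)) \<le> e * B" if t: "t \<in> {0..pi}" for t
        proof -
          have "\<bar>D t * (D t * sin t) - D t * (g (cos t) * sin t)\<bar> = \<bar>D (arccos (cos t)) - g (cos t)\<bar> * \<bar>D t\<bar> * \<bar>sin t\<bar>"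
            using t by (simp add: arccos_cos abs_mult[symmetric] algebra_simps)
          also have "\<dots> \<le> e * B * 1"
            using g(2)[of "cos t"] B(1)[OF t] by (intro mult_mono) (auto simp: \<open>0 < e\<close> less_imp_le)
          finally show ?thesis by simp
        qed
      qed simp
      finally show ?thesis by simp
    qed
    note le = this
    show ?thesis
    proof (rule ccontr)
      let ?I = "integral {0..pi} (\<lambda>\<theta>. D \<theta> * (D \<theta> * sin \<theta>))"
      assume "?I \<noteq> 0"
      \<comment> \<open>This choice of \<open>e\<close> bounds the absolute value of the integral by
        half of itself.\<close>
      with le[of "\<bar>?I\<bar> / (2 * B * pi)"] B(2) show False by (simp add: field_simps)
    qed
  qed
  have "D \<theta> * (D \<theta> * sin \<theta>) = 0"
  proof (rule has_integral_0_cbox_imp_0[where f = "\<lambda>\<theta>. D \<theta> * (D \<theta> * sin \<theta>)" and a = 0 and b = pi])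
    show "continuous_on (cbox 0 pi) (\<lambda>\<theta>. D \<theta> * (D \<theta> * sin \<theta>))" using D by (auto intro!: continuous_intros)
    show "0 \<le> D \<theta> * (D \<theta> * sin \<theta>)" if "\<theta> \<in> box 0 pi" for \<theta>
      using that sin_ge_zero[of \<theta>] by (simp add: mult.assoc[symmetric])
    show "((\<lambda>\<theta>. D \<theta> * (D \<theta> * sin \<theta>)) has_integral 0) (cbox 0 pi)"
    proof -
      have "continuous_on {0..pi} (\<lambda>\<theta>. D \<theta> * sin \<theta>)" by (intro continuous_intros D)
      from integrable_integral[OF int[OF this]] show ?thesis by (simp add: sq0)
    qed
    show "box 0 pi \<noteq> {}" using pi_gt_zero by (metis box_real(1) greaterThanLessThan_empty_iff leD)
    show "\<theta> \<in> cbox 0 pi" using \<theta> by simp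
  qed
  moreover have "sin \<theta> > 0" using \<theta> sin_gt_zero by simp
  ultimately show ?thesis by simp
qed

section \<open>The sine transform of \<open>s * exp (- a * s^2)\<close>\<close>

text \<open>Integration by parts: \<open>?f\<close> is the derivative of the density times
  \<open>sin (t * s)\<close>, which vanishes at both infinities, so its integral is 0. The cosine
  integral that remains is the real part of the characteristic function.\<close>

lemma std_normal_sin_moment:
  "integrable lborel (\<lambda>s. std_normal_density s * s * sin (t * s))"
  "(\<integral>s. std_normal_density s * s * sin (t * s) \<partial>lborel) = t * exp (- t\<^sup>2 / 2)"
proof -
  have i1: "integrable lborel (\<lambda>s. std_normal_density s * s * sin (t * s))"
    by (rule Bochner_Integration.integrable_bound[OF integrable_std_normal_moment_abs[of 1]])
       (auto intro!: AE_I2 simp: abs_mult mult_left_le)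
  have i2: "integrable lborel (\<lambda>s. std_normal_density s * cos (t * s))"
    by (rule Bochner_Integration.integrable_bound[OF integrable_std_normal_moment_abs[of 0]])
       (auto intro!: AE_I2 simp: abs_mult mult_left_le)
  have char: "(\<integral>s. std_normal_density s * cos (t * s) \<partial>lborel) = exp (- t\<^sup>2 / 2)"
  proof -
    interpret prob_space std_normal_distribution by (rule prob_space_normal_density) simp
    have "exp (- t\<^sup>2 / 2) = Re (char std_normal_distribution t)"
      by (simp add: char_std_normal_distribution)
    also have "\<dots> = (\<integral>s. Re (iexp (t * s)) \<partial>std_normal_distribution)"
      unfolding char_def
      by (subst integral_Re) (auto intro!: integrable_const_bound[of _ 1])
    also have "\<dots> = (\<integral>s. cos (t * s) \<partial>std_normal_distribution)"
      by (simp add: Re_exp)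
    also have "\<dots> = (\<integral>s. std_normal_density s * cos (t * s) \<partial>lborel)"
      by (subst integral_density) auto
    finally show ?thesis by simp
  qed
  let ?f = "\<lambda>s. t * (std_normal_density s * cos (t * s)) - std_normal_density s * s * sin (t * s)"
  have if': "integrable lborel ?f" by (intro Bochner_Integration.integrable_diff integrable_mult_right i1 i2)
  have lim: "((\<lambda>s. std_normal_density s * sin (t * s)) \<longlongrightarrow> 0) F"
    if "((\<lambda>s. std_normal_density s) \<longlongrightarrow> 0) F" for F
    by (rule Lim_null_comparison[OF _ that]) (auto intro!: always_eventually simp: abs_mult mult_left_le)
  have sq: "LIM s at_bot. s\<^sup>2 / 2 :> (at_top::real filter)" "LIM s at_top. s\<^sup>2 / 2 :> (at_top::real filter)"
    by real_asymp+
  have "(LBINT s=-\<infinity>..\<infinity>. ?f s) = 0 - 0"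
  proof (rule interval_integral_FTC_integrable[where F = "\<lambda>s. std_normal_density s * sin (t * s)"])
    show "((\<lambda>s. std_normal_density s * sin (t * s)) has_vector_derivative ?f x) (at x)" for x
    proof -
      have "((\<lambda>x. c * exp (- x\<^sup>2 / 2)) has_real_derivative (- x * (c * exp (- x\<^sup>2 / 2)))) (at x)" for c :: real
        by (auto intro!: derivative_eq_intros)
      from this[of "1 / sqrt (2 * pi)"]
      have "(std_normal_density has_real_derivative (- x * std_normal_density x)) (at x)"
        by (simp add: std_normal_density_def[abs_def])
      then show ?thesis
        unfolding has_real_derivative_iff_has_vector_derivative[symmetric]
        by (auto intro!: derivative_eq_intros simp: algebra_simps)
    qed
    show "isCont ?f x" for x unfolding std_normal_density_def by (intro continuous_intros) auto
    show "set_integrable lborel (einterval (-\<infinity>) \<infinity>) ?f" using if' by (simp add: set_integrable_def)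
    show "(((\<lambda>s. std_normal_density s * sin (t * s)) \<circ> real_of_ereal) \<longlongrightarrow> 0) (at_right (-\<infinity>))"
      unfolding o_def at_right_MInf filterlim_filtermap tendsto_def eventually_filtermap real_of_ereal.simps
      by (simp add: tendsto_def[symmetric]) (intro lim, unfold std_normal_density_def, real_asymp)
    show "(((\<lambda>s. std_normal_density s * sin (t * s)) \<circ> real_of_ereal) \<longlongrightarrow> 0) (at_left \<infinity>)"
      unfolding o_def at_left_PInf filterlim_filtermap tendsto_def eventually_filtermap real_of_ereal.simps
      by (simp add: tendsto_def[symmetric]) (intro lim, unfold std_normal_density_def, real_asymp)
  qed auto
  then have "(\<integral>s. ?f s \<partial>lborel) = 0"
    by (simp add: interval_lebesgue_integral_def set_lebesgue_integral_def)
  then show "(\<integral>s. std_normal_density s * s * sin (t * s) \<partial>lborel) = t * exp (- t\<^sup>2 / 2)"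
    using i1 i2 char by simp
  show "integrable lborel (\<lambda>s. std_normal_density s * s * sin (t * s))" by fact
qed

lemma gaussian_sine_transform:
  fixes a t :: real
  assumes a: "0 < a"
  shows "integrable lborel (\<lambda>s. s * exp (- a * s\<^sup>2) * sin (t * s))"
    and "(\<integral>s. s * exp (- a * s\<^sup>2) * sin (t * s) \<partial>lborel) =
      sqrt (2 * pi) / sqrt (2 * a) ^ 3 * t * exp (- t\<^sup>2 / (4 * a))"
proof -
  \<comment> \<open>With this scale \<open>exp (- a * s^2)\<close> becomes the standard Gaussian at
    \<open>c * s\<close>.\<close>
  define c where "c = sqrt (2 * a)"
  have c: "c > 0" "c\<^sup>2 = 2 * a" using a by (simp_all add: c_def)
  have c_neq: "c \<noteq> 0" using c by simp
  let ?f = "\<lambda>s. std_normal_density s * s * sin (t / c * s)"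
  have eq: "?f (0 + c * s) = (c / sqrt (2 * pi)) * (s * exp (- a * s\<^sup>2) * sin (t * s))" for s
    using c by (simp add: std_normal_density_def power_mult_distrib)
  have "integrable lborel (\<lambda>s. ?f (0 + c * s))"
    using std_normal_sin_moment(1)[of "t / c"] c lborel_integrable_real_affine[of ?f c 0] by simp
  from integrable_mult_right[of "sqrt (2 * pi) / c", OF this[unfolded eq]]
  show "integrable lborel (\<lambda>s. s * exp (- a * s\<^sup>2) * sin (t * s))"
    using c by (simp add: mult.assoc[symmetric])
  have "t / c * exp (- (t / c)\<^sup>2 / 2) = c * (\<integral>s. ?f (0 + c * s) \<partial>lborel)"
    using std_normal_sin_moment(2)[of "t / c"] lborel_integral_real_affine[OF c_neq, of ?f 0] c by simp
  also have "\<dots> = c * (c / sqrt (2 * pi)) * (\<integral>s. s * exp (- a * s\<^sup>2) * sin (t * s) \<partial>lborel)"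
    unfolding eq by (subst integral_mult_right_zero) simp
  finally have "(\<integral>s. s * exp (- a * s\<^sup>2) * sin (t * s) \<partial>lborel) =
    sqrt (2 * pi) / c ^ 3 * t * exp (- (t / c)\<^sup>2 / 2)"
    using c(1) by (simp add: field_simps power3_eq_cube)
  then show "(\<integral>s. s * exp (- a * s\<^sup>2) * sin (t * s) \<partial>lborel) =
      sqrt (2 * pi) / sqrt (2 * a) ^ 3 * t * exp (- t\<^sup>2 / (4 * a))"
    using c(2) by (simp add: power_divide c_def)
qed

section \<open>Convergence of the periodised series\<close>

text \<open>The factor times the exponential is \<open>-1 / (2 * a)\<close> times the derivative of
  \<open>exp (- a * x^2)\<close>, so \<open>wrap_sum\<close> is, up to that constant, the derivative
  of a theta function.\<close>

definition wrap_term :: "real \<Rightarrow> int \<Rightarrow> real \<Rightarrow> real" where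
  "wrap_term a k \<theta> = (\<theta> + 2 * pi * of_int k) * exp (- a * (\<theta> + 2 * pi * of_int k)\<^sup>2)"

definition wrap_sum :: "real \<Rightarrow> real \<Rightarrow> real" where
  "wrap_sum a \<theta> = (\<Sum>\<^sub>\<infinity>k\<in>UNIV. wrap_term a k \<theta>)"

lemma summable_on_int_abs:
  fixes f :: "nat \<Rightarrow> real"
  assumes "summable f" "\<And>n. 0 \<le> f n"
  shows "(\<lambda>k::int. f (nat \<bar>k\<bar>)) summable_on UNIV"
proof -
  have f: "f summable_on UNIV"
    using assms by (simp add: summable_on_UNIV_nonneg_real_iff)
  have 1: "(\<lambda>k::int. f (nat \<bar>k\<bar>)) summable_on (range int)"
    by (subst summable_on_reindex) (use f in \<open>auto simp: o_def\<close>)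
  have "(\<lambda>k::int. f (nat \<bar>k\<bar>)) summable_on ((\<lambda>n. - int n) ` {1..})"
    by (subst summable_on_reindex) (use summable_on_subset_banach[OF f] in \<open>auto simp: o_def inj_on_def\<close>)
  moreover have "range int \<union> (\<lambda>n. - int n) ` {1..} = UNIV"
  proof (intro equalityI subsetI UnCI)
    fix k :: int assume k: "k \<notin> (\<lambda>n. - int n) ` {1..}"
    have "k \<in> (\<lambda>n. - int n) ` {1..}" if "k < 0"
      using that by (intro image_eqI[of _ _ "nat (- k)"]) auto
    with k have "0 \<le> k" by linarith
    then show "k \<in> range int" using nonneg_int_cases by blast
  qed auto
  ultimately show ?thesis
    using summable_on_Un_disjoint[OF 1, of "(\<lambda>n. - int n) ` {1..}"] by force
qed

text \<open>For \<theta> in one period around 0, the point \<open>\<theta> + 2 * pi * k\<close> has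
  modulus between \<open>pi * |k|\<close> and \<open>pi * (2 * |k| + 1)\<close>. The lower bound
  controls the exponential and the upper one the linear factor.\<close>

lemma wrap_term_bound:
  assumes a: "0 < a"
  obtains M where "M summable_on UNIV" "\<And>k \<theta>. \<theta> \<in> {-pi..pi} \<Longrightarrow> \<bar>wrap_term a k \<theta>\<bar> \<le> M k"
proof
  define f where "f n = pi * (2 * real n + 1) * exp (- a * (pi * real n)\<^sup>2)" for n :: nat
  have "summable (\<lambda>n::nat. pi * (2 * real n + 1) * exp (- a * (pi * real n)\<^sup>2))"
  proof (rule summable_comparison_test_bigo)
    show "summable (\<lambda>n. norm ((1/2::real) ^ n))" by (simp add: summable_geometric)
    show "(\<lambda>n::nat. pi * (2 * real n + 1) * exp (- a * (pi * real n)\<^sup>2)) \<in> O(\<lambda>n. (1 / 2) ^ n)"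
      using a by real_asymp
  qed
  then show "(\<lambda>k::int. f (nat \<bar>k\<bar>)) summable_on UNIV"
    by (intro summable_on_int_abs) (auto simp: f_def)
  fix k :: int and \<theta> :: real assume \<theta>: "\<theta> \<in> {-pi..pi}"
  let ?n = "real (nat \<bar>k\<bar>)"
  have n: "?n = \<bar>real_of_int k\<bar>" by simp
  have 1: "\<bar>\<theta> + 2 * pi * of_int k\<bar> \<le> pi * (2 * ?n + 1)"
  proof -
    have "\<bar>\<theta> + 2 * pi * of_int k\<bar> \<le> \<bar>\<theta>\<bar> + \<bar>2 * pi * of_int k\<bar>" by (rule abs_triangle_ineq)
    also have "\<dots> \<le> pi + 2 * pi * ?n" using \<theta> unfolding n by (intro add_mono) (auto simp: abs_mult)
    finally show ?thesis by (simp add: algebra_simps)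
  qed
  have 2: "\<bar>pi * ?n\<bar> \<le> \<bar>\<theta> + 2 * pi * of_int k\<bar>"
  proof (cases "k = 0")
    case False
    then have "1 \<le> ?n" by simp
    then have "pi * 1 \<le> pi * ?n" by (intro mult_left_mono) auto
    moreover have "2 * pi * ?n - \<bar>\<theta>\<bar> \<le> \<bar>\<theta> + 2 * pi * of_int k\<bar>"
      using abs_triangle_ineq2[of "2 * pi * of_int k" "- \<theta>"] unfolding n by (simp add: abs_mult add.commute)
    moreover have "\<bar>\<theta>\<bar> \<le> pi" using \<theta> by auto
    ultimately have "pi * ?n \<le> \<bar>\<theta> + 2 * pi * of_int k\<bar>" by linarith
    then show ?thesis by simp
  qed simp
  have "(pi * ?n)\<^sup>2 \<le> (\<theta> + 2 * pi * of_int k)\<^sup>2"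
    using 2 abs_le_square_iff by blast
  then have "exp (- a * (\<theta> + 2 * pi * of_int k)\<^sup>2) \<le> exp (- a * (pi * ?n)\<^sup>2)"
    using a by (simp only: exp_le_cancel_iff) (simp add: mult_left_mono)
  with 1 show "\<bar>wrap_term a k \<theta>\<bar> \<le> f (nat \<bar>k\<bar>)"
    unfolding wrap_term_def f_def abs_mult abs_exp_cancel by (intro mult_mono) auto
qed

text \<open>Replaces the unordered sum over the integers by partial sums over
  \<open>{- N..N}\<close>, whose periods fill a symmetric interval of the line.\<close>

lemma symmetric_intervals_finite_subsets:
  "filterlim (\<lambda>N. {- int N..int N}) (finite_subsets_at_top UNIV) sequentially"
  unfolding filterlim_finite_subsets_at_top
proof (intro allI impI)
  fix X :: "int set" assume "finite X \<and> X \<subseteq> UNIV"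
  then have "bdd_above (abs ` X)" by simp
  then obtain m where m: "\<And>x. x \<in> X \<Longrightarrow> \<bar>x\<bar> \<le> m"
    by (auto simp: bdd_above_def)
  show "\<forall>\<^sub>F N in sequentially. finite {- int N..int N} \<and> X \<subseteq> {- int N..int N} \<and> {- int N..int N} \<subseteq> UNIV"
    using eventually_ge_at_top[of "nat m"]
    by eventually_elim (use m in force)
qed

lemma wrap_sum_uniform_limit:
  assumes "0 < a"
  shows "uniform_limit {-pi..pi} (\<lambda>N \<theta>. \<Sum>k\<in>{- int N..int N}. wrap_term a k \<theta>) (wrap_sum a) sequentially"
proof -
  obtain M where "M summable_on UNIV" "\<And>k \<theta>. \<theta> \<in> {-pi..pi} \<Longrightarrow> \<bar>wrap_term a k \<theta>\<bar> \<le> M k"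
    using wrap_term_bound[OF assms] by metis
  then have "uniform_limit {-pi..pi} (\<lambda>X \<theta>. \<Sum>k\<in>X. wrap_term a k \<theta>) (wrap_sum a) (finite_subsets_at_top UNIV)"
    unfolding wrap_sum_def[abs_def] by (intro Weierstrass_m_test_general) auto
  then show ?thesis
    by (rule filterlim_compose) (rule symmetric_intervals_finite_subsets)
qed

lemma continuous_wrap_term: "continuous_on S (wrap_term a k)"
  unfolding wrap_term_def[abs_def] by (intro continuous_intros)

lemma continuous_wrap_sum:
  assumes "0 < a"
  shows "continuous_on {-pi..pi} (wrap_sum a)"
  by (rule uniform_limit_theorem[OF _ wrap_sum_uniform_limit[OF assms]])
     (auto intro!: always_eventually continuous_intros continuous_wrap_term)

lemma wrap_sum_minus: "wrap_sum a (- \<theta>) = - wrap_sum a \<theta>"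
proof -
  have "wrap_sum a (- \<theta>) = (\<Sum>\<^sub>\<infinity>k\<in>UNIV. wrap_term a (- k) (- \<theta>))"
    unfolding wrap_sum_def by (rule infsum_reindex_bij_witness[of _ uminus uminus]) auto
  also have "\<dots> = (\<Sum>\<^sub>\<infinity>k\<in>UNIV. - wrap_term a k \<theta>)"
  proof (rule infsum_cong)
    fix k
    have "- \<theta> + 2 * pi * of_int (- k) = - (\<theta> + 2 * pi * of_int k)" by simp
    then show "wrap_term a (- k) (- \<theta>) = - wrap_term a k \<theta>"
      unfolding wrap_term_def by (simp only: power2_minus mult_minus_left)
  qed
  also have "\<dots> = - wrap_sum a \<theta>" by (simp add: infsum_uminus wrap_sum_def)
  finally show ?thesis .
qed

text \<open>The periods are centred at the multiples of \<open>2 * pi\<close>, hence the odd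
  multiples of \<open>pi\<close> as endpoints. Passing from \<open>N\<close> to \<open>Suc N\<close>
  adds one period on each side.\<close>

lemma integral_periods:
  fixes h :: "real \<Rightarrow> real"
  assumes h: "continuous_on UNIV h"
  shows "integral {- ((2 * real N + 1) * pi)..(2 * real N + 1) * pi} h =
    (\<Sum>k\<in>{- int N..int N}. integral {-pi..pi} (\<lambda>\<theta>. h (\<theta> + 2 * pi * of_int k)))"
proof (induction N)
  case 0 then show ?case by simp
next
  case (Suc N)
  have sh: "integral {-pi..pi} (\<lambda>\<theta>. h (\<theta> + c)) = integral {-pi + c..pi + c} h" for c
    using integral_shift_Icc_real[of "-pi" pi h c] by (simp add: o_def add.commute)
  have io: "h integrable_on {a..b}" for a b
    by (rule integrable_continuous_real) (rule continuous_on_subset[OF h], simp)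
  define A B where "A = (2 * real N + 1) * pi" and "B = (2 * real (Suc N) + 1) * pi"
  have eqs: "(2 * real N + 1) * pi = A" "(2 * real (Suc N) + 1) * pi = B"
    by (simp_all add: A_def B_def)
  have "0 \<le> A" "A \<le> B" by (auto simp: A_def B_def intro!: mult_right_mono)
  then have AB: "A \<le> B" "- B \<le> - A" "- A \<le> A" "- A \<le> B" "- B \<le> B" by linarith+
  have "integral {- B..B} h = integral {- B..- A} h + integral {- A..B} h"
    by (rule Henstock_Kurzweil_Integration.integral_combine[symmetric]; use AB io in blast)
  also have "integral {- A..B} h = integral {- A..A} h + integral {A..B} h"
    by (rule Henstock_Kurzweil_Integration.integral_combine[symmetric]; use AB io in blast)
  finally have 1: "integral {- B..B} h = integral {- B..- A} h + integral {- A..A} h + integral {A..B} h"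
    by simp
  have 2: "{- int (Suc N)..int (Suc N)} = insert (- int (Suc N)) (insert (int (Suc N)) {- int N..int N})"
    by auto
  have 3: "- pi + 2 * pi * real_of_int (- int (Suc N)) = - B" "pi + 2 * pi * real_of_int (- int (Suc N)) = - A"
    "- pi + 2 * pi * real_of_int (int (Suc N)) = A" "pi + 2 * pi * real_of_int (int (Suc N)) = B"
    by (simp_all add: A_def B_def algebra_simps)
  have "(\<Sum>k\<in>{- int (Suc N)..int (Suc N)}. integral {-pi..pi} (\<lambda>\<theta>. h (\<theta> + 2 * pi * of_int k))) =
    integral {-pi..pi} (\<lambda>\<theta>. h (\<theta> + 2 * pi * real_of_int (- int (Suc N)))) +
    (integral {-pi..pi} (\<lambda>\<theta>. h (\<theta> + 2 * pi * real_of_int (int (Suc N)))) +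
    (\<Sum>k\<in>{- int N..int N}. integral {-pi..pi} (\<lambda>\<theta>. h (\<theta> + 2 * pi * of_int k))))"
    unfolding 2 by (subst sum.insert, simp, simp, subst sum.insert, simp, simp) (rule refl)
  also have "\<dots> = integral {- B..B} h"
    unfolding sh 3 1 Suc.IH[symmetric, unfolded eqs sh] by simp
  finally show ?case unfolding eqs ..
qed

lemma tendsto_integral_uniform_limit:
  fixes f :: "nat \<Rightarrow> real \<Rightarrow> real"
  assumes u: "uniform_limit {a..b} f g sequentially"
    and c: "\<And>n. continuous_on {a..b} (f n)"
  shows "(\<lambda>n. integral {a..b} (f n)) \<longlonglongrightarrow> integral {a..b} g"
proof -
  obtain I J where I: "\<And>n. (f n has_integral I n) {a..b}" and J: "(g has_integral J) {a..b}" and lim: "I \<longlonglongrightarrow> J"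
    using uniform_limit_integral[OF u c] by auto
  have "I = (\<lambda>n. integral {a..b} (f n))" using integral_unique[OF I] by auto
  then show ?thesis using lim integral_unique[OF J] by simp
qed

lemma tendsto_integral_UNIV:
  fixes h :: "real \<Rightarrow> real" and R :: "nat \<Rightarrow> real"
  assumes int: "integrable lborel h" and R: "filterlim R at_top sequentially" 
  shows "(\<lambda>N. integral {- R N..R N} h) \<longlonglongrightarrow> (\<integral>s. h s \<partial>lborel)"
proof -
  have "(\<lambda>N. \<integral>s. indicator {- R N..R N} s * h s \<partial>lborel) \<longlonglongrightarrow> (\<integral>s. h s \<partial>lborel)"
  proof (rule integral_dominated_convergence[where w = "\<lambda>s. norm (h s)"])
    show "AE s in lborel. (\<lambda>N. indicator {- R N..R N} s * h s) \<longlonglongrightarrow> h s"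
    proof (rule AE_I2)
      fix s
      have "\<forall>\<^sub>F N in sequentially. R N \<ge> \<bar>s\<bar>" using R by (simp add: filterlim_at_top)
      then have "\<forall>\<^sub>F N in sequentially. indicator {- R N..R N} s * h s = h s"
        by eventually_elim (auto simp: indicator_def)
      then show "(\<lambda>N. indicator {- R N..R N} s * h s) \<longlonglongrightarrow> h s" by (rule tendsto_eventually)
    qed
  qed (use int in \<open>auto intro!: AE_I2 simp: indicator_def\<close>)
  moreover have "(\<integral>s. indicator {- R N..R N} s * h s \<partial>lborel) = integral {- R N..R N} h" for N
    using set_borel_integral_eq_integral(2)[of "{- R N..R N}" h] int
      integrable_mult_indicator[of "{- R N..R N}" lborel h]
    by (simp add: set_lebesgue_integral_def set_integrable_def)
  ultimately show ?thesis by simp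
qed

text \<open>Unfolding: integrating the periodised function over one period gives an integral over the line.\<close>

lemma wrap_sum_sine_coeff:
  fixes n :: nat
  assumes a: "0 < a"
  shows "integral {0..pi} (\<lambda>\<theta>. wrap_sum a \<theta> * sin (n * \<theta>)) =
    (\<integral>s. s * exp (- a * s\<^sup>2) * sin (n * s) \<partial>lborel) / 2"
proof -
  let ?h = "\<lambda>s :: real. s * exp (- a * s\<^sup>2) * sin (n * s)"
  let ?R = "\<lambda>N. (2 * real N + 1) * pi"
  \<comment> \<open>For integer \<open>n\<close> the sine does not see the shift by a multiple of
    \<open>2 * pi\<close>, so translating the integrand on the line changes only the Gaussian
    factor.\<close>
  have per: "?h (\<theta> + 2 * pi * of_int k) = wrap_term a k \<theta> * sin (n * \<theta>)" for \<theta> :: real and k :: int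
  proof -
    have "real n * (\<theta> + 2 * pi * of_int k) = n * \<theta> + (2 * pi) * of_int (int n * k)" by (simp add: algebra_simps)
    then have "sin (real n * (\<theta> + 2 * pi * of_int k)) = sin (n * \<theta>)"
      by (simp only: sin_add cos_int_2pin sin_int_2pin mult_1_right mult_zero_right add_0_right)
    then show ?thesis by (simp add: wrap_term_def)
  qed
  have ch: "continuous_on UNIV ?h" by (intro continuous_intros)
  let ?U = "\<lambda>(N::nat) \<theta>::real. (\<Sum>k\<in>{- int N..int N}. wrap_term a k \<theta>) * sin (n * \<theta>)"
  have "filterlim ?R at_top sequentially" by real_asymp
  from tendsto_integral_UNIV[OF gaussian_sine_transform(1)[OF a] this]
  have "(\<lambda>N. integral {- ?R N..?R N} ?h) \<longlonglongrightarrow> (\<integral>s. ?h s \<partial>lborel)" .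
  moreover have "integral {- ?R N..?R N} ?h = integral {-pi..pi} (?U N)" for N
  proof -
    have "integral {- ?R N..?R N} ?h = (\<Sum>k\<in>{- int N..int N}. integral {-pi..pi} (\<lambda>\<theta>. wrap_term a k \<theta> * sin (n * \<theta>)))"
      using integral_periods[OF ch, of N] unfolding per by simp
    also have "\<dots> = integral {-pi..pi} (?U N)"
      unfolding sum_distrib_right
      by (rule integral_sum[symmetric]) (auto intro!: integrable_continuous_real continuous_intros continuous_wrap_term)
    finally show ?thesis .
  qed
  ultimately have lim: "(\<lambda>N. integral {-pi..pi} (?U N)) \<longlonglongrightarrow> (\<integral>s. ?h s \<partial>lborel)" by simp
  have "uniform_limit {-pi..pi} ?U (\<lambda>\<theta>. wrap_sum a \<theta> * sin (n * \<theta>)) sequentially"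
    by (rule uniform_lim_mult[OF wrap_sum_uniform_limit[OF a] uniform_limit_const])
       (rule compact_imp_bounded, rule compact_continuous_image, intro continuous_intros continuous_wrap_sum[OF a], simp)+
  moreover have cU: "continuous_on {-pi..pi} (?U N)" for N
    by (intro continuous_intros continuous_wrap_term)
  ultimately
  have "(\<lambda>N. integral {-pi..pi} (?U N)) \<longlonglongrightarrow> integral {-pi..pi} (\<lambda>\<theta>. wrap_sum a \<theta> * sin (n * \<theta>))"
    by (rule tendsto_integral_uniform_limit)
  with lim have "(\<integral>s. ?h s \<partial>lborel) = integral {-pi..pi} (\<lambda>\<theta>. wrap_sum a \<theta> * sin (n * \<theta>))"
    by (rule LIMSEQ_unique)
  also have "\<dots> = integral {-pi..0} (\<lambda>\<theta>. wrap_sum a \<theta> * sin (n * \<theta>)) + integral {0..pi} (\<lambda>\<theta>. wrap_sum a \<theta> * sin (n * \<theta>))"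
  proof (rule Henstock_Kurzweil_Integration.integral_combine[symmetric])
    show "(\<lambda>\<theta>. wrap_sum a \<theta> * sin (n * \<theta>)) integrable_on {-pi..pi}"
      by (intro integrable_continuous_real continuous_intros continuous_wrap_sum[OF a])
  qed auto
  \<comment> \<open>The integrand is a product of two odd functions, hence even; both halves of the
    period contribute equally.\<close>
  also have "integral {-pi..0} (\<lambda>\<theta>. wrap_sum a \<theta> * sin (n * \<theta>)) = integral {0..pi} (\<lambda>\<theta>. wrap_sum a \<theta> * sin (n * \<theta>))"
  proof -
    have "(\<lambda>\<theta>::real. wrap_sum a (- \<theta>) * sin (n * (- \<theta>))) = (\<lambda>\<theta>::real. wrap_sum a \<theta> * sin (n * \<theta>))"
      by (simp add: wrap_sum_minus)
    then show ?thesis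
      using Henstock_Kurzweil_Integration.integral_reflect_real[of "pi" 0 "\<lambda>\<theta>. wrap_sum a \<theta> * sin (n * \<theta>)"]
      by (simp only: minus_zero)
  qed
  finally show ?thesis by simp
qed

section \<open>The sine series and its first harmonic\<close>

lemma sine_orthogonality:
  fixes m n :: nat
  assumes "m \<noteq> 0" "n \<noteq> 0"
  shows "integral {0..pi} (\<lambda>\<theta>. sin (m * \<theta>) * sin (n * \<theta>)) = (if m = n then pi / 2 else 0)"
proof -
  have cos0: "((\<lambda>\<theta>. cos (k * \<theta>)) has_integral 0) {0..pi}" if "k \<in> \<int>" "k \<noteq> 0" for k :: real
  proof -
    have "((\<lambda>\<theta>. cos (k * \<theta>)) has_integral sin (k * pi) / k - sin (k * 0) / k) {0..pi}"
      using that(2)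
      by (intro fundamental_theorem_of_calculus)
         (auto intro!: derivative_eq_intros simp: has_real_derivative_iff_has_vector_derivative[symmetric])
    moreover have "sin (k * pi) = 0" using that(1) sin_zero_iff_int2 by (auto elim!: Ints_cases)
    ultimately show ?thesis by simp
  qed
  let ?g = "\<lambda>\<theta>. (cos ((real m - real n) * \<theta>) - cos ((real m + real n) * \<theta>)) / 2"
  have eq: "sin (m * \<theta>) * sin (n * \<theta>) = ?g \<theta>" for \<theta> :: real
    by (simp add: sin_times_sin algebra_simps)
  have 1: "((\<lambda>\<theta>. cos ((real m + real n) * \<theta>)) has_integral 0) {0..pi}"
    using assms by (intro cos0) auto
  have "((\<lambda>\<theta>. cos ((real m - real n) * \<theta>)) has_integral (if m = n then pi else 0)) {0..pi}"
  proof (cases "m = n")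
    case True
    then show ?thesis using has_integral_const_real[of "1::real" 0 pi] by simp
  next
    case False
    then show ?thesis using cos0[of "real m - real n"] by simp
  qed
  from has_integral_divide[OF has_integral_diff[OF this 1], of 2]
  have "(?g has_integral (if m = n then pi / 2 else 0)) {0..pi}" by (auto split: if_splits)
  then show ?thesis unfolding eq by (rule integral_unique)
qed

text \<open>Lets the higher harmonics be measured against \<open>sin \<theta>\<close>, so that the
  error of the leading term is relative even where the sine vanishes.\<close>

lemma abs_sin_mult_le:
  assumes "\<theta> \<in> {0..pi}"
  shows "\<bar>sin (real n * \<theta>)\<bar> \<le> n * sin \<theta>"
proof (induction n)
  case (Suc n)
  have s: "0 \<le> sin \<theta>" using assms by (simp add: sin_ge_zero)
  have "\<bar>sin (real (Suc n) * \<theta>)\<bar> \<le> \<bar>sin (n * \<theta>) * cos \<theta>\<bar> + \<bar>cos (n * \<theta>) * sin \<theta>\<bar>"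
    by (simp add: algebra_simps sin_add)
  also have "\<dots> \<le> \<bar>sin (n * \<theta>)\<bar> * 1 + 1 * \<bar>sin \<theta>\<bar>"
    unfolding abs_mult by (intro add_mono mult_mono) auto
  finally show ?case using Suc s by (simp add: algebra_simps)
qed simp

lemma summable_pow_gaussian:
  fixes a :: real
  assumes "0 < a"
  shows "summable (\<lambda>m::nat. real m * exp (- (real m)\<^sup>2 / (4 * a)))"
proof (rule summable_comparison_test_bigo)
  show "summable (\<lambda>n. norm ((1/2::real) ^ n))" by (simp add: summable_geometric)
  show "(\<lambda>m::nat. real m * exp (- (real m)\<^sup>2 / (4 * a))) \<in> O(\<lambda>n. (1 / 2) ^ n)"
    using assms by real_asymp
qed

text \<open>Both sides are continuous and have the same sine coefficients, so
  \<open>fourier_sine_unique\<close> applies to their difference. The m-th coefficient is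
  \<open>2 / pi\<close> times the integral over \<open>{0..pi}\<close>, which by unfolding is half
  of the Gaussian sine transform on the line.\<close>

lemma wrap_sum_sine_series:
  assumes a: "0 < a" and \<theta>: "\<theta> \<in> {0<..<pi}"
  shows "(\<lambda>m. sqrt (2 * pi) / sqrt (2 * a) ^ 3 / pi * (real m * exp (- (real m)\<^sup>2 / (4 * a))) * sin (real m * \<theta>))
    sums wrap_sum a \<theta>"
proof -
  define K where "K = sqrt (2 * pi) / sqrt (2 * a) ^ 3"
  define b where "b m = K / pi * (real m * exp (- (real m)\<^sup>2 / (4 * a)))" for m :: nat
  have b: "0 \<le> b m" for m using a by (simp add: b_def K_def)
  have bs: "summable b" unfolding b_def by (intro summable_mult summable_pow_gaussian a)
  have bb: "\<bar>b m * sin (real m * \<theta>)\<bar> \<le> b m" for m \<theta>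
    using b[of m] by (simp add: abs_mult mult_left_le)
  let ?G = "\<lambda>\<theta>. \<Sum>m. b m * sin (real m * \<theta>)"
  have ul: "uniform_limit {0..pi} (\<lambda>N \<theta>. \<Sum>m<N. b m * sin (real m * \<theta>)) ?G sequentially"
    by (rule Weierstrass_m_test[OF _ bs]) (simp add: bb)
  have cG: "continuous_on {0..pi} ?G"
    by (rule uniform_limit_theorem[OF _ ul]) (auto intro!: always_eventually continuous_intros)
  have cF: "continuous_on {0..pi} (wrap_sum a)"
    by (rule continuous_on_subset[OF continuous_wrap_sum[OF a]]) auto
  have "wrap_sum a \<theta> - ?G \<theta> = 0"
  proof (rule fourier_sine_unique[OF _ _ \<theta>])
    show "continuous_on {0..pi} (\<lambda>\<theta>. wrap_sum a \<theta> - ?G \<theta>)" by (intro continuous_intros cG cF)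
    fix n :: nat
    have ul': "uniform_limit {0..pi} (\<lambda>N \<theta>. (\<Sum>m<N. b m * sin (real m * \<theta>)) * sin (n * \<theta>))
      (\<lambda>\<theta>. ?G \<theta> * sin (n * \<theta>)) sequentially"
    proof (rule uniform_lim_mult[OF ul uniform_limit_const])
      show "bounded (?G ` {0..pi})" by (intro compact_imp_bounded compact_continuous_image cG compact_Icc)
      show "bounded ((\<lambda>\<theta>. sin (real n * \<theta>)) ` {0..pi})"
        by (intro compact_imp_bounded compact_continuous_image compact_Icc continuous_intros)
    qed
    have "(\<lambda>N. integral {0..pi} (\<lambda>\<theta>. (\<Sum>m<N. b m * sin (real m * \<theta>)) * sin (n * \<theta>))) \<longlonglongrightarrow>
      integral {0..pi} (\<lambda>\<theta>. ?G \<theta> * sin (n * \<theta>))"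
      by (rule tendsto_integral_uniform_limit[OF ul']) (intro continuous_intros)
    moreover have "integral {0..pi} (\<lambda>\<theta>. (\<Sum>m<N. b m * sin (real m * \<theta>)) * sin (n * \<theta>)) = b n * (pi / 2)"
      if "N > n" for N
    proof -
      have "integral {0..pi} (\<lambda>\<theta>. (\<Sum>m<N. b m * sin (real m * \<theta>)) * sin (n * \<theta>)) =
        integral {0..pi} (\<lambda>\<theta>. \<Sum>m<N. b m * (sin (real m * \<theta>) * sin (n * \<theta>)))"
        by (simp only: sum_distrib_right mult.assoc)
      also have "\<dots> = (\<Sum>m<N. integral {0..pi} (\<lambda>\<theta>. b m * (sin (real m * \<theta>) * sin (n * \<theta>))))"
        by (rule integral_sum) (auto intro!: integrable_continuous_real continuous_intros)
      also have "\<dots> = (\<Sum>m<N. if m = n then b n * (pi / 2) else 0)"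
      proof (rule sum.cong[OF refl])
        fix m
        \<comment> \<open>Orthogonality needs nonzero frequencies. For frequency 0 the integral is
          0, in accordance with \<open>b 0 = 0\<close>.\<close>
        show "integral {0..pi} (\<lambda>\<theta>. b m * (sin (real m * \<theta>) * sin (n * \<theta>))) = (if m = n then b n * (pi / 2) else 0)"
          using sine_orthogonality[of m n] by (cases "m = 0"; cases "n = 0") (auto simp: b_def)
      qed
      also have "\<dots> = b n * (pi / 2)" using that by simp
      finally show ?thesis .
    qed
    then have "(\<lambda>N. integral {0..pi} (\<lambda>\<theta>. (\<Sum>m<N. b m * sin (real m * \<theta>)) * sin (n * \<theta>))) \<longlonglongrightarrow> b n * (pi / 2)"
      by (intro tendsto_eventually eventually_mono[OF eventually_gt_at_top[of n]]) auto
    ultimately have G: "integral {0..pi} (\<lambda>\<theta>. ?G \<theta> * sin (n * \<theta>)) = b n * (pi / 2)"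
      by (rule LIMSEQ_unique)
    have F: "integral {0..pi} (\<lambda>\<theta>. wrap_sum a \<theta> * sin (n * \<theta>)) = b n * (pi / 2)"
      unfolding wrap_sum_sine_coeff[OF a] gaussian_sine_transform(2)[OF a] by (simp add: b_def K_def)
    have "integral {0..pi} (\<lambda>\<theta>. (wrap_sum a \<theta> - ?G \<theta>) * sin (n * \<theta>)) =
      integral {0..pi} (\<lambda>\<theta>. wrap_sum a \<theta> * sin (n * \<theta>)) - integral {0..pi} (\<lambda>\<theta>. ?G \<theta> * sin (n * \<theta>))"
      unfolding left_diff_distrib
      by (intro Henstock_Kurzweil_Integration.integral_diff integrable_continuous_real continuous_intros cG cF)
    then show "integral {0..pi} (\<lambda>\<theta>. (wrap_sum a \<theta> - ?G \<theta>) * sin (n * \<theta>)) = 0" using F G by simp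
  qed
  moreover have "summable (\<lambda>m. b m * sin (real m * \<theta>))"
    by (rule summable_comparison_test'[OF bs]) (use bb in auto)
  ultimately have "(\<lambda>m. b m * sin (real m * \<theta>)) sums wrap_sum a \<theta>" by (simp add: sums_iff)
  then show ?thesis by (simp only: b_def K_def)
qed

text \<open>Constant for the sum of all harmonics from the second on, once the decay has been
  weakened to powers of 1/2. One factor \<open>m\<close> is the size of the coefficient, the other
  comes from \<open>abs_sin_mult_le\<close>.\<close>

definition tail_const :: real where
  "tail_const = (\<Sum>m. (real m)\<^sup>2 * (1 / 2) ^ m)"

lemma summable_tail_const: "summable (\<lambda>m. (real m)\<^sup>2 * (1 / 2::real) ^ m)"
proof (rule summable_comparison_test_bigo)
  show "summable (\<lambda>n. norm ((2/3::real) ^ n))" by (simp add: summable_geometric)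
  show "(\<lambda>m. (real m)\<^sup>2 * (1 / 2::real) ^ m) \<in> O(\<lambda>n. (2 / 3) ^ n)" by real_asymp
qed

text \<open>The m-th coefficient carries \<open>q\<close> to the power \<open>m^2\<close>, where the
  first harmonic has only \<open>q\<close>. The bound has the factor \<open>sin \<theta>\<close> on
  both sides, so it is an estimate of the relative error, uniform on the open interval.\<close>

lemma wrap_sum_leading_term:
  fixes a \<theta> :: real
  defines "q \<equiv> exp (- 1 / (4 * a))"
  defines "b \<equiv> sqrt (2 * pi) / sqrt (2 * a) ^ 3 / pi * q"
  assumes a: "0 < a" and q: "q \<le> 1 / 2" and \<theta>: "\<theta> \<in> {0<..<pi}"
  shows "\<bar>wrap_sum a \<theta> - b * sin \<theta>\<bar> \<le> tail_const * q * (b * sin \<theta>)"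
proof -
  define K where "K = sqrt (2 * pi) / sqrt (2 * a) ^ 3 / pi"
  have K: "0 \<le> K" using a by (simp add: K_def)
  have s: "0 < sin \<theta>" using \<theta> by (simp add: sin_gt_zero)
  have q0: "0 < q" by (simp add: q_def)
  let ?f = "\<lambda>m. K * (real m * exp (- (real m)\<^sup>2 / (4 * a))) * sin (real m * \<theta>)"
  have qp: "exp (- (real m)\<^sup>2 / (4 * a)) = q ^ (m\<^sup>2)" for m :: nat
    by (simp add: q_def exp_of_nat_mult[symmetric])
  have sums: "?f sums wrap_sum a \<theta>"
    using wrap_sum_sine_series[OF a \<theta>] by (simp add: K_def)
  have "(\<lambda>m. if m = 1 then b * sin \<theta> else 0) sums (b * sin \<theta>)"
    by (rule sums_single)
  from sums_diff[OF sums this]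
  have d: "(\<lambda>m. ?f m - (if m = 1 then b * sin \<theta> else 0)) sums (wrap_sum a \<theta> - b * sin \<theta>)" .
  have bd: "norm (?f m - (if m = 1 then b * sin \<theta> else 0)) \<le> q * (b * sin \<theta>) * ((real m)\<^sup>2 * (1 / 2) ^ m)" for m
  proof -
    consider "m = 0" | "m = 1" | "m \<ge> 2" by linarith
    then show ?thesis
    proof cases
      case 2
      have "b = K * q" by (simp add: b_def K_def)
      then show ?thesis using 2 qp[of 1] q0 s K by simp
    next
      case 3
      \<comment> \<open>Leaves two spare powers of \<open>q\<close>: one is the \<open>q\<close>
        inside \<open>b\<close>, the other is the small factor of the error.\<close>
      have m2: "m + 2 \<le> m\<^sup>2"
      proof -
        have "2 * m \<le> m * m" using 3 by (intro mult_right_mono) auto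
        then show ?thesis using 3 unfolding power2_eq_square by linarith
      qed
      have "q ^ (m\<^sup>2) \<le> q ^ (m + 2)" using m2 q0 q by (intro power_decreasing) auto
      also have "\<dots> = q ^ m * q\<^sup>2" by (rule power_add)
      also have "\<dots> \<le> (1 / 2) ^ m * q\<^sup>2" using q0 q by (intro mult_right_mono power_mono) auto
      finally have qm: "q ^ (m\<^sup>2) \<le> (1 / 2) ^ m * q\<^sup>2" .
      have "norm (?f m) = K * (real m * q ^ (m\<^sup>2)) * \<bar>sin (real m * \<theta>)\<bar>"
        unfolding qp using K q0 by (simp add: abs_mult)
      also have "\<dots> \<le> K * (real m * ((1 / 2) ^ m * q\<^sup>2)) * (m * sin \<theta>)"
        using qm abs_sin_mult_le[of \<theta> m] \<theta> K q0 by (intro mult_mono mult_left_mono mult_nonneg_nonneg) auto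
      also have "\<dots> = q * (b * sin \<theta>) * ((real m)\<^sup>2 * (1 / 2) ^ m)"
        by (simp add: b_def K_def power2_eq_square)
      finally show ?thesis using 3 by simp
    qed simp
  qed
  have "norm (\<Sum>m. ?f m - (if m = 1 then b * sin \<theta> else 0)) \<le> (\<Sum>m. q * (b * sin \<theta>) * ((real m)\<^sup>2 * (1 / 2) ^ m))"
    by (rule norm_suminf_le[OF bd summable_mult[OF summable_tail_const]])
  also have "\<dots> = tail_const * q * (b * sin \<theta>)"
    unfolding tail_const_def using suminf_mult[OF summable_tail_const] by simp
  finally show ?thesis using d by (simp add: sums_iff)
qed

text \<open>With \<open>\<theta> = \<pi> y / t\<close> the exponent \<open>2 (k y + k\<^sup>2 t)\<close> is \<open>((y + 2 k t)\<^sup>2 - y\<^sup>2) / (2 t)\<close>.\<close>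

lemma phi0_eq_wrap_sum:
  assumes t: "0 < t"
  shows "phi0 y t = exp (y\<^sup>2 / (2 * t)) * (t / pi) * wrap_sum (t / (2 * pi\<^sup>2)) (pi * y / t)"
proof -
  have "(y + 2 * of_int k * t) * exp (- 2 * (of_int k * y + (of_int k)\<^sup>2 * t)) =
    exp (y\<^sup>2 / (2 * t)) * (t / pi) * wrap_term (t / (2 * pi\<^sup>2)) k (pi * y / t)" for k :: int
  proof -
    have 1: "pi * y / t + 2 * pi * of_int k = (pi / t) * (y + 2 * of_int k * t)" using t by (simp add: field_simps)
    have 2: "- (t / (2 * pi\<^sup>2)) * ((pi / t) * (y + 2 * of_int k * t))\<^sup>2 = - (y + 2 * of_int k * t)\<^sup>2 / (2 * t)"
      using t by (simp add: field_simps power2_eq_square)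
    have 3: "exp (- 2 * (of_int k * y + (of_int k)\<^sup>2 * t)) = exp (y\<^sup>2 / (2 * t)) * exp (- (y + 2 * of_int k * t)\<^sup>2 / (2 * t))"
      unfolding exp_add[symmetric] using t by (simp add: field_simps power2_eq_square)
    show ?thesis unfolding wrap_term_def 1 2 3 using t by simp
  qed
  then have "phi0 y t = (\<Sum>\<^sub>\<infinity>k. exp (y\<^sup>2 / (2 * t)) * (t / pi) * wrap_term (t / (2 * pi\<^sup>2)) k (pi * y / t))"
    unfolding phi0_def by simp
  also have "\<dots> = exp (y\<^sup>2 / (2 * t)) * (t / pi) * wrap_sum (t / (2 * pi\<^sup>2)) (pi * y / t)"
    unfolding wrap_sum_def by (rule infsum_cmult_right')
  finally show ?thesis .
qed

text \<open>The first harmonic of \<open>wrap_sum\<close> at \<open>a = t / (2 * pi^2)\<close>,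
  multiplied by the prefactor of \<open>phi0_eq_wrap_sum\<close>; here
  \<open>sqrt (2 * a) = sqrt t / pi\<close> and \<open>1 / (4 * a) = pi^2 / (2 * t)\<close>.\<close>

definition phi0_lead :: "real \<Rightarrow> real \<Rightarrow> real" where
  "phi0_lead y t = exp (y\<^sup>2 / (2 * t)) * (pi * sqrt (2 * pi) / sqrt t) * exp (- pi\<^sup>2 / (2 * t)) * sin (pi * y / t)"

lemma phi0_leading_term:
  assumes t: "0 < t" "exp (- pi\<^sup>2 / (2 * t)) \<le> 1 / 2" and y: "0 < y" "y < t"
  shows "\<bar>phi0 y t - phi0_lead y t\<bar> \<le> tail_const * exp (- pi\<^sup>2 / (2 * t)) * phi0_lead y t"
proof -
  let ?a = "t / (2 * pi\<^sup>2)" and ?\<theta> = "pi * y / t"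
  define b where "b = sqrt (2 * pi) / sqrt (2 * ?a) ^ 3 / pi * exp (- 1 / (4 * ?a))"
  have a: "0 < ?a" using t by simp
  have e: "- 1 / (4 * ?a) = - pi\<^sup>2 / (2 * t)" using t by (simp add: field_simps)
  have \<theta>: "?\<theta> \<in> {0<..<pi}" using t y by (simp add: field_simps)
  have w: "\<bar>wrap_sum ?a ?\<theta> - b * sin ?\<theta>\<bar> \<le> tail_const * exp (- pi\<^sup>2 / (2 * t)) * (b * sin ?\<theta>)"
    using wrap_sum_leading_term[OF a _ \<theta>] t(2) unfolding b_def e by simp
  have st: "sqrt (2 * ?a) = sqrt t / pi" using t by (simp add: real_sqrt_divide)
  have lead: "phi0_lead y t = exp (y\<^sup>2 / (2 * t)) * (t / pi) * (b * sin ?\<theta>)"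
  proof -
    have "sqrt t ^ 3 = t * sqrt t" using t by (simp add: power3_eq_cube)
    then have "pi * sqrt (2 * pi) / sqrt t = t / pi * (sqrt (2 * pi) / sqrt (2 * ?a) ^ 3 / pi)"
      unfolding st using t by (simp add: power_divide field_simps power3_eq_cube)
    then show ?thesis unfolding phi0_lead_def b_def e by (simp only: mult_ac)
  qed
  let ?E = "exp (y\<^sup>2 / (2 * t)) * (t / pi)"
  have "\<bar>phi0 y t - phi0_lead y t\<bar> = ?E * \<bar>wrap_sum ?a ?\<theta> - b * sin ?\<theta>\<bar>"
    unfolding phi0_eq_wrap_sum[OF t(1)] lead right_diff_distrib[symmetric] using t by (simp add: abs_mult)
  also have "\<dots> \<le> ?E * (tail_const * exp (- pi\<^sup>2 / (2 * t)) * (b * sin ?\<theta>))"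
    using w t by (intro mult_left_mono) auto
  also have "\<dots> = tail_const * exp (- pi\<^sup>2 / (2 * t)) * phi0_lead y t"
    unfolding lead by simp
  finally show ?thesis .
qed

section \<open>Short-time asymptotics of \<open>phi0\<close>\<close>

definition phi_ratio :: "real \<Rightarrow> real \<Rightarrow> real \<Rightarrow> real \<Rightarrow> real \<Rightarrow> real" where
  "phi_ratio x u t c z = phi0c c z (t + u / c) / phi0c c x (u / c)"

text \<open>The quotient of the two values of \<open>phi0_lead\<close> after cancellation of
  everything singular in \<open>c\<close>: each factor is continuous at \<open>c = 0\<close>, so the
  limit is read off by evaluation there.\<close>

definition lead_ratio :: "real \<Rightarrow> real \<Rightarrow> real \<Rightarrow> real \<Rightarrow> real \<Rightarrow> real" where
  "lead_ratio x u t c z = exp (c * z\<^sup>2 / (2 * (c * t + u)) - c * x\<^sup>2 / (2 * u)) * sqrt (u / (c * t + u)) *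
     exp (pi\<^sup>2 * t / (2 * u * (c * t + u))) * (sin (pi * z / (c * t + u)) / sin (pi * x / u))"

lemma lead_ratio_eq:
  assumes c: "0 < c" and u: "0 < u" and t: "0 \<le> t"
  shows "phi0_lead (c * z) (c * (c * t + u)) / phi0_lead (c * x) (c * u) = lead_ratio x u t c z"
proof -
  let ?v = "c * t + u"
  have v: "0 < ?v" using c u t by (intro add_nonneg_pos) auto
  have 1: "(c * z)\<^sup>2 / (2 * (c * ?v)) = c * z\<^sup>2 / (2 * ?v)" "(c * x)\<^sup>2 / (2 * (c * u)) = c * x\<^sup>2 / (2 * u)"
    using c v u by (simp_all add: power2_eq_square)
  have 2: "pi * (c * z) / (c * ?v) = pi * z / ?v" "pi * (c * x) / (c * u) = pi * x / u"
    using c by simp_all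
  \<comment> \<open>Both exponents are of order \<open>1 / c\<close>, but the factor
    \<open>c * t\<close> in their difference cancels this. At \<open>c = 0\<close> the result is the
    exponent of the Doob transform.\<close>
  have 3: "- pi\<^sup>2 / (2 * (c * ?v)) - (- pi\<^sup>2 / (2 * (c * u))) = pi\<^sup>2 * t / (2 * u * ?v)"
  proof -
    have "- pi\<^sup>2 / (2 * (c * v)) - (- pi\<^sup>2 / (2 * (c * u))) = pi\<^sup>2 * (v - u) / (2 * c * u * v)" if "0 < v" for v
      using that c u by (simp add: field_simps)
    from this[OF v] show ?thesis using c by simp
  qed
  have 4: "(pi * sqrt (2 * pi) / sqrt (c * ?v)) / (pi * sqrt (2 * pi) / sqrt (c * u)) = sqrt (u / ?v)"
    using c v u by (simp add: real_sqrt_mult real_sqrt_divide)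
  have "phi0_lead (c * z) (c * ?v) / phi0_lead (c * x) (c * u) =
    (exp (c * z\<^sup>2 / (2 * ?v)) / exp (c * x\<^sup>2 / (2 * u))) *
    ((pi * sqrt (2 * pi) / sqrt (c * ?v)) / (pi * sqrt (2 * pi) / sqrt (c * u))) *
    (exp (- pi\<^sup>2 / (2 * (c * ?v))) / exp (- pi\<^sup>2 / (2 * (c * u)))) *
    (sin (pi * z / ?v) / sin (pi * x / u))"
    unfolding phi0_lead_def 1 2 by (simp only: times_divide_times_eq)
  then show ?thesis unfolding exp_diff[symmetric] 3 4 lead_ratio_def .
qed

lemma lead_ratio_tendsto:
  assumes "0 < u"
  shows "((\<lambda>c. lead_ratio x u t c z) \<longlongrightarrow> sin (pi * z / u) / sin (pi * x / u) * exp (pi\<^sup>2 / u\<^sup>2 * (t / 2))) (at_right 0)"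
proof -
  have "isCont (\<lambda>c. lead_ratio x u t c z) 0"
    unfolding lead_ratio_def divide_inverse using assms by (intro continuous_intros) auto
  then have "((\<lambda>c. lead_ratio x u t c z) \<longlongrightarrow> lead_ratio x u t 0 z) (at_right 0)"
    unfolding isCont_def by (rule tendsto_mono[OF at_le, rotated]) simp
  moreover have "lead_ratio x u t 0 z = sin (pi * z / u) / sin (pi * x / u) * exp (pi\<^sup>2 / u\<^sup>2 * (t / 2))"
    using assms by (simp add: lead_ratio_def power2_eq_square)
  ultimately show ?thesis by simp
qed

context
  fixes x u t :: real
  assumes x: "0 < x" "x < u" and t: "0 \<le> t"
begin

lemma phi0c_eq_phi0: "0 < c \<Longrightarrow> phi0c c z (s + u / c) = phi0 (c * z) (c * (c * s + u))"
  unfolding phi0c_def by (simp add: power2_eq_square algebra_simps)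

lemma phi0_error_tendsto:
  "0 \<le> s \<Longrightarrow> ((\<lambda>c. exp (- pi\<^sup>2 / (2 * (c * (c * s + u))))) \<longlongrightarrow> 0) (at_right 0)"
proof -
  assume s: "0 \<le> s"
  have u: "0 < u" using x by simp
  have "filterlim (\<lambda>c. c * (c * s + u)) (at_right 0) (at_right 0)"
    unfolding filterlim_at
  proof
    show "((\<lambda>c. c * (c * s + u)) \<longlongrightarrow> 0) (at_right 0)" by (auto intro!: tendsto_eq_intros)
    show "\<forall>\<^sub>F c in at_right 0. c * (c * s + u) \<in> {0<..} \<and> c * (c * s + u) \<noteq> 0"
      using eventually_at_right_less[of "0::real"]
    proof eventually_elim
      case (elim c)
      then have "0 < c * s + u" using s u by (intro add_nonneg_pos) auto
      with elim show ?case by simp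
    qed
  qed
  moreover have "((\<lambda>v::real. exp (- pi\<^sup>2 / (2 * v))) \<longlongrightarrow> 0) (at_right 0)" by real_asymp
  ultimately show ?thesis by (rule filterlim_compose[rotated])
qed

text \<open>One threshold for \<open>c\<close> serves all \<open>z\<close> in the moving interval,
  even near its ends, where both functions tend to 0. This uniformity gives the bound for dominated
  convergence later on.\<close>

lemma phi0_relative_error:
  assumes s: "0 \<le> s"
  shows "\<forall>\<^sub>F c in at_right 0. \<forall>z. 0 < z \<and> z < c * s + u \<longrightarrow>
     0 < phi0_lead (c * z) (c * (c * s + u)) \<and>
     \<bar>phi0 (c * z) (c * (c * s + u)) / phi0_lead (c * z) (c * (c * s + u)) - 1\<bar>
       \<le> tail_const * exp (- pi\<^sup>2 / (2 * (c * (c * s + u))))"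
proof -
  have "\<forall>\<^sub>F c in at_right 0. exp (- pi\<^sup>2 / (2 * (c * (c * s + u)))) < 1 / 2"
    by (rule order_tendstoD[OF phi0_error_tendsto[OF s]]) simp
  then show ?thesis using eventually_at_right_less[of "0::real"]
  proof eventually_elim
    case (elim c)
    show ?case
    proof (intro allI impI)
      fix z assume z: "0 < z \<and> z < c * s + u"
      let ?v = "c * (c * s + u)"
      have v: "0 < c * s + u" using z by linarith
      have v': "0 < ?v" using v elim by simp
      have "0 < pi * (c * z) / ?v" "pi * (c * z) / ?v < pi"
      proof -
        have "pi * (c * z) / ?v = pi * (z / (c * s + u))" using elim by simp
        moreover have w: "0 < z / (c * s + u)" "z / (c * s + u) < 1" using z v by simp_all
        moreover note mult_strict_left_mono[OF w(2) pi_gt_zero]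
        ultimately show "0 < pi * (c * z) / ?v" "pi * (c * z) / ?v < pi"
          by (simp_all only: mult_pos_pos pi_gt_zero mult_1_right)
      qed
      then have "0 < sin (pi * (c * z) / ?v)" by (rule sin_gt_zero)
      then have pos: "0 < phi0_lead (c * z) ?v"
        unfolding phi0_lead_def using v' by (intro mult_pos_pos divide_pos_pos) auto
      have "\<bar>phi0 (c * z) ?v - phi0_lead (c * z) ?v\<bar> \<le> tail_const * exp (- pi\<^sup>2 / (2 * ?v)) * phi0_lead (c * z) ?v"
        by (rule phi0_leading_term) (use z elim v' in auto)
      then have "\<bar>phi0 (c * z) ?v - phi0_lead (c * z) ?v\<bar> / phi0_lead (c * z) ?v \<le> tail_const * exp (- pi\<^sup>2 / (2 * ?v))"
        using pos by (simp add: pos_divide_le_eq)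
      moreover have "\<bar>phi0 (c * z) ?v - phi0_lead (c * z) ?v\<bar> / phi0_lead (c * z) ?v =
        \<bar>phi0 (c * z) ?v / phi0_lead (c * z) ?v - 1\<bar>"
        using pos by (simp add: diff_divide_distrib[symmetric] abs_divide divide_diff_eq_iff)
      ultimately show "0 < phi0_lead (c * z) ?v \<and>
          \<bar>phi0 (c * z) ?v / phi0_lead (c * z) ?v - 1\<bar> \<le> tail_const * exp (- pi\<^sup>2 / (2 * ?v))"
        using pos by simp
    qed
  qed
qed

text \<open>Splits the density into two relative errors, each close to 1, and the explicit
  \<open>lead_ratio\<close>. The denominator is written with \<open>c * 0 + u\<close> so that it is
  the case \<open>s = 0\<close> of the same estimates.\<close>

lemma phi_ratio_factor:
  assumes c: "0 < c" and L: "phi0_lead (c * z) (c * (c * t + u)) \<noteq> 0" "phi0_lead (c * x) (c * (c * 0 + u)) \<noteq> 0"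
  shows "phi_ratio x u t c z = (phi0 (c * z) (c * (c * t + u)) / phi0_lead (c * z) (c * (c * t + u))) /
    (phi0 (c * x) (c * (c * 0 + u)) / phi0_lead (c * x) (c * (c * 0 + u))) * lead_ratio x u t c z"
proof -
  have "phi0c c x (u / c) = phi0 (c * x) (c * (c * 0 + u))" using phi0c_eq_phi0[OF c, of x 0] by simp
  moreover have "lead_ratio x u t c z = phi0_lead (c * z) (c * (c * t + u)) / phi0_lead (c * x) (c * (c * 0 + u))"
    using lead_ratio_eq[OF c _ t, of u z x] x by simp
  ultimately show ?thesis unfolding phi_ratio_def phi0c_eq_phi0[OF c] using L by simp
qed

text \<open>A relative error below 1 forces \<open>phi0\<close> to have the sign of the positive
  leading term, both in the numerator and in the denominator.\<close>

lemma phi_ratio_nonneg: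
  "\<forall>\<^sub>F c in at_right 0. \<forall>z. 0 < z \<and> z < c * t + u \<longrightarrow> 0 \<le> phi_ratio x u t c z"
proof -
  have small: "\<forall>\<^sub>F c in at_right 0. tail_const * exp (- pi\<^sup>2 / (2 * (c * (c * s + u)))) < 1" if "0 \<le> s" for s
    by (rule order_tendstoD[OF tendsto_mult_right_zero[OF phi0_error_tendsto[OF that]]]) simp
  show ?thesis
    using phi0_relative_error[OF t] phi0_relative_error[OF order_refl] eventually_at_right_less[of "0::real"]
      small[OF t] small[OF order_refl]
  proof eventually_elim
    case (elim c)
    have pos: "0 \<le> phi0 y v" if "0 < phi0_lead y v" "\<bar>phi0 y v / phi0_lead y v - 1\<bar> \<le> d" "d < 1" for y v d
    proof -
      have "0 < phi0 y v / phi0_lead y v" using that(2,3) by linarith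
      then show ?thesis using that(1) by (simp add: zero_less_divide_iff)
    qed
    show ?case
    proof (intro allI impI)
      fix z assume z: "0 < z \<and> z < c * t + u"
      have "0 \<le> phi0 (c * z) (c * (c * t + u))"
        using elim(1)[rule_format, OF z] pos elim(4) by blast
      moreover have "0 \<le> phi0 (c * x) (c * (c * 0 + u))"
        using elim(2)[rule_format, of x] pos elim(5) x by auto
      ultimately show "0 \<le> phi_ratio x u t c z"
        using phi0c_eq_phi0[OF elim(3), of z t] phi0c_eq_phi0[OF elim(3), of x 0] by (simp add: phi_ratio_def)
    qed
  qed
qed

text \<open>The endpoint \<open>z = u\<close> is included: for \<open>t > 0\<close> it lies strictly
  below \<open>c * t + u\<close> for every positive \<open>c\<close>. It has to be, because a path
  in the limiting event may be at \<open>u\<close> at time \<open>t\<close>.\<close>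

lemma phi_ratio_tendsto:
  assumes z: "0 < z" "z \<le> u" and t0: "0 < t"
  shows "((\<lambda>c. phi_ratio x u t c z) \<longlongrightarrow> sin (pi * z / u) / sin (pi * x / u) * exp (pi\<^sup>2 / u\<^sup>2 * (t / 2))) (at_right 0)"
proof -
  have lim1: "((\<lambda>c. phi0 (c * y) (c * (c * s + u)) / phi0_lead (c * y) (c * (c * s + u))) \<longlongrightarrow> 1) (at_right 0)"
    if s: "0 \<le> s" and y: "\<And>c. 0 < c \<Longrightarrow> 0 < y \<and> y < c * s + u" for s y
  proof -
    have "((\<lambda>c. phi0 (c * y) (c * (c * s + u)) / phi0_lead (c * y) (c * (c * s + u)) - 1) \<longlongrightarrow> 0) (at_right 0)"
    proof (rule Lim_null_comparison)
      show "\<forall>\<^sub>F c in at_right 0. norm (phi0 (c * y) (c * (c * s + u)) / phi0_lead (c * y) (c * (c * s + u)) - 1)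
         \<le> tail_const * exp (- pi\<^sup>2 / (2 * (c * (c * s + u))))"
        using phi0_relative_error[OF s] eventually_at_right_less[of "0::real"]
        by eventually_elim (use y in auto)
      show "((\<lambda>c. tail_const * exp (- pi\<^sup>2 / (2 * (c * (c * s + u))))) \<longlongrightarrow> 0) (at_right 0)"
        by (rule tendsto_mult_right_zero[OF phi0_error_tendsto[OF s]])
    qed
    then show ?thesis by (simp add: LIM_zero_iff)
  qed
  have yz: "0 < z \<and> z < c * t + u" if "0 < c" for c
    using that z t0 by (simp add: add_strict_increasing)
  have yx: "0 < x \<and> x < c * 0 + u" for c using x by simp
  have "((\<lambda>c. (phi0 (c * z) (c * (c * t + u)) / phi0_lead (c * z) (c * (c * t + u))) /
    (phi0 (c * x) (c * (c * 0 + u)) / phi0_lead (c * x) (c * (c * 0 + u))) * lead_ratio x u t c z)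
    \<longlongrightarrow> 1 / 1 * (sin (pi * z / u) / sin (pi * x / u) * exp (pi\<^sup>2 / u\<^sup>2 * (t / 2)))) (at_right 0)"
    using x by (intro tendsto_mult tendsto_divide lead_ratio_tendsto lim1 t yz yx) auto
  moreover have "\<forall>\<^sub>F c in at_right 0. phi_ratio x u t c z =
    (phi0 (c * z) (c * (c * t + u)) / phi0_lead (c * z) (c * (c * t + u))) /
    (phi0 (c * x) (c * (c * 0 + u)) / phi0_lead (c * x) (c * (c * 0 + u))) * lead_ratio x u t c z"
    using phi0_relative_error[OF t] phi0_relative_error[OF order_refl] eventually_at_right_less[of "0::real"]
    by eventually_elim (intro phi_ratio_factor; use yz yx in force)
  ultimately show ?thesis by (simp add: filterlim_cong)
qed

text \<open>Since \<open>z\<close> lies below the barrier and \<open>c < 1\<close>, the quadratic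
  exponent is at most \<open>(c * t + u) / 2\<close>; the other factors are controlled by
  \<open>u \<le> c * t + u\<close>.\<close>

lemma lead_ratio_bound:
  assumes c: "0 < c" "c < 1" and z: "0 < z" "z < c * t + u"
  shows "\<bar>lead_ratio x u t c z\<bar> \<le> exp (t + u) * exp (pi\<^sup>2 * t / (2 * u * u)) / sin (pi * x / u)"
proof -
  have u: "0 < u" using x by simp
  have s: "0 < sin (pi * x / u)" using x by (intro sin_gt_zero) (auto simp: field_simps)
  have v: "u \<le> c * t + u" "c * t + u \<le> t + u" using c t by (auto simp: mult_left_le_one_le)
  have v0: "0 < c * t + u" using v u by linarith
  have "z\<^sup>2 \<le> (c * t + u)\<^sup>2" using z by (intro power_mono) auto
  then have "c * z\<^sup>2 \<le> 1 * (c * t + u)\<^sup>2" using c by (intro mult_mono) auto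
  then have "c * z\<^sup>2 / (2 * (c * t + u)) \<le> (c * t + u)\<^sup>2 / (2 * (c * t + u))"
    using v0 by (intro divide_right_mono) auto
  also have "\<dots> = (c * t + u) / 2" using v0 by (simp only: power2_eq_square) (metis less_irrefl nonzero_mult_divide_mult_cancel_left2)
  also have "\<dots> \<le> t + u" using v v0 by simp
  finally have e1: "c * z\<^sup>2 / (2 * (c * t + u)) - c * x\<^sup>2 / (2 * u) \<le> t + u"
    using c u by (smt (verit) divide_nonneg_pos mult_nonneg_nonneg zero_le_power2)
  have e2: "sqrt (u / (c * t + u)) \<le> 1" using u v v0 by simp
  have e3: "pi\<^sup>2 * t / (2 * u * (c * t + u)) \<le> pi\<^sup>2 * t / (2 * u * u)"
    using u v t v0 by (intro divide_left_mono mult_left_mono mult_pos_pos) auto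
  have "\<bar>lead_ratio x u t c z\<bar> = exp (c * z\<^sup>2 / (2 * (c * t + u)) - c * x\<^sup>2 / (2 * u)) * sqrt (u / (c * t + u)) *
     exp (pi\<^sup>2 * t / (2 * u * (c * t + u))) * (\<bar>sin (pi * z / (c * t + u))\<bar> / sin (pi * x / u))"
    unfolding lead_ratio_def using s u v0 by (simp add: abs_mult)
  also have "\<dots> \<le> exp (t + u) * 1 * exp (pi\<^sup>2 * t / (2 * u * u)) * (1 / sin (pi * x / u))"
    using e1 e2 e3 s u v0 by (intro mult_mono divide_right_mono) auto
  finally show ?thesis by simp
qed

lemma phi_ratio_bounded:
  obtains B where "0 < B" "\<forall>\<^sub>F c in at_right 0. \<forall>z. 0 < z \<and> z < c * t + u \<longrightarrow> \<bar>phi_ratio x u t c z\<bar> \<le> B"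
proof
  let ?B = "exp (t + u) * exp (pi\<^sup>2 * t / (2 * u * u)) / sin (pi * x / u)"
  have s: "0 < sin (pi * x / u)" using x by (intro sin_gt_zero) (auto simp: field_simps)
  \<comment> \<open>The factor 3 is \<open>(3 / 2) / (1 / 2)\<close>: both relative errors will be
    at most 1/2.\<close>
  then show "0 < 3 * ?B" by simp
  have small: "\<forall>\<^sub>F c in at_right 0. tail_const * exp (- pi\<^sup>2 / (2 * (c * (c * s + u)))) < 1 / 2" if "0 \<le> s" for s
    by (rule order_tendstoD[OF tendsto_mult_right_zero[OF phi0_error_tendsto[OF that]]]) simp
  show "\<forall>\<^sub>F c in at_right 0. \<forall>z. 0 < z \<and> z < c * t + u \<longrightarrow> \<bar>phi_ratio x u t c z\<bar> \<le> 3 * ?B"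
    using phi0_relative_error[OF t] phi0_relative_error[OF order_refl] eventually_at_right_less[of "0::real"]
      small[OF t] small[OF order_refl] eventually_at_right_real[OF zero_less_one]
  proof eventually_elim
    case (elim c)
    show ?case
    proof (intro allI impI)
      fix z assume z: "0 < z \<and> z < c * t + u"
      let ?r = "phi0 (c * z) (c * (c * t + u)) / phi0_lead (c * z) (c * (c * t + u))"
      let ?s = "phi0 (c * x) (c * (c * 0 + u)) / phi0_lead (c * x) (c * (c * 0 + u))"
      have r: "\<bar>?r - 1\<bar> \<le> 1 / 2" "phi0_lead (c * z) (c * (c * t + u)) \<noteq> 0" using elim(1,4) z by force+
      have s0: "\<bar>?s - 1\<bar> \<le> 1 / 2" "phi0_lead (c * x) (c * (c * 0 + u)) \<noteq> 0"
        using elim(2)[rule_format, of x] elim(5) x by auto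
      have "\<bar>?r\<bar> \<le> 3 / 2" "1 / 2 \<le> \<bar>?s\<bar>" using r(1) s0(1) by linarith+
      then have q: "\<bar>?r\<bar> / \<bar>?s\<bar> \<le> (3 / 2) / (1 / 2)" by (intro frac_le) auto
      have "\<bar>phi_ratio x u t c z\<bar> = \<bar>?r\<bar> / \<bar>?s\<bar> * \<bar>lead_ratio x u t c z\<bar>"
        unfolding phi_ratio_factor[OF elim(3) r(2) s0(2)] by (simp only: abs_mult abs_divide)
      also have "\<dots> \<le> ((3 / 2) / (1 / 2)) * ?B"
        using q lead_ratio_bound[of c z] elim(6) z by (intro mult_mono) auto
      finally show "\<bar>phi_ratio x u t c z\<bar> \<le> 3 * ?B" by simp
    qed
  qed
qed

end

section \<open>Weak convergence on the path space\<close>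

text \<open>Strict positivity at a dense set of times would not suffice. By compactness the minimum
  is attained, so positivity on the interval means a uniform bound \<open>inverse (Suc m)\<close>
  for some \<open>m\<close>, and such a closed condition passes from a countable dense set to its
  closure.\<close>

lemma sets_forall_pos:
  fixes g :: "real \<Rightarrow> 'a \<Rightarrow> real"
  assumes meas: "\<And>s. s \<in> {a..b} \<Longrightarrow> g s \<in> borel_measurable M"
    and cont: "\<And>z. z \<in> space M \<Longrightarrow> continuous_on {a..b} (\<lambda>s. g s z)"
  shows "{z \<in> space M. \<forall>s\<in>{a..b}. 0 < g s z} \<in> sets M"
proof -
  obtain D where D: "countable D" "D \<subseteq> {a..b}" "{a..b} \<subseteq> closure D"
    using separable by blast
  have cl: "closure D = {a..b}" using D(2,3) by (simp add: closure_minimal subset_antisym)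
  have "{z \<in> space M. \<forall>s\<in>{a..b}. 0 < g s z} =
    (\<Union>m::nat. {z \<in> space M. \<forall>s\<in>D. inverse (real (Suc m)) \<le> g s z})"
  proof (intro equalityI subsetI)
    fix z assume "z \<in> {z \<in> space M. \<forall>s\<in>{a..b}. 0 < g s z}"
    then have z: "z \<in> space M" "\<And>s. s \<in> {a..b} \<Longrightarrow> 0 < g s z" by auto
    show "z \<in> (\<Union>m::nat. {z \<in> space M. \<forall>s\<in>D. inverse (real (Suc m)) \<le> g s z})"
    proof (cases "{a..b} = {}")
      case True
      then show ?thesis using z D(2) by auto
    next
      case False
      obtain r where r: "r \<in> {a..b}" "\<And>s. s \<in> {a..b} \<Longrightarrow> g r z \<le> g s z"
        using continuous_attains_inf[OF compact_Icc False cont[OF z(1)]] by blast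
      obtain m where "inverse (real (Suc m)) < g r z" using reals_Archimedean[OF z(2)[OF r(1)]] by auto
      then show ?thesis using z(1) r(2) D(2) by (force intro: order_trans[OF less_imp_le])
    qed
  next
    fix z assume "z \<in> (\<Union>m::nat. {z \<in> space M. \<forall>s\<in>D. inverse (real (Suc m)) \<le> g s z})"
    then obtain m where z: "z \<in> space M" "\<And>s. s \<in> D \<Longrightarrow> inverse (real (Suc m)) \<le> g s z" by auto
    have "0 < g s z" if "s \<in> {a..b}" for s
    proof -
      have "0 < inverse (real (Suc m))" by simp
      also have "\<dots> \<le> g s z"
        by (rule continuous_ge_on_closure[where S = D]) (use cont[OF z(1)] that z(2) cl in auto)
      finally show ?thesis .
    qed
    then show "z \<in> {z \<in> space M. \<forall>s\<in>{a..b}. 0 < g s z}" using z(1) by simp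
  qed
  also have "\<dots> \<in> sets M"
  proof (intro sets.countable_UN subsetI, clarify)
    fix m :: nat
    have *: "{z \<in> space M. inverse (real (Suc m)) \<le> g s z} \<in> sets M" if "s \<in> D" for s
    proof -
      have [measurable]: "g s \<in> borel_measurable M" using meas D(2) that by auto
      show ?thesis by measurable
    qed
    show "{z \<in> space M. \<forall>s\<in>D. inverse (real (Suc m)) \<le> g s z} \<in> sets M"
      by (rule sets.sets_Collect_countable_All'[OF * D(1)])
  qed
  finally show ?thesis .
qed

section \<open>Coordinates, Borel sets and natural filtration of the path space\<close>

lemma continuous_coord: "continuous_on {0..} (\<lambda>s. coord s w)"
  using Rep_path[of w] by (simp add: coord_def)

lemma continuous_coord_Icc: "0 \<le> a \<Longrightarrow> continuous_on {a..b} (\<lambda>s. coord s w)"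
  by (rule continuous_on_subset[OF continuous_coord]) auto

definition mk_path :: "(real \<Rightarrow> real) \<Rightarrow> path" where
  "mk_path f = Abs_path (restrict f {0..})"

lemma coord_mk_path:
  assumes "continuous_on {0..} f" "0 \<le> s"
  shows "coord s (mk_path f) = f s"
proof -
  have "continuous_on {0..} (restrict f {0..})"
    by (rule continuous_on_eq[OF assms(1)]) simp
  then show ?thesis using assms(2) by (simp add: coord_def mk_path_def Abs_path_inverse)
qed

lemma space_nat_filtration [simp]: "space (nat_filtration t) = UNIV"
  by (simp add: nat_filtration_def space_measure_of_conv)

lemma sets_nat_filtration:
  "sets (nat_filtration t) = sigma_sets UNIV {coord s -` B | s B. 0 \<le> s \<and> s \<le> t \<and> B \<in> sets borel}"
  unfolding nat_filtration_def by (rule sets_measure_of) auto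

lemma measurable_coord_nat_filtration:
  "0 \<le> s \<Longrightarrow> s \<le> t \<Longrightarrow> coord s \<in> borel_measurable (nat_filtration t)"
  unfolding measurable_def by (auto simp: sets_nat_filtration)

lemma open_coord_vimage:
  assumes "0 \<le> s" "open B"
  shows "open (coord s -` B)"
  unfolding open_path_def
proof
  fix w assume "w \<in> coord s -` B"
  then obtain e where "e > 0" "ball (coord s w) e \<subseteq> B" using assms(2) open_contains_ball by blast
  then show "\<exists>K e. compact K \<and> K \<subseteq> {0..} \<and> 0 < e \<and> unif_nbhd w K e \<subseteq> coord s -` B"
    using assms(1) by (intro exI[of _ "{s}"] exI[of _ e]) (auto simp: unif_nbhd_def dist_commute ball_def)
qed

lemma measurable_coord: "0 \<le> s \<Longrightarrow> coord s \<in> borel_measurable borel"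
  by (rule borel_measurable_continuous_onI) (simp add: continuous_on_open_vimage open_coord_vimage)

lemma sets_nat_filtration_subset: "sets (nat_filtration t) \<subseteq> sets borel"
  unfolding sets_nat_filtration
proof (rule sets.sigma_sets_subset')
  show "{coord s -` B |s B. 0 \<le> s \<and> s \<le> t \<and> B \<in> sets borel} \<subseteq> sets borel"
    using measurable_sets[OF measurable_coord] by auto
qed simp

lemma sets_nat_filtration_mono: "s \<le> t \<Longrightarrow> sets (nat_filtration s) \<subseteq> sets (nat_filtration t)"
  unfolding sets_nat_filtration by (rule sigma_sets_mono') force

lemma subalgebra_nat_filtration: "sets M = sets borel \<Longrightarrow> subalgebra M (nat_filtration t)"
  using sets_nat_filtration_subset sets_eq_imp_space_eq[of M borel] by (simp add: subalgebra_def)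

lemma measurable_nat_filtration_borel:
  "sets M = sets borel \<Longrightarrow> f \<in> measurable (nat_filtration t) N \<Longrightarrow> f \<in> measurable M N"
  by (rule measurable_from_subalg[OF subalgebra_nat_filtration])

lemma measurable_nat_filtration_mono:
  assumes "s \<le> t" "f \<in> measurable (nat_filtration s) N"
  shows "f \<in> measurable (nat_filtration t) N"
  using assms sets_nat_filtration_mono[OF assms(1)] unfolding measurable_def by auto

section \<open>A countable family of basic neighbourhoods\<close>

lemma unif_nbhd_in_nat_filtration:
  assumes "0 < e"
  shows "unif_nbhd v {0..real n} e \<in> sets (nat_filtration (real n))"
proof -
  have "{w \<in> space (nat_filtration n). \<forall>s\<in>{0..real n}. 0 < e - dist (coord s w) (coord s v)} \<in> sets (nat_filtration n)"
  proof (rule sets_forall_pos)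
    fix s assume s: "s \<in> {0..real n}"
    have [measurable]: "coord s \<in> borel_measurable (nat_filtration n)"
      using s by (intro measurable_coord_nat_filtration) auto
    show "(\<lambda>w. e - dist (coord s w) (coord s v)) \<in> borel_measurable (nat_filtration n)" by measurable
  qed (intro continuous_intros continuous_coord_Icc, auto)
  then show ?thesis by (simp add: unif_nbhd_def)
qed

text \<open>The code consists of a time horizon, a degree and a list of rational coefficients, so
  the index type, and with it the range, is countable.\<close>

definition bernstein_path :: "nat \<times> nat \<times> rat list \<Rightarrow> path" where
  "bernstein_path = (\<lambda>(n, m, qs). mk_path (\<lambda>s. \<Sum>k\<le>m. of_rat (qs ! k) * Bernstein m k (s / n)))"

text \<open>Rescale \<open>{0..n}\<close> to the unit interval, approximate by a Bernstein
  polynomial up to \<open>e / 2\<close>, and move each coefficient to a rational at distance below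
  \<open>e / 2\<close>. As Bernstein polynomials are nonnegative with sum 1, the second change costs
  at most \<open>e / 2\<close> as well.\<close>

lemma bernstein_path_dense:
  assumes n: "0 < n" and e: "0 < e"
  obtains v where "v \<in> range bernstein_path" "w \<in> unif_nbhd v {0..real n} e"
proof -
  define f where "f = (\<lambda>x. coord (real n * x) w)"
  have "continuous_on {0..1} f"
    unfolding f_def
    by (rule continuous_on_compose2[OF continuous_coord_Icc[of 0 n]])
       (use n in \<open>auto intro!: continuous_intros mult_left_le\<close>)
  from Bernstein_Weierstrass[OF this, of "e/2"] obtain N where
    "\<forall>n x. N \<le> n \<and> x \<in> {0..1} \<longrightarrow> \<bar>f x - (\<Sum>k\<le>n. f (k / n) * Bernstein n k x)\<bar> < e / 2"
    using e by auto
  then have N: "\<And>x. x \<in> {0..1} \<Longrightarrow> \<bar>f x - (\<Sum>k\<le>N. f (k / N) * Bernstein N k x)\<bar> < e / 2" by auto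
  have "\<exists>q. f (k / N) < of_rat q \<and> of_rat q < f (k / N) + e / 2" for k :: nat
    by (rule of_rat_dense) (use e in simp)
  then obtain q where q: "\<And>k::nat. f (k / N) < of_rat (q k) \<and> of_rat (q k) < f (k / N) + e / 2" by metis
  define qs where "qs = map q [0..<Suc N]"
  let ?v = "bernstein_path (n, N, qs)"
  have qs: "qs ! k = q k" if "k \<le> N" for k using that by (simp add: qs_def del: upt_Suc)
  have v: "coord s ?v = (\<Sum>k\<le>N. of_rat (q k) * Bernstein N k (s / n))" if "0 \<le> s" for s
  proof -
    have "continuous_on {0..} (\<lambda>s. \<Sum>k\<le>N. of_rat (qs ! k) * Bernstein N k (s / n))"
      unfolding Bernstein_def using n by (intro continuous_intros) auto
    from coord_mk_path[OF this that] show ?thesis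
      unfolding bernstein_path_def using qs by (auto intro!: sum.cong)
  qed
  have "dist (coord s w) (coord s ?v) < e" if s: "s \<in> {0..real n}" for s
  proof -
    have x: "s / n \<in> {0..1}" using s n by auto
    have "\<bar>(\<Sum>k\<le>N. f (k / N) * Bernstein N k (s / n)) - coord s ?v\<bar> =
      \<bar>\<Sum>k\<le>N. (f (k / N) - of_rat (q k)) * Bernstein N k (s / n)\<bar>"
      using s by (simp add: v sum_subtractf left_diff_distrib)
    also have "\<dots> \<le> (\<Sum>k\<le>N. e / 2 * Bernstein N k (s / n))"
    proof (rule order_trans[OF sum_abs], rule sum_mono)
      fix k
      have "\<bar>f (k / N) - of_rat (q k)\<bar> \<le> e / 2" using q[of k] by linarith
      then show "\<bar>(f (k / N) - of_rat (q k)) * Bernstein N k (s / n)\<bar> \<le> e / 2 * Bernstein N k (s / n)"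
        using Bernstein_nonneg[of "s / n" N k] x e unfolding abs_mult by (intro mult_mono) auto
    qed
    also have "\<dots> = e / 2" by (simp only: sum_distrib_left[symmetric] sum_Bernstein mult_1_right)
    finally have "\<bar>(\<Sum>k\<le>N. f (k / N) * Bernstein N k (s / n)) - coord s ?v\<bar> \<le> e / 2" .
    moreover have "f (s / n) = coord s w" using n by (simp add: f_def)
    ultimately show ?thesis using N[OF x] unfolding dist_real_def by linarith
  qed
  then show ?thesis by (intro that[of ?v]) (auto simp: unif_nbhd_def)
qed

text \<open>Second countability in the form needed: a horizon containing \<open>K\<close>, and a
  radius below \<open>e / 2\<close> because the neighbourhood is centred at \<open>v\<close> and not
  at \<open>w\<close>.\<close>

lemma open_path_basic_nbhd:
  assumes U: "open U" "w \<in> U"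
  obtains v n m where "v \<in> range bernstein_path"
    "w \<in> unif_nbhd v {0..real n} (inverse (real (Suc m)))" "unif_nbhd v {0..real n} (inverse (real (Suc m))) \<subseteq> U"
proof -
  obtain K e where K: "compact K" "K \<subseteq> {0..}" "0 < e" "unif_nbhd w K e \<subseteq> U"
    using U unfolding open_path_def by blast
  obtain b where b: "\<And>s. s \<in> K \<Longrightarrow> \<bar>s\<bar> \<le> b"
    using compact_imp_bounded[OF K(1)] by (auto simp: bounded_iff)
  define n where "n = Suc (nat \<lceil>b\<rceil>)"
  have Kn: "K \<subseteq> {0..real n}"
  proof
    fix s assume "s \<in> K"
    with b[of s] K(2) show "s \<in> {0..real n}" unfolding n_def by (auto simp: abs_le_iff) linarith
  qed
  obtain m where m: "inverse (real (Suc m)) < e / 2" using reals_Archimedean[of "e/2"] K(3) by auto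
  let ?d = "inverse (real (Suc m))"
  obtain v where v: "v \<in> range bernstein_path" "w \<in> unif_nbhd v {0..real n} ?d"
    by (rule bernstein_path_dense[of n ?d w]) (auto simp: n_def)
  have "unif_nbhd v {0..real n} ?d \<subseteq> unif_nbhd w K e"
  proof
    fix z assume z: "z \<in> unif_nbhd v {0..real n} ?d"
    have "dist (coord s z) (coord s w) < e" if "s \<in> K" for s
    proof -
      have "dist (coord s z) (coord s v) < ?d" "dist (coord s w) (coord s v) < ?d"
        using z v(2) Kn that by (auto simp: unif_nbhd_def)
      then show ?thesis using m dist_triangle2[of "coord s z" "coord s w" "coord s v"] by linarith
    qed
    then show "z \<in> unif_nbhd w K e" by (simp add: unif_nbhd_def)
  qed
  with v K(4) show ?thesis by (intro that) auto
qed

text \<open>A bounded continuous function is the supremum of the countably many step functions that lie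
  below it and take, apart from a lower bound, one rational value on one basic neighbourhood.\<close>

lemma continuous_increasing_approx:
  fixes f :: "path \<Rightarrow> real"
  assumes f: "continuous_on UNIV f" and b: "\<And>w. \<bar>f w\<bar> \<le> b"
  obtains g :: "nat \<Rightarrow> path \<Rightarrow> real"
  where "\<And>k. \<exists>n. g k \<in> borel_measurable (nat_filtration (real n))"
    "\<And>k w. \<bar>g k w\<bar> \<le> b" "\<And>k w. g k w \<le> f w" "\<And>w. (\<lambda>k. g k w) \<longlonglongrightarrow> f w"
proof -
  let ?N = "\<lambda>(v, n, m, r::rat). unif_nbhd v {0..real n} (inverse (real (Suc m)))"
  define J where "J = {(v, n, m, r). v \<in> range bernstein_path \<and> (\<forall>w\<in>?N (v, n, m, r). of_rat r \<le> f w)}"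
  define h where "h = (\<lambda>(v, n::nat, m::nat, r) w. if w \<in> ?N (v, n, m, r) then max (- b) (of_rat r) else - b)"
  have "countable (range bernstein_path \<times> (UNIV :: (nat \<times> nat \<times> rat) set))" by (intro countable_SIGMA) auto
  then have cJ: "countable J" by (rule countable_subset[rotated]) (auto simp: J_def)
  have hf: "h j w \<le> f w" if "j \<in> J" for j w
    using that b[of w] by (auto simp: J_def h_def abs_le_iff minus_le_iff)
  have hb: "- b \<le> h j w" for j w
    by (auto simp: h_def split: prod.split)
  have hm: "\<exists>n. h j \<in> borel_measurable (nat_filtration (real n))" for j
  proof -
    obtain v n m r where j: "j = (v, n, m, r)" by (cases j)
    have "h j \<in> borel_measurable (nat_filtration (real n))"
      unfolding j h_def by (auto intro!: measurable_If_set simp: unif_nbhd_in_nat_filtration)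
    then show ?thesis by blast
  qed
  have sup: "\<exists>j\<in>J. a < h j w" if a: "a < f w" for a w
  proof -
    obtain r where r: "a < real_of_rat r" "of_rat r < f w" using of_rat_dense[OF a] by auto
    have "open (f -` {of_rat r<..})" by (intro open_vimage f) simp
    then obtain v n m where v: "v \<in> range bernstein_path" "w \<in> ?N (v, n, m, r)" "?N (v, n, m, r) \<subseteq> f -` {of_rat r<..}"
      by (rule open_path_basic_nbhd[of _ w]) (use r in auto)
    then have "(v, n, m, r) \<in> J" by (auto simp: J_def intro: less_imp_le)
    moreover have "a < h (v, n, m, r) w" using v(2) r by (simp add: h_def)
    ultimately show ?thesis by blast
  qed
  have J: "J \<noteq> {}" using sup[of "f undefined - 1" undefined] by auto
  let ?j = "from_nat_into J"
  have jJ: "?j i \<in> J" for i by (rule from_nat_into[OF J])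
  \<comment> \<open>Finite maxima turn the countable supremum into an increasing sequence, and each
    involves finitely many horizons, so it is measurable with respect to the filtration at the
    largest of them.\<close>
  define g where "g k w = Max ((\<lambda>i. h (?j i) w) ` {..k})" for k w
  have "\<forall>i. \<exists>n. h (?j i) \<in> borel_measurable (nat_filtration (real n))" using hm by blast
  then obtain \<nu> where \<nu>: "\<And>i. h (?j i) \<in> borel_measurable (nat_filtration (real (\<nu> i)))" by metis
  show ?thesis
  proof (rule that[of g])
    show "\<exists>n. g k \<in> borel_measurable (nat_filtration (real n))" for k
    proof
      have "h (?j i) \<in> borel_measurable (nat_filtration (real (Max (\<nu> ` {..k}))))" if "i \<le> k" for i
        by (rule measurable_nat_filtration_mono[OF _ \<nu>]) (use that in simp)
      then show "g k \<in> borel_measurable (nat_filtration (real (Max (\<nu> ` {..k}))))"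
        unfolding g_def by (intro borel_measurable_Max) auto
    qed
    show gf: "g k w \<le> f w" for k w
      unfolding g_def using hf[OF jJ] by (subst Max_le_iff) auto
    have "- b \<le> g k w" for k w
      unfolding g_def using hb by (subst Max_ge_iff) auto
    then show "\<bar>g k w\<bar> \<le> b" for k w
      using gf[of k w] b[of w] by (smt (verit) abs_le_iff)
    show "(\<lambda>k. g k w) \<longlonglongrightarrow> f w" for w
    proof (rule order_tendstoI)
      fix a assume "a < f w"
      then obtain j where "j \<in> J" "a < h j w" using sup by blast
      then obtain i where i: "a < h (?j i) w" using from_nat_into_surj[OF cJ] by metis
      show "\<forall>\<^sub>F k in sequentially. a < g k w"
        using eventually_ge_at_top[of i]
        by eventually_elim (use i in \<open>auto simp: g_def intro!: less_le_trans[OF i Max_ge]\<close>)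
    next
      fix a assume "f w < a"
      then show "\<forall>\<^sub>F k in sequentially. g k w < a"
        using gf by (auto intro!: always_eventually intro: le_less_trans)
    qed
  qed
qed

text \<open>No tightness is needed, because bounded continuous functions are limits from below of
  functionals measurable with respect to some \<open>nat_filtration n\<close>.\<close>

lemma weakly_convergesI_filtration:
  fixes Q :: "real \<Rightarrow> path measure"
  assumes Q: "\<forall>\<^sub>F c in F. prob_space (Q c) \<and> sets (Q c) = sets borel"
    and P: "prob_space P" "sets P = sets borel"
    and conv: "\<And>n (g :: path \<Rightarrow> real) b. g \<in> borel_measurable (nat_filtration (real n)) \<Longrightarrow> (\<And>w. \<bar>g w\<bar> \<le> b) \<Longrightarrow>
      ((\<lambda>c. \<integral>w. g w \<partial>Q c) \<longlongrightarrow> (\<integral>w. g w \<partial>P)) F"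
  shows "weakly_converges Q P F"
  unfolding weakly_converges_def
proof (intro allI impI)
  interpret P: prob_space P by fact
  have int: "integrable M g" if "prob_space M" "sets M = sets borel" "g \<in> borel_measurable borel" "\<And>w. \<bar>g w\<bar> \<le> b"
    for M :: "path measure" and g :: "path \<Rightarrow> real" and b
  proof -
    interpret prob_space M by fact
    show ?thesis by (rule integrable_const_bound[of _ b]) (use that in \<open>auto cong: measurable_cong_sets\<close>)
  qed
  \<comment> \<open>Approximation from below yields only the lower half of convergence; the upper
    half follows by applying it to \<open>- f\<close>.\<close>
  have lower: "\<forall>\<^sub>F c in F. a < (\<integral>w. f w \<partial>Q c)"
    if f: "continuous_on UNIV f" "\<And>w. \<bar>f w\<bar> \<le> b" and a: "a < (\<integral>w. f w \<partial>P)"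
    for f :: "path \<Rightarrow> real" and a b
  proof -
    obtain g where gm: "\<And>k. \<exists>n. g k \<in> borel_measurable (nat_filtration (real n))"
      and gb: "\<And>k w. \<bar>g k w\<bar> \<le> b" and gf: "\<And>k w. g k w \<le> f w" and gl: "\<And>w. (\<lambda>k. g k w) \<longlonglongrightarrow> f w"
      using continuous_increasing_approx[OF f] by metis
    have fm: "f \<in> borel_measurable borel" by (rule borel_measurable_continuous_onI[OF f(1)])
    have gmb: "g k \<in> borel_measurable borel" for k
      using gm measurable_nat_filtration_borel by blast
    have "(\<lambda>k. \<integral>w. g k w \<partial>P) \<longlonglongrightarrow> (\<integral>w. f w \<partial>P)"
      by (rule integral_dominated_convergence[where w = "\<lambda>_. b"])
         (use fm gmb gb gl P(2) in \<open>auto cong: measurable_cong_sets\<close>)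
    from order_tendstoD(1)[OF this a] obtain k where k: "a < (\<integral>w. g k w \<partial>P)"
      by (auto simp: eventually_sequentially)
    obtain n where "g k \<in> borel_measurable (nat_filtration (real n))" using gm by blast
    then have "((\<lambda>c. \<integral>w. g k w \<partial>Q c) \<longlongrightarrow> (\<integral>w. g k w \<partial>P)) F" by (rule conv) (rule gb)
    from order_tendstoD(1)[OF this k] show ?thesis using Q
    proof eventually_elim
      case (elim c)
      have "(\<integral>w. g k w \<partial>Q c) \<le> (\<integral>w. f w \<partial>Q c)"
        using elim(2) by (intro integral_mono int[of _ _ b] fm gmb gb f(2) gf) auto
      with elim(1) show ?case by linarith
    qed
  qed
  fix f :: "path \<Rightarrow> real" assume f: "continuous_on UNIV f" "bounded (range f)"
  then obtain b where b: "\<And>w. \<bar>f w\<bar> \<le> b" by (auto simp: bounded_iff)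
  show "((\<lambda>c. \<integral>w. f w \<partial>Q c) \<longlongrightarrow> (\<integral>w. f w \<partial>P)) F"
  proof (rule order_tendstoI)
    show "\<forall>\<^sub>F c in F. a < (\<integral>w. f w \<partial>Q c)" if "a < (\<integral>w. f w \<partial>P)" for a
      by (rule lower[OF f(1) b that])
    show "\<forall>\<^sub>F c in F. (\<integral>w. f w \<partial>Q c) < a" if "(\<integral>w. f w \<partial>P) < a" for a
    proof -
      have "continuous_on UNIV (\<lambda>w. - f w)" by (intro continuous_intros f)
      then have "\<forall>\<^sub>F c in F. - a < (\<integral>w. - f w \<partial>Q c)"
        by (rule lower[of _ b]) (use b that in auto)
      then show ?thesis by eventually_elim simp
    qed
  qed
qed

section \<open>Survival in a strip\<close>

text \<open>As \<open>hit_time\<close> is an infimum, absence of a visit up to \<open>t\<close>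
  would give only \<open>t \<le> hit_time\<close>. Continuity of \<open>G\<close> at
  \<open>t\<close> keeps it nonzero a little longer, which makes the inequality strict.\<close>

lemma less_hit_time_iff:
  assumes t: "0 \<le> t" and G: "continuous_on {0..} G"
    and D: "\<And>s. 0 \<le> s \<Longrightarrow> coord s w \<in> D s \<longleftrightarrow> G s = (0::real)"
  shows "ereal t < hit_time D w \<longleftrightarrow> (\<forall>s\<in>{0..t}. G s \<noteq> 0)"
proof
  assume lt: "ereal t < hit_time D w"
  show "\<forall>s\<in>{0..t}. G s \<noteq> 0"
  proof
    fix s assume s: "s \<in> {0..t}"
    show "G s \<noteq> 0"
    proof
      assume "G s = 0"
      then have "hit_time D w \<le> ereal s"
        unfolding hit_time_def using D s by (intro Inf_lower) auto
      also have "\<dots> \<le> ereal t" using s by simp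
      finally show False using lt by simp
    qed
  qed
next
  assume nz: "\<forall>s\<in>{0..t}. G s \<noteq> 0"
  then have "0 < \<bar>G t\<bar>" using t by simp
  then obtain d where d: "0 < d" "\<And>s. s \<in> {0..} \<Longrightarrow> dist s t < d \<Longrightarrow> dist (G s) (G t) < \<bar>G t\<bar>"
    using G t unfolding continuous_on_iff by (metis atLeast_iff)
  have "ereal (t + d) \<le> hit_time D w"
    unfolding hit_time_def
  proof (rule Inf_greatest, clarify)
    fix s assume s: "0 \<le> s" "coord s w \<in> D s"
    then have Gs: "G s = 0" using D by simp
    then have "t < s" using nz s(1) by force
    moreover have "\<not> dist s t < d" using d(2)[of s] s(1) Gs by (auto simp: dist_real_def)
    ultimately show "ereal (t + d) \<le> ereal s" by (simp add: dist_real_def)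
  qed
  moreover have "ereal t < ereal (t + d)" using d(1) by simp
  ultimately show "ereal t < hit_time D w" by (rule less_le_trans[rotated])
qed

text \<open>The product vanishes exactly on the two barriers; its absolute value puts the condition
  into the form required by \<open>sets_forall_pos\<close>.\<close>

lemma hit_time_barrier_iff:
  assumes t: "0 \<le> t"
  shows "ereal t < hit_time (\<lambda>s. {0, c * s + u}) w \<longleftrightarrow> (\<forall>s\<in>{0..t}. 0 < \<bar>coord s w * (coord s w - (c * s + u))\<bar>)"
proof -
  have "ereal t < hit_time (\<lambda>s. {0, c * s + u}) w \<longleftrightarrow> (\<forall>s\<in>{0..t}. coord s w * (coord s w - (c * s + u)) \<noteq> 0)"
    by (rule less_hit_time_iff[OF t]) (auto intro!: continuous_intros continuous_coord)
  then show ?thesis by simp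
qed

definition stays :: "real \<Rightarrow> real \<Rightarrow> real \<Rightarrow> path set" where
  "stays c u t = {w. \<forall>s\<in>{0..t}. 0 < coord s w \<and> coord s w < c * s + u}"

lemma stays_less_hit_time:
  assumes t: "0 \<le> t" and w: "w \<in> stays c u t"
  shows "ereal t < hit_time (\<lambda>s. {0, c * s + u}) w"
  unfolding hit_time_barrier_iff[OF t] using w by (force simp: stays_def)

text \<open>A path that starts strictly between the barriers can leave only by crossing one: apply
  the intermediate value theorem to the signed distance to the nearer barrier.\<close>

lemma less_hit_time_iff_stays:
  assumes t: "0 \<le> t" and w: "0 < coord 0 w" "coord 0 w < u"
  shows "ereal t < hit_time (\<lambda>s. {0, c * s + u}) w \<longleftrightarrow> w \<in> stays c u t"
proof
  assume "ereal t < hit_time (\<lambda>s. {0, c * s + u}) w"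
  then have nz: "\<forall>s\<in>{0..t}. 0 < \<bar>coord s w * (coord s w - (c * s + u))\<bar>"
    unfolding hit_time_barrier_iff[OF t] .
  have "0 < coord s w \<and> coord s w < c * s + u" if s: "s \<in> {0..t}" for s
  proof -
    let ?m = "\<lambda>r. min (coord r w) ((c * r + u) - coord r w)"
    have cm: "continuous_on {0..s} ?m" using s by (intro continuous_intros continuous_coord_Icc) auto
    have "0 < ?m s"
    proof (rule ccontr)
      assume "\<not> 0 < ?m s"
      then have "?m s \<le> 0" by (simp only: not_less)
      moreover have "0 \<le> ?m 0" using w by simp
      ultimately obtain r where "0 \<le> r" "r \<le> s" "?m r = 0"
        using IVT2'[of ?m s 0 0] s cm by auto
      moreover from this have "0 < \<bar>coord r w * (coord r w - (c * r + u))\<bar>" using nz s by auto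
      ultimately show False by (auto simp: min_def split: if_splits)
    qed
    then show ?thesis by simp
  qed
  then show "w \<in> stays c u t" by (simp add: stays_def)
qed (rule stays_less_hit_time[OF t])

lemma stays_in_nat_filtration: "stays c u t \<in> sets (nat_filtration t)"
proof -
  have "{w \<in> space (nat_filtration t). \<forall>s\<in>{0..t}. 0 < min (coord s w) (c * s + u - coord s w)} \<in> sets (nat_filtration t)"
  proof (rule sets_forall_pos)
    fix s assume s: "s \<in> {0..t}"
    have [measurable]: "coord s \<in> borel_measurable (nat_filtration t)"
      using s by (intro measurable_coord_nat_filtration) auto
    show "(\<lambda>w. min (coord s w) (c * s + u - coord s w)) \<in> borel_measurable (nat_filtration t)" by measurable
  qed (intro continuous_intros continuous_coord_Icc, auto)
  then show ?thesis by (simp add: stays_def)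
qed

lemma less_hit_time_in_nat_filtration:
  assumes t: "0 \<le> t"
  shows "{w. ereal t < hit_time (\<lambda>s. {0, c * s + u}) w} \<in> sets (nat_filtration t)"
proof -
  have "{w \<in> space (nat_filtration t). \<forall>s\<in>{0..t}. 0 < \<bar>coord s w * (coord s w - (c * s + u))\<bar>} \<in> sets (nat_filtration t)"
  proof (rule sets_forall_pos)
    fix s assume s: "s \<in> {0..t}"
    have [measurable]: "coord s \<in> borel_measurable (nat_filtration t)"
      using s by (intro measurable_coord_nat_filtration) auto
    show "(\<lambda>w. \<bar>coord s w * (coord s w - (c * s + u))\<bar>) \<in> borel_measurable (nat_filtration t)" by measurable
  qed (intro continuous_intros continuous_coord_Icc, auto)
  then show ?thesis by (simp add: hit_time_barrier_iff[OF t])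
qed

text \<open>This event is the limit of \<open>stays c u t\<close> as \<open>c\<close> decreases to
  0, for paths that start below \<open>u\<close>: the lower barrier stays strict, the upper one may
  be touched.\<close>

lemma closed_strip_in_nat_filtration:
  "{w. \<forall>s\<in>{0..t}. 0 < coord s w \<and> coord s w \<le> u} \<in> sets (nat_filtration t)"
proof -
  have "{w. \<forall>s\<in>{0..t}. 0 < coord s w \<and> coord s w \<le> u} = (\<Inter>m::nat. stays 0 (u + inverse (real (Suc m))) t)"
  proof (intro equalityI subsetI)
    fix w assume w: "w \<in> (\<Inter>m::nat. stays 0 (u + inverse (real (Suc m))) t)"
    have "0 < coord s w \<and> coord s w \<le> u" if s: "s \<in> {0..t}" for s
    proof
      show "0 < coord s w" using w s by (auto simp: stays_def)
      show "coord s w \<le> u"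
      proof (rule field_le_epsilon)
        fix e :: real assume "0 < e"
        then obtain m where "inverse (real (Suc m)) < e" using reals_Archimedean by blast
        moreover have "coord s w < u + inverse (real (Suc m))" using w s by (auto simp: stays_def)
        ultimately show "coord s w \<le> u + e" by linarith
      qed
    qed
    then show "w \<in> {w. \<forall>s\<in>{0..t}. 0 < coord s w \<and> coord s w \<le> u}" by simp
  qed (auto simp: stays_def intro: le_less_trans[OF _ less_add_same_cancel1[THEN iffD2]])
  also have "\<dots> \<in> sets (nat_filtration t)"
    by (intro sets.countable_INT subsetI) (auto simp: stays_in_nat_filtration)
  finally show ?thesis .
qed

text \<open>\<open>M\<close> and the measure with density \<open>Z\<close> are compared only after
  restriction to \<open>nat_filtration t\<close>. There they coincide, and integrals of functions
  measurable for the filtration can be computed there.\<close>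

lemma integral_filtration_density:
  fixes g Z :: "path \<Rightarrow> real"
  assumes M: "finite_measure M" "sets M = sets borel" and W: "sets W = sets borel"
    and Z: "integrable W Z" "AE w in W. 0 \<le> Z w"
    and eq: "\<And>A. A \<in> sets (nat_filtration t) \<Longrightarrow> measure M A = (\<integral>w. Z w * indicator A w \<partial>W)"
    and g: "g \<in> borel_measurable (nat_filtration t)"
  shows "(\<integral>w. g w \<partial>M) = (\<integral>w. g w * Z w \<partial>W)"
proof -
  interpret M: finite_measure M by fact
  let ?F = "nat_filtration t"
  let ?N = "density W (\<lambda>w. ennreal (Z w))"
  have [measurable]: "Z \<in> borel_measurable W" using Z(1) by simp
  have sM: "subalgebra M ?F" by (rule subalgebra_nat_filtration[OF M(2)])
  have sW: "subalgebra W ?F" by (rule subalgebra_nat_filtration[OF W])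
  have sN: "subalgebra ?N ?F" using sW by (simp add: subalgebra_def)
  have "restr_to_subalg M ?F = restr_to_subalg ?N ?F"
  proof (rule measure_eqI)
    show "sets (restr_to_subalg M ?F) = sets (restr_to_subalg ?N ?F)"
      by (simp add: sets_restr_to_subalg[OF sM] sets_restr_to_subalg[OF sN])
    fix A assume "A \<in> sets (restr_to_subalg M ?F)"
    then have A: "A \<in> sets ?F" by (simp add: sets_restr_to_subalg[OF sM])
    then have AW[measurable]: "A \<in> sets W" using sW by (auto simp: subalgebra_def)
    have "emeasure ?N A = (\<integral>\<^sup>+w. ennreal (Z w * indicator A w) \<partial>W)"
      by (subst emeasure_density) (auto intro!: nn_integral_cong simp: indicator_def)
    also have "\<dots> = ennreal (\<integral>w. Z w * indicator A w \<partial>W)"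
      using integrable_mult_indicator[OF AW Z(1)] Z(2)
      by (intro nn_integral_eq_integral) (auto simp: mult.commute elim!: eventually_mono)
    also have "\<dots> = emeasure M A" by (simp add: eq[OF A, symmetric] M.emeasure_eq_measure)
    finally show "emeasure (restr_to_subalg M ?F) A = emeasure (restr_to_subalg ?N ?F) A"
      by (simp add: emeasure_restr_to_subalg[OF sM A] emeasure_restr_to_subalg[OF sN A])
  qed
  then have "(\<integral>w. g w \<partial>M) = (\<integral>w. g w \<partial>?N)"
    using integral_subalgebra2[OF sM g] integral_subalgebra2[OF sN g] by simp
  also have "\<dots> = (\<integral>w. Z w *\<^sub>R g w \<partial>W)"
    using measurable_from_subalg[OF sW g] Z by (intro integral_density) auto
  finally show ?thesis by (simp add: mult.commute)
qed

section \<open>Convergence on a bounded time interval\<close>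

definition doob_weight :: "real \<Rightarrow> real \<Rightarrow> real \<Rightarrow> path \<Rightarrow> real" where
  "doob_weight x u t w = sin (pi * coord t w / u) / sin (pi * x / u) * exp (pi\<^sup>2 / u\<^sup>2 * (t / 2))"

text \<open>All integrals are moved to the one measure \<open>Wx\<close>, where only the density
  depends on \<open>c\<close>; there dominated convergence applies with a constant bound.\<close>

lemma filtration_integral_tendsto:
  fixes x u t :: real and Wx :: "path measure" and Q :: "real \<Rightarrow> path measure" and g :: "path \<Rightarrow> real"
  assumes x: "0 < x" "x < u" and t: "0 < t"
    and W: "prob_space Wx" "sets Wx = sets borel" "AE w in Wx. coord 0 w = x"
    and Q: "\<And>c. 0 < c \<Longrightarrow> c < 1 \<Longrightarrow> is_Q Wx c x u (Q c)"
    and P: "prob_space P" "sets P = sets borel"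
    and PF: "\<And>A. A \<in> sets (nat_filtration t) \<Longrightarrow>
      measure P A = (\<integral>w. doob_weight x u t w * indicator (stays 0 u t) w * indicator A w \<partial>Wx)"
    and g: "g \<in> borel_measurable (nat_filtration t)" "\<And>w. \<bar>g w\<bar> \<le> b"
  shows "((\<lambda>c. \<integral>w. g w \<partial>Q c) \<longlongrightarrow> (\<integral>w. g w \<partial>P)) (at_right 0)"
proof -
  interpret W: prob_space Wx by fact
  interpret P: prob_space P by fact
  have FW: "A \<in> sets Wx" if "A \<in> sets (nat_filtration t)" for A
    using that sets_nat_filtration_subset W(2) by auto
  have UF: "UNIV \<in> sets (nat_filtration t)" using sets.top[of "nat_filtration t"] by simp
  have sp: "space Wx = UNIV" using sets_eq_imp_space_eq[OF W(2)] by simp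
  have [measurable]: "stays c u t \<in> sets Wx" for c by (intro FW stays_in_nat_filtration)
  have [measurable]: "coord t \<in> borel_measurable Wx"
    using measurable_coord[of t] t W(2) by (simp cong: measurable_cong_sets)
  have [measurable]: "g \<in> borel_measurable Wx" by (rule measurable_nat_filtration_borel[OF W(2) g(1)])
  \<comment> \<open>\<open>Z c\<close> is the density of \<open>Q c\<close> up to time
    \<open>t\<close>, \<open>Z0\<close> that of \<open>P\<close>, and \<open>Zl\<close> will be the
    pointwise limit of \<open>Z c\<close>.\<close>
  define Z where "Z c w = phi_ratio x u t c (coord t w) * indicator (stays c u t) w" for c w
  define Z0 where "Z0 w = doob_weight x u t w * indicator (stays 0 u t) w" for w
  let ?E = "{w. \<forall>s\<in>{0..t}. 0 < coord s w \<and> coord s w \<le> u}"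
  define Zl where "Zl w = doob_weight x u t w * indicator ?E w" for w
  have [measurable]: "?E \<in> sets Wx" by (intro FW closed_strip_in_nat_filtration)
  have [measurable]: "Z0 \<in> borel_measurable Wx" "Zl \<in> borel_measurable Wx"
    unfolding Z0_def Zl_def doob_weight_def by measurable
  have tail: "integrable Wx (Z c) \<and> (\<forall>A\<in>sets (nat_filtration t). measure (Q c) A = (\<integral>w. Z c w * indicator A w \<partial>Wx))"
    if c: "0 < c" "c < 1" for c
  proof -
    let ?T = "{w. ereal t < Tc c u w}"
    let ?Y = "\<lambda>w. phi0c c (coord t w) (t + u / c) / phi0c c x (u / c) * indicator ?T w"
    have [measurable]: "?T \<in> sets Wx"
      unfolding Tc_def using t by (intro FW less_hit_time_in_nat_filtration) simp
    interpret Qc: prob_space "Q c" using Q[OF c] by (simp add: is_Q_def)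
    have spQ: "space (Q c) = UNIV" using Q[OF c] sets_eq_imp_space_eq[of "Q c" borel] by (simp add: is_Q_def)
    have QA: "measure (Q c) A = (\<integral>w. ?Y w * indicator A w \<partial>Wx)" if "A \<in> sets (nat_filtration t)" for A
      using Q[OF c] that t by (simp add: is_Q_def indicator_inter_arith mult.assoc)
    have "(\<integral>w. ?Y w \<partial>Wx) = 1" using QA[OF UF] Qc.prob_space spQ by simp
    \<comment> \<open>The Bochner integral of a function that is not integrable is 0 by convention,
      so the value 1 proves integrability.\<close>
    then have iY: "integrable Wx ?Y" using not_integrable_integral_eq by fastforce
    have eq: "AE w in Wx. ?Y w = Z c w"
      using W(3)
    proof eventually_elim
      case (elim w)
      have "w \<in> ?T \<longleftrightarrow> w \<in> stays c u t"
        using less_hit_time_iff_stays[of t w u c] elim x t by (simp add: Tc_def)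
      then show ?case by (simp add: Z_def phi_ratio_def indicator_def)
    qed
    \<comment> \<open>In contrast to \<open>eq\<close> this holds for every path, since staying
      between the barriers excludes hitting them. It therefore transfers measurability to
      \<open>Z c\<close>, which equality almost everywhere does not.\<close>
    have ZY: "Z c w = indicator (stays c u t) w *\<^sub>R ?Y w" for w
      using stays_less_hit_time[of t w c u] t by (simp add: Z_def Tc_def phi_ratio_def indicator_def)
    have iZ: "integrable Wx (Z c)"
      unfolding ZY using iY by (intro integrable_mult_indicator) auto
    have "(\<integral>w. Z c w * indicator A w \<partial>Wx) = (\<integral>w. ?Y w * indicator A w \<partial>Wx)" if "A \<in> sets (nat_filtration t)" for A
    proof (rule integral_cong_AE)
      have [measurable]: "A \<in> sets Wx" "Z c \<in> borel_measurable Wx" "?Y \<in> borel_measurable Wx"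
        using FW[OF that] iZ iY by auto
      show "(\<lambda>w. Z c w * indicator A w) \<in> borel_measurable Wx" "(\<lambda>w. ?Y w * indicator A w) \<in> borel_measurable Wx"
        by measurable
      show "AE w in Wx. Z c w * indicator A w = ?Y w * indicator A w" using eq by eventually_elim simp
    qed
    with iZ QA show ?thesis by simp
  qed
  obtain B where B: "0 < B" "\<forall>\<^sub>F c in at_right 0. \<forall>z. 0 < z \<and> z < c * t + u \<longrightarrow> \<bar>phi_ratio x u t c z\<bar> \<le> B"
    using phi_ratio_bounded[OF x, of t] t by auto
  have good: "\<forall>\<^sub>F c in at_right 0. 0 < c \<and> c < 1 \<and> (\<forall>w. 0 \<le> Z c w \<and> \<bar>Z c w\<bar> \<le> B)"
    using phi_ratio_nonneg[OF x, of t, OF less_imp_le[OF t]] B(2) eventually_at_right_real[OF zero_less_one]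
  proof eventually_elim
    case (elim c)
    have "0 \<le> Z c w \<and> \<bar>Z c w\<bar> \<le> B" for w
    proof (cases "w \<in> stays c u t")
      case True
      then have "0 < coord t w \<and> coord t w < c * t + u" using t by (auto simp: stays_def)
      then show ?thesis using elim True by (simp add: Z_def)
    qed (use B(1) in \<open>simp add: Z_def\<close>)
    with elim(3) show ?case unfolding greaterThanLessThan_iff by blast
  qed
  have lim_pt: "((\<lambda>c. Z c w) \<longlongrightarrow> Zl w) (at_right 0)" if w: "coord 0 w = x" for w
  proof (cases "w \<in> ?E")
    case True
    \<comment> \<open>A path that may touch \<open>u\<close> is still strictly below every barrier
      with positive slope: at positive times because \<open>c * s > 0\<close>, at time 0 because it
      starts at \<open>x < u\<close>.\<close>
    have "w \<in> stays c u t" if "0 < c" for c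
    proof -
      have "coord s w < c * s + u" if s: "s \<in> {0..t}" for s
      proof (cases "s = 0")
        case False
        then have "0 < c * s" using s \<open>0 < c\<close> by simp
        moreover have "coord s w \<le> u" using True s by simp
        ultimately show ?thesis by linarith
      qed (use w x in simp)
      then show ?thesis using True by (simp add: stays_def)
    qed
    then have "\<forall>\<^sub>F c in at_right 0. phi_ratio x u t c (coord t w) = Z c w"
      using eventually_at_right_less[of "0::real"] by (auto simp: Z_def elim!: eventually_mono)
    moreover have "((\<lambda>c. phi_ratio x u t c (coord t w)) \<longlongrightarrow> Zl w) (at_right 0)"
      using phi_ratio_tendsto[OF x less_imp_le[OF t], of "coord t w"] True t by (auto simp: Zl_def doob_weight_def)
    ultimately show ?thesis by (rule Lim_transform_eventually[rotated])
  next
    case False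
    then obtain s where s: "s \<in> {0..t}" "coord s w \<le> 0 \<or> u < coord s w" by force
    have "\<forall>\<^sub>F c in at_right 0. w \<notin> stays c u t"
    proof (cases "coord s w \<le> 0")
      case True
      then show ?thesis using s(1) by (auto simp: stays_def intro!: always_eventually bexI[of _ s])
    next
      case False
      then have "u < coord s w" using s by simp
      then have "((\<lambda>c. c * s + u) \<longlongrightarrow> u) (at_right 0)" by (auto intro!: tendsto_eq_intros)
      from order_tendstoD(2)[OF this \<open>u < coord s w\<close>] show ?thesis
        by eventually_elim (use s(1) in \<open>force simp: stays_def\<close>)
    qed
    then have "\<forall>\<^sub>F c in at_right 0. 0 = Z c w" by eventually_elim (simp add: Z_def)
    from Lim_transform_eventually[OF tendsto_const this] show ?thesis using False by (simp add: Zl_def)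
  qed
  have lim: "((\<lambda>c. \<integral>w. h w \<partial>Q c) \<longlongrightarrow> (\<integral>w. h w * Zl w \<partial>Wx)) (at_right 0)"
    if h: "h \<in> borel_measurable (nat_filtration t)" "\<And>w. \<bar>h w\<bar> \<le> d" for h d
  proof -
    have hW: "h \<in> borel_measurable Wx" by (rule measurable_nat_filtration_borel[OF W(2) h(1)])
    have hQ: "\<forall>\<^sub>F c in at_right 0. (\<integral>w. h w \<partial>Q c) = (\<integral>w. h w * Z c w \<partial>Wx)"
      using good
    proof eventually_elim
      case (elim c)
      then have c: "0 < c" "c < 1" by auto
      show ?case
      proof (rule integral_filtration_density[OF _ _ W(2) _ _ _ h(1)])
        show "finite_measure (Q c)" "sets (Q c) = sets borel"
          using Q[OF c] by (auto simp: is_Q_def prob_space_def)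
      qed (use tail[OF c] elim in auto)
    qed
    \<comment> \<open>Below \<open>c0\<close> the bounds hold for every \<open>c\<close>, so
      dominated convergence can be used along each sequence that decreases to 0 from below
      \<open>c0\<close>.\<close>
    obtain c0 where c0: "0 < c0" "\<And>c. 0 < c \<Longrightarrow> c < c0 \<Longrightarrow> c < 1 \<and> (\<forall>w. 0 \<le> Z c w \<and> \<bar>Z c w\<bar> \<le> B)"
      using good unfolding eventually_at_right_field by blast
    have "((\<lambda>c. \<integral>w. h w * Z c w \<partial>Wx) \<longlongrightarrow> (\<integral>w. h w * Zl w \<partial>Wx)) (at_right 0)"
    proof (rule tendsto_at_right_sequentially[OF c0(1)])
      fix S :: "nat \<Rightarrow> real"
      assume S: "\<And>n. 0 < S n" "\<And>n. S n < c0" "decseq S" "S \<longlonglongrightarrow> 0"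
      have S0: "filterlim S (at_right 0) sequentially"
        using S(1,4) by (auto simp: filterlim_at less_imp_neq[symmetric] intro!: always_eventually)
      show "(\<lambda>n. \<integral>w. h w * Z (S n) w \<partial>Wx) \<longlonglongrightarrow> (\<integral>w. h w * Zl w \<partial>Wx)"
      proof (rule integral_dominated_convergence[where w = "\<lambda>_. d * B"])
        show "(\<lambda>w. h w * Zl w) \<in> borel_measurable Wx" using hW by measurable
        show "(\<lambda>w. h w * Z (S n) w) \<in> borel_measurable Wx" for n
          using hW tail[of "S n"] c0(2)[OF S(1,2)] S(1) by (intro borel_measurable_times) auto
        show "AE w in Wx. (\<lambda>n. h w * Z (S n) w) \<longlonglongrightarrow> h w * Zl w"
          using W(3) by eventually_elim (intro tendsto_mult tendsto_const filterlim_compose[OF lim_pt S0])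
        show "AE w in Wx. norm (h w * Z (S n) w) \<le> d * B" for n
        proof (rule AE_I2)
          fix w
          have "\<bar>Z (S n) w\<bar> \<le> B" using c0(2)[OF S(1,2)] by blast
          from mult_mono[OF h(2) this order_trans[OF abs_ge_zero h(2)] abs_ge_zero]
          show "norm (h w * Z (S n) w) \<le> d * B" by (simp only: real_norm_def abs_mult)
        qed
      qed simp
    qed
    then show ?thesis
      by (rule Lim_transform_eventually) (use hQ in \<open>eventually_elim, simp\<close>)
  qed
  have wnn: "0 \<le> doob_weight x u t w" if "0 \<le> coord t w" "coord t w \<le> u" for w
  proof -
    have "0 < sin (pi * x / u)" using x by (intro sin_gt_zero) (auto simp: field_simps)
    moreover have "0 \<le> sin (pi * coord t w / u)" using that x by (intro sin_ge_zero) (auto simp: field_simps)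
    ultimately show ?thesis by (simp add: doob_weight_def)
  qed
  have Z0l: "0 \<le> Z0 w \<and> Z0 w \<le> Zl w" for w
  proof -
    have "stays 0 u t \<subseteq> ?E" by (auto simp: stays_def intro: less_imp_le)
    moreover have "0 \<le> doob_weight x u t w" if "w \<in> ?E"
      using wnn[of w] that t by (force intro: less_imp_le)
    ultimately show ?thesis unfolding Z0_def Zl_def by (auto simp: indicator_def)
  qed
  have bound: "\<bar>doob_weight x u t w\<bar> \<le> 1 / \<bar>sin (pi * x / u)\<bar> * exp (pi\<^sup>2 / u\<^sup>2 * (t / 2))" for w
    unfolding doob_weight_def abs_mult abs_divide by (intro mult_mono divide_right_mono) auto
  have bound': "\<bar>doob_weight x u t w * indicator A w\<bar> \<le> 1 / \<bar>sin (pi * x / u)\<bar> * exp (pi\<^sup>2 / u\<^sup>2 * (t / 2))" for w A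
    using bound[of w] order_trans[OF abs_ge_zero bound[of w]] by (simp add: indicator_def)
  have i0: "integrable Wx Z0" and il: "integrable Wx Zl"
    using bound' by (auto intro!: W.integrable_const_bound[where B = "1 / \<bar>sin (pi * x / u)\<bar> * exp (pi\<^sup>2 / u\<^sup>2 * (t / 2))"] simp: Z0_def Zl_def)
  \<comment> \<open>Take the constant functional 1 in \<open>lim\<close>: every \<open>Q c\<close>
    has mass 1, and no mass is lost in the limit.\<close>
  have "(\<integral>w. Zl w \<partial>Wx) = 1"
  proof -
    have "((\<lambda>c. \<integral>w. 1 \<partial>Q c) \<longlongrightarrow> (\<integral>w. 1 * Zl w \<partial>Wx)) (at_right 0)" by (rule lim[of _ 1]) auto
    moreover have "((\<lambda>c. \<integral>w. 1 \<partial>Q c) \<longlongrightarrow> (1::real)) (at_right 0)"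
      by (rule tendsto_eventually, use good in eventually_elim) (use Q in \<open>auto simp: is_Q_def prob_space.prob_space\<close>)
    ultimately have "(\<integral>w. 1 * Zl w \<partial>Wx) = 1"
      by (rule tendsto_unique[OF trivial_limit_at_right_real])
    then show ?thesis by simp
  qed
  moreover have "(\<integral>w. Z0 w \<partial>Wx) = 1"
    using PF[OF UF] P.prob_space sets_eq_imp_space_eq[OF P(2)] by (simp add: Z0_def)
  text \<open>\<open>Zl\<close> and \<open>Z0\<close> differ only on paths touching the level \<open>u\<close> without crossing it.
    Equality of the total masses makes this event negligible, so the law of the maximum of
    Brownian motion is not needed.\<close>
  ultimately have "(\<integral>w. Zl w - Z0 w \<partial>Wx) = 0" using i0 il by simp
  then have AE0: "AE w in Wx. Zl w - Z0 w = 0"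
    by (subst (asm) integral_nonneg_eq_0_iff_AE) (use i0 il Z0l in auto)
  have "(\<integral>w. g w \<partial>P) = (\<integral>w. g w * Z0 w \<partial>Wx)"
    by (rule integral_filtration_density[OF _ P(2) W(2) i0 _ _ g(1)])
       (use PF Z0l P.finite_measure_axioms in \<open>auto simp: Z0_def\<close>)
  also have "\<dots> = (\<integral>w. g w * Zl w \<partial>Wx)"
    by (rule integral_cong_AE) (use AE0 in auto)
  finally show ?thesis using lim[OF g] by simp
qed

lemma weakly_converges_Q:
  fixes x u :: real and Wx :: "path measure" and Q :: "real \<Rightarrow> path measure"
  assumes x: "0 < x" "x < u"
    and W: "prob_space Wx" "sets Wx = sets borel" "AE w in Wx. coord 0 w = x"
    and Q: "\<And>c. 0 < c \<Longrightarrow> c < 1 \<Longrightarrow> is_Q Wx c x u (Q c)"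
    and P: "prob_space P" "sets P = sets borel"
    and PF: "\<And>t A. 0 < t \<Longrightarrow> A \<in> sets (nat_filtration t) \<Longrightarrow>
      measure P A = (\<integral>w. doob_weight x u t w * indicator (stays 0 u t) w * indicator A w \<partial>Wx)"
  shows "weakly_converges Q P (at_right 0)"
proof (rule weakly_convergesI_filtration[OF _ P])
  show "\<forall>\<^sub>F c in at_right 0. prob_space (Q c) \<and> sets (Q c) = sets borel"
    using eventually_at_right_real[OF zero_less_one]
    by eventually_elim (use Q in \<open>auto simp: is_Q_def\<close>)
  fix n :: nat and g :: "path \<Rightarrow> real" and b
  assume g: "g \<in> borel_measurable (nat_filtration (real n))" "\<And>w. \<bar>g w\<bar> \<le> b"
  \<comment> \<open>The horizon must be positive for the convergence of densities, so the case
    \<open>n = 0\<close> is absorbed by passing to \<open>Suc n\<close>.\<close>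
  have t: "0 < real (Suc n)" by simp
  have gS: "g \<in> borel_measurable (nat_filtration (real (Suc n)))"
    by (rule measurable_nat_filtration_mono[OF _ g(1)]) simp
  show "((\<lambda>c. \<integral>w. g w \<partial>Q c) \<longlongrightarrow> (\<integral>w. g w \<partial>P)) (at_right 0)"
    by (rule filtration_integral_tendsto[OF x t W _ P _ gS]) (fact Q PF[OF t] g(2))+
qed

section \<open>Finite-dimensional distributions\<close>

text \<open>The process is a parameter because cylinders are needed for the coordinates and also for
  the increments after a fixed time.\<close>

definition cyl :: "(real \<Rightarrow> 'a \<Rightarrow> real) \<Rightarrow> real set \<Rightarrow> (real \<Rightarrow> real set) \<Rightarrow> 'a set" where
  "cyl X J B = {w. \<forall>j\<in>J. X j w \<in> B j}"

lemma cyl_in_sets: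
  assumes "space M = UNIV" "finite J" "\<And>j. j \<in> J \<Longrightarrow> X j \<in> borel_measurable M" "\<And>j. j \<in> J \<Longrightarrow> B j \<in> sets borel"
  shows "cyl X J B \<in> sets M"
proof -
  have "{w \<in> space M. X j w \<in> B j} \<in> sets M" if "j \<in> J" for j
    using measurable_sets[OF assms(3)[OF that] assms(4)[OF that]] by (simp add: vimage_def Int_def conj_commute)
  then have "{w \<in> space M. \<forall>j\<in>J. X j w \<in> B j} \<in> sets M"
    by (rule sets.sets_Collect_finite_All[OF _ assms(2)])
  then show ?thesis using assms(1) by (simp add: cyl_def)
qed

lemma emeasure_distr_density_indicator:
  assumes "space M = UNIV" "X \<in> borel_measurable M" "A \<in> sets M" "C \<in> sets borel"
  shows "emeasure (distr (density M (indicator A)) borel X) C = emeasure M (A \<inter> {w. X w \<in> C})"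
proof -
  have XC: "{w. X w \<in> C} \<in> sets M"
    using measurable_sets[OF assms(2,4)] assms(1) by (simp add: vimage_def)
  have "emeasure (distr (density M (indicator A)) borel X) C = emeasure (density M (indicator A)) {w. X w \<in> C}"
    using assms by (subst emeasure_distr) (auto simp: vimage_def)
  also have "\<dots> = (\<integral>\<^sup>+w. indicator (A \<inter> {w. X w \<in> C}) w \<partial>M)"
    unfolding indicator_inter_arith using assms(3) XC by (intro emeasure_density) auto
  also have "\<dots> = emeasure M (A \<inter> {w. X w \<in> C})"
    by (rule nn_integral_indicator[OF sets.Int[OF assms(3) XC]])
  finally show ?thesis .
qed

text \<open>The measures may depend on the time horizon, as do the laws of a process
  transformed by a space-time harmonic function.\<close>

lemma fdd_unique:
  fixes \<mu> :: "real \<Rightarrow> 'a measure" and \<nu> :: "real \<Rightarrow> 'b measure"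
  assumes sp: "\<And>t. 0 \<le> t \<Longrightarrow> space (\<mu> t) = UNIV" "\<And>t. 0 \<le> t \<Longrightarrow> space (\<nu> t) = UNIV"
    and X: "\<And>s t. 0 \<le> s \<Longrightarrow> s \<le> t \<Longrightarrow> X s \<in> borel_measurable (\<mu> t)"
    and Y: "\<And>s t. 0 \<le> s \<Longrightarrow> s \<le> t \<Longrightarrow> Y s \<in> borel_measurable (\<nu> t)"
    and \<kappa>: "\<And>s t C. 0 \<le> s \<Longrightarrow> s < t \<Longrightarrow> C \<in> sets borel \<Longrightarrow> (\<lambda>y. \<kappa> s t y C) \<in> borel_measurable borel"
    and init: "\<And>B. B \<in> sets borel \<Longrightarrow> emeasure (\<mu> 0) {w. X 0 w \<in> B} = emeasure (\<nu> 0) {w. Y 0 w \<in> B}"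
    and stepX: "\<And>s t J B C. 0 \<le> s \<Longrightarrow> s < t \<Longrightarrow> finite J \<Longrightarrow> J \<subseteq> {0..s} \<Longrightarrow> (\<And>j. B j \<in> sets borel) \<Longrightarrow> C \<in> sets borel \<Longrightarrow>
      emeasure (\<mu> t) (cyl X J B \<inter> {w. X t w \<in> C}) = (\<integral>\<^sup>+w. indicator (cyl X J B) w * \<kappa> s t (X s w) C \<partial>\<mu> s)"
    and stepY: "\<And>s t J B C. 0 \<le> s \<Longrightarrow> s < t \<Longrightarrow> finite J \<Longrightarrow> J \<subseteq> {0..s} \<Longrightarrow> (\<And>j. B j \<in> sets borel) \<Longrightarrow> C \<in> sets borel \<Longrightarrow>
      emeasure (\<nu> t) (cyl Y J B \<inter> {w. Y t w \<in> C}) = (\<integral>\<^sup>+w. indicator (cyl Y J B) w * \<kappa> s t (Y s w) C \<partial>\<nu> s)"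
    and J: "finite J" "J \<subseteq> {0..}" and B: "\<And>j. B j \<in> sets borel"
  shows "emeasure (\<mu> (Max (insert 0 J))) (cyl X (insert 0 J) B) = emeasure (\<nu> (Max (insert 0 J))) (cyl Y (insert 0 J) B)"
  using J B
proof (induction J arbitrary: B rule: finite_linorder_max_induct)
  case empty
  then show ?case using init[of "B 0"] by (simp add: cyl_def)
next
  case (insert b A)
  show ?case
  proof (cases "b = 0")
    case True
    then have "A = {}" using insert by force
    then show ?thesis using True init[of "B 0"] insert.prems by (simp add: cyl_def)
  next
    case False
    then have b: "0 < b" using insert.prems by auto
    \<comment> \<open>Time 0 is always included, so that the maximum exists and the step to the new
      time \<open>b\<close> starts from the last earlier time \<open>?s\<close>.\<close>
    let ?A = "insert 0 A" and ?s = "Max (insert 0 A)"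
    have finA: "finite ?A" using insert by simp
    have sA: "?s \<in> ?A" by (rule Max_in) (use finA in auto)
    have s: "0 \<le> ?s" "?s < b" using finA sA b insert.hyps(2) by (auto simp: Max_ge_iff)
    have AJ: "?A \<subseteq> {0..?s}" using finA insert.prems by auto
    have mx: "Max (insert 0 (insert b A)) = b"
      using s insert.hyps finA by (subst insert_commute, subst Max_insert) auto
    have cylX: "cyl X (insert 0 (insert b A)) B = cyl X ?A B \<inter> {w. X b w \<in> B b}"
      and cylY: "cyl Y (insert 0 (insert b A)) B = cyl Y ?A B \<inter> {w. Y b w \<in> B b}"
      by (auto simp: cyl_def)
    have mX: "cyl X ?A B \<in> sets (\<mu> ?s)"
      using AJ s insert.prems by (intro cyl_in_sets finA sp X) auto
    have mY: "cyl Y ?A B \<in> sets (\<nu> ?s)"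
      using AJ s insert.prems by (intro cyl_in_sets finA sp Y) auto
    let ?DX = "distr (density (\<mu> ?s) (indicator (cyl X ?A B))) borel (X ?s)"
    let ?DY = "distr (density (\<nu> ?s) (indicator (cyl Y ?A B))) borel (Y ?s)"
    have DX: "X ?s \<in> borel_measurable (\<mu> ?s)" and DY: "Y ?s \<in> borel_measurable (\<nu> ?s)"
      using X Y s by auto
    \<comment> \<open>The induction hypothesis holds for all \<open>B\<close>. Prescribing in
      addition that the value at time \<open>?s\<close> lies in \<open>C\<close> only shrinks
      \<open>B ?s\<close>, which gives equality of the laws at \<open>?s\<close> restricted to the
      cylinder.\<close>
    have "?DX = ?DY"
    proof (rule measure_eqI)
      fix C assume "C \<in> sets ?DX"
      then have C: "C \<in> sets borel" by simp
      let ?B = "B(?s := B ?s \<inter> C)"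
      have eX: "cyl X ?A B \<inter> {w. X ?s w \<in> C} = cyl X ?A ?B" and eY: "cyl Y ?A B \<inter> {w. Y ?s w \<in> C} = cyl Y ?A ?B"
        using sA by (auto simp: cyl_def)
      have "emeasure ?DX C = emeasure (\<mu> ?s) (cyl X ?A ?B)"
        using emeasure_distr_density_indicator[OF sp(1)[OF s(1)] DX mX C] by (simp only: eX)
      also have "\<dots> = emeasure (\<nu> ?s) (cyl Y ?A ?B)"
        by (rule insert.IH) (use insert.prems C in auto)
      also have "\<dots> = emeasure ?DY C"
        using emeasure_distr_density_indicator[OF sp(2)[OF s(1)] DY mY C] by (simp only: eY)
      finally show "emeasure ?DX C = emeasure ?DY C" .
    qed simp
    then have "(\<integral>\<^sup>+y. \<kappa> ?s b y (B b) \<partial>?DX) = (\<integral>\<^sup>+y. \<kappa> ?s b y (B b) \<partial>?DY)" by simp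
    moreover have "(\<integral>\<^sup>+y. \<kappa> ?s b y (B b) \<partial>?DX) = (\<integral>\<^sup>+w. indicator (cyl X ?A B) w * \<kappa> ?s b (X ?s w) (B b) \<partial>\<mu> ?s)"
      using \<kappa>[OF s, of "B b"] insert.prems mX DX
      by (simp add: nn_integral_distr nn_integral_density measurable_compose[OF DX])
    moreover have "(\<integral>\<^sup>+y. \<kappa> ?s b y (B b) \<partial>?DY) = (\<integral>\<^sup>+w. indicator (cyl Y ?A B) w * \<kappa> ?s b (Y ?s w) (B b) \<partial>\<nu> ?s)"
      using \<kappa>[OF s, of "B b"] insert.prems mY DY
      by (simp add: nn_integral_distr nn_integral_density measurable_compose[OF DY])
    ultimately show ?thesis
      unfolding mx cylX cylY
      using stepX[OF s finA AJ, of B "B b"] stepY[OF s finA AJ, of B "B b"] insert.prems by simp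
  qed
qed

text \<open>The hypothesis says that, on \<open>A\<close>, the variable \<open>D\<close> is independent of \<open>Z\<close> and has law \<open>N\<close>.\<close>

lemma nn_integral_indep:
  assumes M: "prob_space M" and N: "prob_space N" and A: "A \<in> sets M"
    and Z: "Z \<in> measurable M S" and D: "D \<in> measurable M N"
    and ind: "\<And>C E. C \<in> sets S \<Longrightarrow> E \<in> sets N \<Longrightarrow>
      emeasure M (A \<inter> (Z -` C \<inter> space M) \<inter> (D -` E \<inter> space M)) = emeasure M (A \<inter> (Z -` C \<inter> space M)) * emeasure N E"
    and H: "H \<in> borel_measurable (S \<Otimes>\<^sub>M N)"
  shows "(\<integral>\<^sup>+w. indicator A w * H (Z w, D w) \<partial>M) = (\<integral>\<^sup>+w. indicator A w * (\<integral>\<^sup>+d. H (Z w, d) \<partial>N) \<partial>M)"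
proof -
  interpret M: prob_space M by fact
  interpret N: prob_space N by fact
  note [measurable] = A Z D H
  let ?\<mu> = "density M (indicator A)"
  have "finite_measure ?\<mu>"
    by (rule finite_measureI) (simp add: emeasure_density M.emeasure_eq_measure cong: nn_integral_cong_simp)
  then interpret \<mu>: finite_measure ?\<mu> .
  let ?L = "distr ?\<mu> S Z"
  have "finite_measure ?L" by (rule \<mu>.finite_measure_distr) simp
  then interpret L: finite_measure ?L .
  have em: "emeasure ?\<mu> E = emeasure M (A \<inter> E)" if "E \<in> sets M" for E
    using that by (simp add: emeasure_density indicator_inter_arith[symmetric])
  have setsL: "sets (?L \<Otimes>\<^sub>M N) = sets (S \<Otimes>\<^sub>M N)" by (rule sets_pair_measure_cong) simp_all
  \<comment> \<open>Under \<open>M\<close> restricted to \<open>A\<close>, the pair has a product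
    law; checking this on rectangles is the hypothesis \<open>ind\<close>, and the claim is then
    Tonelli.\<close>
  have eq: "?L \<Otimes>\<^sub>M N = distr ?\<mu> (S \<Otimes>\<^sub>M N) (\<lambda>w. (Z w, D w))"
  proof (rule pair_measure_eqI)
    show "sigma_finite_measure ?L" "sigma_finite_measure N" by unfold_locales
    show "sets (?L \<Otimes>\<^sub>M N) = sets (distr ?\<mu> (S \<Otimes>\<^sub>M N) (\<lambda>w. (Z w, D w)))"
      using setsL by simp
    fix C E assume "C \<in> sets ?L" "E \<in> sets N"
    then have C[measurable]: "C \<in> sets S" and E[measurable]: "E \<in> sets N" by auto
    have vim: "(\<lambda>w. (Z w, D w)) -` (C \<times> E) \<inter> space M = (Z -` C \<inter> space M) \<inter> (D -` E \<inter> space M)" by auto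
    have ZC: "Z -` C \<inter> space M \<in> sets M" and DE: "D -` E \<inter> space M \<in> sets M"
      using measurable_sets[OF Z C] measurable_sets[OF D E] by auto
    have "emeasure ?L C = emeasure M (A \<inter> (Z -` C \<inter> space M))"
      using em[OF ZC] C Z by (subst emeasure_distr) simp_all
    moreover have "emeasure (distr ?\<mu> (S \<Otimes>\<^sub>M N) (\<lambda>w. (Z w, D w))) (C \<times> E) =
      emeasure M (A \<inter> (Z -` C \<inter> space M) \<inter> (D -` E \<inter> space M))"
    proof -
      have "emeasure (distr ?\<mu> (S \<Otimes>\<^sub>M N) (\<lambda>w. (Z w, D w))) (C \<times> E) =
        emeasure ?\<mu> ((\<lambda>w. (Z w, D w)) -` (C \<times> E) \<inter> space M)"
        by (subst emeasure_distr) simp_all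
      also have "\<dots> = emeasure M (A \<inter> ((Z -` C \<inter> space M) \<inter> (D -` E \<inter> space M)))"
        unfolding vim by (rule em[OF sets.Int[OF ZC DE]])
      finally show ?thesis by (simp only: Int_assoc)
    qed
    ultimately show "emeasure ?L C * emeasure N E = emeasure (distr ?\<mu> (S \<Otimes>\<^sub>M N) (\<lambda>w. (Z w, D w))) (C \<times> E)"
      using ind[OF C E] by simp
  qed
  have Hm: "H \<in> borel_measurable (?L \<Otimes>\<^sub>M N)"
    using H measurable_cong_sets[OF setsL refl] by blast
  have "(\<integral>\<^sup>+w. indicator A w * H (Z w, D w) \<partial>M) = (\<integral>\<^sup>+p. H p \<partial>distr ?\<mu> (S \<Otimes>\<^sub>M N) (\<lambda>w. (Z w, D w)))"
    by (simp add: nn_integral_distr nn_integral_density)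
  also have "\<dots> = (\<integral>\<^sup>+z. \<integral>\<^sup>+d. H (z, d) \<partial>N \<partial>?L)"
    unfolding eq[symmetric] by (rule N.nn_integral_fst[symmetric, OF Hm])
  also have "\<dots> = (\<integral>\<^sup>+w. indicator A w * (\<integral>\<^sup>+d. H (Z w, d) \<partial>N) \<partial>M)"
    by (simp add: nn_integral_distr nn_integral_density)
  finally show ?thesis .
qed

definition normal_kernel :: "real \<Rightarrow> real \<Rightarrow> real set \<Rightarrow> ennreal" where
  "normal_kernel v y C = (\<integral>\<^sup>+d. indicator C (y + d) \<partial>density lborel (normal_density 0 (sqrt v)))"

lemma measurable_normal_kernel:
  assumes [measurable]: "C \<in> sets borel" and v: "0 < v"
  shows "(\<lambda>y. normal_kernel v y C) \<in> borel_measurable borel"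
proof -
  interpret N: prob_space "density lborel (normal_density 0 (sqrt v))"
    using v by (intro prob_space_normal_density) simp
  show ?thesis unfolding normal_kernel_def by measurable
qed

text \<open>\<open>Z\<close> may be any variable known at time \<open>s\<close>. Besides
  \<open>coord s\<close>, the increment of the path since some earlier time is needed.\<close>

lemma wiener_increment:
  assumes W: "wiener_measure x M" and s: "0 \<le> s" "s < t"
    and A: "A \<in> sets (nat_filtration s)" and Z: "Z \<in> borel_measurable (nat_filtration s)" and C: "C \<in> sets borel"
  shows "emeasure M (A \<inter> {w. Z w + (coord t w - coord s w) \<in> C}) =
    (\<integral>\<^sup>+w. indicator A w * normal_kernel (t - s) (Z w) C \<partial>M)"
proof -
  let ?D = "\<lambda>w. coord t w - coord s w"
  let ?N = "density lborel (normal_density 0 (sqrt (t - s)))"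
  have M: "prob_space M" "sets M = sets borel" using W by (auto simp: wiener_measure_def)
  interpret M: prob_space M by fact
  have sp: "space M = UNIV" using sets_eq_imp_space_eq[OF M(2)] by simp
  have D: "distributed M lborel ?D (normal_density 0 (sqrt (t - s)))"
    and ind: "M.indep_set (sets (nat_filtration s)) (sets (vimage_algebra UNIV ?D borel))"
    using W s unfolding wiener_measure_def by blast+
  have Dm[measurable]: "?D \<in> borel_measurable M" using distributed_measurable[OF D] by simp
  have Am[measurable]: "A \<in> sets M" using A M(2) sets_nat_filtration_subset by auto
  have Zm[measurable]: "Z \<in> borel_measurable M" by (rule measurable_nat_filtration_borel[OF M(2) Z])
  have N: "prob_space ?N" using s by (intro prob_space_normal_density) simp
  have law: "emeasure M (?D -` E \<inter> space M) = emeasure ?N E" if "E \<in> sets borel" for E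
    unfolding distributed_distr_eq_density[OF D, symmetric] using that by (subst emeasure_distr) simp_all
  have "(\<integral>\<^sup>+w. indicator A w * indicator C (fst (Z w, ?D w) + snd (Z w, ?D w)) \<partial>M) =
    (\<integral>\<^sup>+w. indicator A w * (\<integral>\<^sup>+d. indicator C (fst (Z w, d) + snd (Z w, d)) \<partial>?N) \<partial>M)"
  proof (rule nn_integral_indep[where S = borel and H = "\<lambda>p. indicator C (fst p + snd p)", OF M(1) N Am Zm])
    show "?D \<in> measurable M ?N" using Dm by simp
    note [measurable] = C
    show "(\<lambda>p. indicator C (fst p + snd p) :: ennreal) \<in> borel_measurable (borel \<Otimes>\<^sub>M ?N)" by measurable
    fix E F assume E: "E \<in> sets (borel :: real measure)" and F: "F \<in> sets ?N"
    have "A \<inter> (Z -` E \<inter> space M) \<in> sets (nat_filtration s)"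
      using A measurable_sets[OF Z E] sp by auto
    moreover have "?D -` F \<inter> space M \<in> sets (vimage_algebra UNIV ?D borel)"
      using in_vimage_algebra[of F borel ?D UNIV] F sp by simp
    ultimately have "M.prob (A \<inter> (Z -` E \<inter> space M) \<inter> (?D -` F \<inter> space M)) =
      M.prob (A \<inter> (Z -` E \<inter> space M)) * M.prob (?D -` F \<inter> space M)"
      by (rule M.indep_setD[OF ind])
    then show "emeasure M (A \<inter> (Z -` E \<inter> space M) \<inter> (?D -` F \<inter> space M)) =
      emeasure M (A \<inter> (Z -` E \<inter> space M)) * emeasure ?N F"
      using law[of F] F by (simp add: M.emeasure_eq_measure ennreal_mult)
  qed
  moreover have "emeasure M (A \<inter> {w. Z w + ?D w \<in> C}) = (\<integral>\<^sup>+w. indicator A w * indicator C (Z w + ?D w) \<partial>M)"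
  proof -
    have [measurable]: "{w. Z w + ?D w \<in> C} \<in> sets M"
      using measurable_sets[OF borel_measurable_add[OF Zm Dm] C] sp by (simp add: vimage_def)
    have "indicator A w * indicator C (Z w + ?D w) = (indicator (A \<inter> {w. Z w + ?D w \<in> C}) w :: ennreal)" for w
      by (simp add: indicator_def)
    then show ?thesis by simp
  qed
  ultimately show ?thesis by (simp add: normal_kernel_def)
qed

section \<open>Markov property of Wiener measure\<close>

text \<open>With an arbitrary set of times this covers both \<open>nat_filtration\<close> and the
  full product sigma-algebra. Taking the latter as the target of \<open>shift\<close> allows
  measurability to be checked one coordinate at a time.\<close>

definition filt :: "real set \<Rightarrow> path measure" where
  "filt T = sigma UNIV {coord s -` B | s B. s \<in> T \<and> B \<in> sets borel}"

lemma space_filt [simp]: "space (filt T) = UNIV"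
  by (simp add: filt_def space_measure_of_conv)

lemma sets_filt: "sets (filt T) = sigma_sets UNIV {coord s -` B | s B. s \<in> T \<and> B \<in> sets borel}"
  unfolding filt_def by (rule sets_measure_of) auto

lemma nat_filtration_eq_filt: "nat_filtration t = filt {0..t}"
  unfolding nat_filtration_def filt_def by simp

lemma measurable_coord_filt: "s \<in> T \<Longrightarrow> coord s \<in> borel_measurable (filt T)"
  unfolding measurable_def by (auto simp: sets_filt)

lemma cyl_in_filt:
  "finite J \<Longrightarrow> J \<subseteq> T \<Longrightarrow> (\<And>j. B j \<in> sets borel) \<Longrightarrow> cyl coord J B \<in> sets (filt T)"
  by (rule cyl_in_sets) (auto intro: measurable_coord_filt)

lemma sets_filt_cyl:
  "sets (filt T) = sigma_sets UNIV {cyl coord J B | J B. finite J \<and> J \<subseteq> T \<and> (\<forall>j. B j \<in> sets borel)}" (is "_ = sigma_sets UNIV ?E")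
proof
  show "sets (filt T) \<subseteq> sigma_sets UNIV ?E"
    unfolding sets_filt
  proof (rule sigma_sets_mono', clarify)
    fix s and B :: "real set" assume "s \<in> T" "B \<in> sets borel"
    then show "\<exists>J B'. coord s -` B = cyl coord J B' \<and> finite J \<and> J \<subseteq> T \<and> (\<forall>j. B' j \<in> sets borel)"
      by (intro exI[of _ "{s}"] exI[of _ "\<lambda>_. B"]) (auto simp: cyl_def)
  qed
  have "?E \<subseteq> sets (filt T)" using cyl_in_filt by blast
  then show "sigma_sets UNIV ?E \<subseteq> sets (filt T)"
    using sets.sigma_sets_subset[of ?E "filt T"] by simp
qed

text \<open>Cylinders form a generator stable under intersection: to intersect two of them, use the
  union of the time sets and allow every value at times that one of them does not constrain.\<close>

lemma measure_eqI_cyl: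
  assumes M: "finite_measure M" "sets M = sets (filt T)" and N: "sets N = sets (filt T)"
    and eq: "\<And>J B. finite J \<Longrightarrow> J \<subseteq> T \<Longrightarrow> (\<And>j. B j \<in> sets borel) \<Longrightarrow>
      emeasure M (cyl coord J B) = emeasure N (cyl coord J B)"
  shows "M = N"
proof (rule measure_eqI_generator_eq)
  let ?E = "{cyl coord J B | J B. finite J \<and> J \<subseteq> T \<and> (\<forall>j. B j \<in> sets borel)}"
  show "Int_stable ?E"
  proof (rule Int_stableI, clarify)
    fix J K :: "real set" and B C :: "real \<Rightarrow> real set"
    assume *: "finite J" "finite K" "J \<subseteq> T" "K \<subseteq> T" "\<forall>j. B j \<in> sets borel" "\<forall>j. C j \<in> sets borel"
    let ?B = "\<lambda>j. (if j \<in> J then B j else UNIV) \<inter> (if j \<in> K then C j else UNIV)"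
    have "cyl coord J B \<inter> cyl coord K C = cyl coord (J \<union> K) ?B" by (auto simp: cyl_def)
    then show "\<exists>L D. cyl coord J B \<inter> cyl coord K C = cyl coord L D \<and> finite L \<and> L \<subseteq> T \<and> (\<forall>j. D j \<in> sets borel)"
      using * by (intro exI[of _ "J \<union> K"] exI[of _ ?B]) auto
  qed
  show "?E \<subseteq> Pow UNIV" by simp
  show "sets M = sigma_sets UNIV ?E" "sets N = sigma_sets UNIV ?E"
    using M(2) N sets_filt_cyl by auto
  show "emeasure M A = emeasure N A" if "A \<in> ?E" for A using that eq by auto
  show "range (\<lambda>_::nat. UNIV) \<subseteq> ?E"
  proof clarify
    show "\<exists>J B. UNIV = cyl coord J B \<and> finite J \<and> J \<subseteq> T \<and> (\<forall>j. B j \<in> sets borel)"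
      by (intro exI[of _ "{}"] exI[of _ "\<lambda>_. UNIV"]) (auto simp: cyl_def)
  qed
  show "(\<Union>i::nat. UNIV) = (UNIV :: path set)" by simp
  show "emeasure M UNIV \<noteq> \<infinity>" for i :: nat
    using M(1) by (simp add: finite_measure.emeasure_finite)
qed

text \<open>The position at time \<open>r\<close> is subtracted; what remains is independent of the
  past up to \<open>r\<close>, and its law depends neither on \<open>r\<close> nor on the starting
  point.\<close>

definition shift :: "real \<Rightarrow> path \<Rightarrow> path" where
  "shift r w = mk_path (\<lambda>s. coord (r + s) w - coord r w)"

lemma coord_shift:
  assumes "0 \<le> r" "0 \<le> s"
  shows "coord s (shift r w) = coord (r + s) w - coord r w"
proof -
  have "continuous_on {0..} (\<lambda>s. coord (r + s) w)"
    by (rule continuous_on_compose2[OF continuous_coord]) (use assms in \<open>auto intro!: continuous_intros\<close>)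
  then show ?thesis
    unfolding shift_def by (intro coord_mk_path continuous_intros assms)
qed

lemma measurable_shift:
  assumes r: "0 \<le> r" and M: "sets M = sets borel"
  shows "shift r \<in> measurable M (filt {0..})"
  unfolding filt_def
proof (rule measurable_measure_of)
  have sp: "space M = UNIV" using sets_eq_imp_space_eq[OF M] by simp
  fix y assume "y \<in> {coord s -` B | s B. s \<in> {0..} \<and> B \<in> sets (borel :: real measure)}"
  then obtain s B where y: "y = coord s -` B" "0 \<le> s" and B: "B \<in> sets (borel :: real measure)" by auto
  have "coord (r + s) \<in> borel_measurable M" "coord r \<in> borel_measurable M"
    using measurable_coord[of "r + s"] measurable_coord[of r] r y(2) M by (auto cong: measurable_cong_sets)
  then have m: "(\<lambda>w. coord (r + s) w - coord r w) \<in> borel_measurable M" by simp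
  have "shift r -` y \<inter> space M = (\<lambda>w. coord (r + s) w - coord r w) -` B \<inter> space M"
    using coord_shift[OF r y(2)] by (auto simp: y(1))
  then show "shift r -` y \<inter> space M \<in> sets M" using measurable_sets[OF m B] by simp
qed auto

lemma wiener_prob_space:
  assumes "wiener_measure x M"
  shows "prob_space M" "sets M = sets borel" "space M = UNIV" "AE w in M. coord 0 w = x"
  using assms sets_eq_imp_space_eq[of M borel] by (auto simp: wiener_measure_def)

text \<open>Independence of past and future increments together with uniqueness of their law. The
  increments after \<open>r\<close> under \<open>Wx\<close> restricted to \<open>A\<close>, and
  those after 0 under \<open>Wy\<close> scaled by the mass of \<open>A\<close>, both start at 0 and
  move by the same Gaussian kernel, so their finite-dimensional distributions agree.\<close>

lemma wiener_increments_law: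
  assumes Wx: "wiener_measure x Wx" and Wy: "wiener_measure y Wy"
    and r: "0 \<le> r" and A: "A \<in> sets (nat_filtration r)" and S: "S \<in> sets (filt {0..})"
  shows "emeasure Wx (A \<inter> shift r -` S) = emeasure Wx A * emeasure Wy (shift 0 -` S)"
proof -
  note x = wiener_prob_space[OF Wx] and y = wiener_prob_space[OF Wy]
  interpret Wx: prob_space Wx by (rule x(1))
  interpret Wy: prob_space Wy by (rule y(1))
  have AW[measurable]: "A \<in> sets Wx" using A x(2) sets_nat_filtration_subset by auto
  let ?\<mu> = "density Wx (indicator A)" and ?\<nu> = "scale_measure (emeasure Wx A) Wy"
  let ?X = "\<lambda>s w. coord (r + s) w - coord r w" and ?Y = "\<lambda>s w. coord s w - coord 0 w"
  let ?\<kappa> = "\<lambda>s t. normal_kernel (t - s)"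
  have em: "emeasure ?\<mu> E = emeasure Wx (A \<inter> E)" if "E \<in> sets Wx" for E
    using that by (simp add: emeasure_density indicator_inter_arith[symmetric])
  have mc[measurable]: "coord s \<in> borel_measurable Wx" "coord s \<in> borel_measurable Wy" if "0 \<le> s" for s
    using measurable_coord[OF that] x(2) y(2) by (auto cong: measurable_cong_sets)
  have XF: "?X s \<in> borel_measurable (nat_filtration t')" if "0 \<le> s" "r + s \<le> t'" for s t'
    using r that by (intro borel_measurable_diff measurable_coord_nat_filtration) auto
  have YF: "?Y s \<in> borel_measurable (nat_filtration t')" if "0 \<le> s" "s \<le> t'" for s t'
    using that by (intro borel_measurable_diff measurable_coord_nat_filtration) auto
  have fdd: "emeasure ?\<mu> (cyl ?X (insert 0 J) B) = emeasure ?\<nu> (cyl ?Y (insert 0 J) B)"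
    if J: "finite J" "J \<subseteq> {0..}" and B: "\<And>j. B j \<in> sets borel" for J and B :: "real \<Rightarrow> real set"
  proof (rule fdd_unique[where \<mu> = "\<lambda>_. ?\<mu>" and \<nu> = "\<lambda>_. ?\<nu>" and X = ?X and Y = ?Y and \<kappa> = ?\<kappa>, OF _ _ _ _ _ _ _ _ J B])
    show "space ?\<mu> = UNIV" "space ?\<nu> = UNIV" using x(3) y(3) by (simp_all add: space_scale_measure)
    show "?X s \<in> borel_measurable ?\<mu>" "?Y s \<in> borel_measurable ?\<nu>" if "0 \<le> s" for s
      using mc[of s] mc[of 0] mc[of r] mc[of "r + s"] r that by (simp_all cong: measurable_cong_sets)
    show "(\<lambda>y. ?\<kappa> s t y C) \<in> borel_measurable borel" if "s < t" "C \<in> sets borel" for s t C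
      using that by (intro measurable_normal_kernel) auto
    show "emeasure ?\<mu> {w. ?X 0 w \<in> C} = emeasure ?\<nu> {w. ?Y 0 w \<in> C}" for C
      using em[of UNIV] sets.top[of Wx] x(3) y(3) Wy.emeasure_space_1 by (cases "0 \<in> C") auto
  next
    fix s t :: real and J :: "real set" and B :: "real \<Rightarrow> real set" and C :: "real set"
    assume st: "(0::real) \<le> s" "s < t" and J: "finite J" "J \<subseteq> {0..s}"
      and B: "\<And>j. B j \<in> sets borel" and C: "C \<in> sets borel"
    have cF: "cyl ?X J B \<in> sets (nat_filtration (r + s))"
      using J B by (intro cyl_in_sets XF) auto
    have AF: "A \<inter> cyl ?X J B \<in> sets (nat_filtration (r + s))"
      using A sets_nat_filtration_mono[of r "r + s"] st(1) cF by auto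
    have cW: "cyl ?X J B \<in> sets Wx" using cF x(2) sets_nat_filtration_subset by auto
    have XC: "{w. ?X t w \<in> C} \<in> sets Wx"
      using measurable_sets[OF borel_measurable_diff[OF mc(1) mc(1)] C, of "r + t" r] r st x(3) by (simp add: vimage_def)
    have "emeasure ?\<mu> (cyl ?X J B \<inter> {w. ?X t w \<in> C}) =
      emeasure Wx ((A \<inter> cyl ?X J B) \<inter> {w. ?X s w + (coord (r + t) w - coord (r + s) w) \<in> C})"
      by (simp add: em[OF sets.Int[OF cW XC]] Int_assoc)
    also have "\<dots> = (\<integral>\<^sup>+w. indicator (A \<inter> cyl ?X J B) w * normal_kernel ((r + t) - (r + s)) (?X s w) C \<partial>Wx)"
      by (rule wiener_increment[OF Wx _ _ AF XF C]) (use r st in auto)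
    also have "\<dots> = (\<integral>\<^sup>+w. indicator (cyl ?X J B) w * ?\<kappa> s t (?X s w) C \<partial>?\<mu>)"
    proof -
      have [measurable]: "(\<lambda>w. ?\<kappa> s t (?X s w) C) \<in> borel_measurable Wx"
        using measurable_compose[OF borel_measurable_diff[OF mc(1) mc(1)] measurable_normal_kernel[OF C], of "r + s" r "t - s"] r st by simp
      note [measurable] = cW
      show ?thesis by (subst nn_integral_density) (simp_all add: indicator_inter_arith mult.assoc)
    qed
    finally show "emeasure ?\<mu> (cyl ?X J B \<inter> {w. ?X t w \<in> C}) = (\<integral>\<^sup>+w. indicator (cyl ?X J B) w * ?\<kappa> s t (?X s w) C \<partial>?\<mu>)" .
    have cF: "cyl ?Y J B \<in> sets (nat_filtration s)"
      using J B by (intro cyl_in_sets YF) auto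
    have cW: "cyl ?Y J B \<in> sets Wy" using cF y(2) sets_nat_filtration_subset by auto
    have "emeasure Wy (cyl ?Y J B \<inter> {w. ?Y t w \<in> C}) =
      emeasure Wy (cyl ?Y J B \<inter> {w. ?Y s w + (coord t w - coord s w) \<in> C})" by simp
    also have "\<dots> = (\<integral>\<^sup>+w. indicator (cyl ?Y J B) w * ?\<kappa> s t (?Y s w) C \<partial>Wy)"
      by (rule wiener_increment[OF Wy st cF YF C]) (use st in auto)
    finally have "emeasure ?\<nu> (cyl ?Y J B \<inter> {w. ?Y t w \<in> C}) = emeasure Wx A * \<dots>" by simp
    also have "\<dots> = (\<integral>\<^sup>+w. indicator (cyl ?Y J B) w * ?\<kappa> s t (?Y s w) C \<partial>?\<nu>)"
    proof (rule nn_integral_scale_measure[symmetric])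
      have "(\<lambda>w. ?\<kappa> s t (?Y s w) C) \<in> borel_measurable Wy"
        using measurable_compose[OF borel_measurable_diff[OF mc(2) mc(2)] measurable_normal_kernel[OF C], of s 0 "t - s"] st by simp
      then show "(\<lambda>w. indicator (cyl ?Y J B) w * ?\<kappa> s t (?Y s w) C) \<in> borel_measurable Wy"
        using cW by measurable
    qed
    finally show "emeasure ?\<nu> (cyl ?Y J B \<inter> {w. ?Y t w \<in> C}) = (\<integral>\<^sup>+w. indicator (cyl ?Y J B) w * ?\<kappa> s t (?Y s w) C \<partial>?\<nu>)" .
  qed
  have sr: "shift r \<in> measurable ?\<mu> (filt {0..})" using measurable_shift[OF r, of Wx] x(2) by simp
  have s0: "shift 0 \<in> measurable Wy (filt {0..})" using measurable_shift[of 0 Wy] y(2) by simp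
  have "distr ?\<mu> (filt {0..}) (shift r) = scale_measure (emeasure Wx A) (distr Wy (filt {0..}) (shift 0))"
  proof (rule measure_eqI_cyl)
    have "finite_measure ?\<mu>"
      using em[of UNIV] sets.top[of Wx] x(3) by (intro finite_measureI) (simp add: Wx.emeasure_eq_measure)
    then show "finite_measure (distr ?\<mu> (filt {0..}) (shift r))"
      by (rule finite_measure.finite_measure_distr) (rule sr)
    fix J :: "real set" and B :: "real \<Rightarrow> real set"
    assume J: "finite J" "J \<subseteq> {0..}" and B: "\<And>j. B j \<in> sets (borel :: real measure)"
    \<comment> \<open>\<open>fdd\<close> includes time 0 in the cylinder; allowing every value
      outside \<open>J\<close> makes this harmless.\<close>
    let ?B = "\<lambda>j. if j \<in> J then B j else UNIV"
    have cJ: "cyl coord J B \<in> sets (filt {0..})" by (rule cyl_in_filt[OF J B])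
    have vX: "shift r -` cyl coord J B = cyl ?X (insert 0 J) ?B"
      using J(2) coord_shift[OF r] by (auto simp: cyl_def subset_iff)
    have vY: "shift 0 -` cyl coord J B = cyl ?Y (insert 0 J) ?B"
      using J(2) coord_shift[of 0] by (auto simp: cyl_def subset_iff)
    have "emeasure (distr ?\<mu> (filt {0..}) (shift r)) (cyl coord J B) = emeasure ?\<mu> (cyl ?X (insert 0 J) ?B)"
      using emeasure_distr[OF sr cJ] x(3) by (simp add: vX)
    also have "\<dots> = emeasure ?\<nu> (cyl ?Y (insert 0 J) ?B)"
      by (rule fdd[OF J]) (simp add: B)
    also have "\<dots> = emeasure (scale_measure (emeasure Wx A) (distr Wy (filt {0..}) (shift 0))) (cyl coord J B)"
      using emeasure_distr[OF s0 cJ] y(3) by (simp add: vY)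
    finally show "emeasure (distr ?\<mu> (filt {0..}) (shift r)) (cyl coord J B) =
      emeasure (scale_measure (emeasure Wx A) (distr Wy (filt {0..}) (shift 0))) (cyl coord J B)" .
  qed simp_all
  then have "emeasure (distr ?\<mu> (filt {0..}) (shift r)) S = emeasure Wx A * emeasure (distr Wy (filt {0..}) (shift 0)) S"
    by simp
  moreover have "shift r -` S \<in> sets Wx" using measurable_sets[OF sr S] x(3) by simp
  ultimately show ?thesis
    using emeasure_distr[OF sr S] emeasure_distr[OF s0 S] em x(3) y(3) by simp
qed

section \<open>Survival in the strip and the Markov property\<close>

text \<open>A function of the starting point and the increments separately: in this form the Markov
  property at time \<open>r\<close> becomes the independence of \<open>coord r\<close> and
  \<open>shift r\<close>.\<close>

definition surviving :: "real \<Rightarrow> real \<Rightarrow> (real \<Rightarrow> ennreal) \<Rightarrow> real \<times> path \<Rightarrow> ennreal" where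
  "surviving u t \<phi> p = \<phi> (fst p + coord t (snd p)) *
     indicator {p. \<forall>s\<in>{0..t}. 0 < fst p + coord s (snd p) \<and> fst p + coord s (snd p) < u} p"

lemma measurable_surviving:
  assumes \<phi>[measurable]: "\<phi> \<in> borel_measurable borel" and t: "0 \<le> t"
  shows "surviving u t \<phi> \<in> borel_measurable (borel \<Otimes>\<^sub>M filt {0..})"
proof -
  let ?M = "borel \<Otimes>\<^sub>M filt {0..} :: (real \<times> path) measure"
  have sp: "space ?M = UNIV" by (simp add: space_pair_measure)
  have [measurable]: "(\<lambda>p. coord s (snd p)) \<in> borel_measurable ?M" if "0 \<le> s" for s
    using that by (intro measurable_compose[OF measurable_snd measurable_coord_filt]) simp
  have "{p \<in> space ?M. \<forall>s\<in>{0..t}. 0 < min (fst p + coord s (snd p)) (u - (fst p + coord s (snd p)))} \<in> sets ?M"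
  proof (rule sets_forall_pos)
    fix s assume "s \<in> {0..t}"
    then have [measurable]: "(\<lambda>p. coord s (snd p)) \<in> borel_measurable ?M" by simp
    show "(\<lambda>p. min (fst p + coord s (snd p)) (u - (fst p + coord s (snd p)))) \<in> borel_measurable ?M" by measurable
  qed (intro continuous_intros continuous_coord_Icc, auto)
  then have [measurable]: "{p. \<forall>s\<in>{0..t}. 0 < fst p + coord s (snd p) \<and> fst p + coord s (snd p) < u} \<in> sets ?M"
    by (simp add: sp)
  have [measurable]: "(\<lambda>p. coord t (snd p)) \<in> borel_measurable ?M" using t by simp
  show ?thesis unfolding surviving_def[abs_def] by measurable
qed

lemma wiener_increments_law_unique:
  assumes Wx: "wiener_measure x Wx" and Wy: "wiener_measure y Wy"
  shows "distr Wx (filt {0..}) (shift 0) = distr Wy (filt {0..}) (shift 0)"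
proof (rule measure_eqI)
  note x = wiener_prob_space[OF Wx] and y = wiener_prob_space[OF Wy]
  fix S assume "S \<in> sets (distr Wx (filt {0..}) (shift 0))"
  then have S: "S \<in> sets (filt {0..})" by simp
  have "UNIV \<in> sets (nat_filtration 0)" using sets.top[of "nat_filtration 0"] by simp
  from wiener_increments_law[OF Wx Wy order_refl this S]
  have "emeasure Wx (shift 0 -` S) = emeasure Wy (shift 0 -` S)"
    using prob_space.emeasure_space_1[OF x(1)] x(3) by simp
  then show "emeasure (distr Wx (filt {0..}) (shift 0)) S = emeasure (distr Wy (filt {0..}) (shift 0)) S"
    using emeasure_distr[OF measurable_shift[OF order_refl x(2)] S] emeasure_distr[OF measurable_shift[OF order_refl y(2)] S] x(3) y(3)
    by simp
qed simp

text \<open>The expectation of \<open>\<phi>\<close> at time \<open>t\<close> over surviving paths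
  started at \<open>y\<close>, obtained by translating the increments of the single measure
  \<open>Wx\<close>. Measurability in \<open>y\<close> is then a case of Tonelli, whereas a family
  of Wiener measures comes with none.\<close>

definition survival_kernel :: "path measure \<Rightarrow> real \<Rightarrow> real \<Rightarrow> (real \<Rightarrow> ennreal) \<Rightarrow> real \<Rightarrow> ennreal" where
  "survival_kernel Wx u t \<phi> y = (\<integral>\<^sup>+\<omega>. surviving u t \<phi> (y, \<omega>) \<partial>distr Wx (filt {0..}) (shift 0))"

lemma measurable_survival_kernel:
  assumes Wx: "wiener_measure x Wx" and \<phi>: "\<phi> \<in> borel_measurable borel" and t: "0 \<le> t"
  shows "survival_kernel Wx u t \<phi> \<in> borel_measurable borel"
proof -
  note x = wiener_prob_space[OF Wx]
  interpret N: prob_space "distr Wx (filt {0..}) (shift 0)"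
    by (rule prob_space.prob_space_distr[OF x(1) measurable_shift[OF order_refl x(2)]])
  have "surviving u t \<phi> \<in> borel_measurable (borel \<Otimes>\<^sub>M distr Wx (filt {0..}) (shift 0))"
    using measurable_surviving[OF \<phi> t] measurable_cong_sets[OF sets_pair_measure_cong[OF refl sets_distr] refl] by blast
  from N.borel_measurable_nn_integral_fst[OF this] show ?thesis
    unfolding survival_kernel_def[abs_def] .
qed

lemma survival_kernel_eq:
  assumes Wx: "wiener_measure x Wx" and Wy: "wiener_measure y Wy"
    and \<phi>: "\<phi> \<in> borel_measurable borel" and t: "0 \<le> t"
  shows "survival_kernel Wx u t \<phi> y = (\<integral>\<^sup>+w. \<phi> (coord t w) * indicator (stays 0 u t) w \<partial>Wy)"
proof -
  note y = wiener_prob_space[OF Wy]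
  have m: "(\<lambda>\<omega>. surviving u t \<phi> (y, \<omega>)) \<in> borel_measurable (filt {0..})"
    by (rule measurable_compose[OF _ measurable_surviving[OF \<phi> t]]) simp
  have "survival_kernel Wx u t \<phi> y = (\<integral>\<^sup>+w. surviving u t \<phi> (y, shift 0 w) \<partial>Wy)"
    unfolding survival_kernel_def wiener_increments_law_unique[OF Wx Wy]
    by (rule nn_integral_distr[OF measurable_shift[OF order_refl y(2)]]) (use m in simp)
  also have "\<dots> = (\<integral>\<^sup>+w. \<phi> (coord t w) * indicator (stays 0 u t) w \<partial>Wy)"
  proof (rule nn_integral_cong_AE)
    show "AE w in Wy. surviving u t \<phi> (y, shift 0 w) = \<phi> (coord t w) * indicator (stays 0 u t) w"
      using y(4)
    proof eventually_elim
      case (elim w)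
      then have "y + coord s (shift 0 w) = coord s w" if "0 \<le> s" for s
        using coord_shift[of 0 s w] that by simp
      then show ?case using t by (simp add: surviving_def stays_def indicator_def)
    qed
  qed
  finally show ?thesis .
qed

text \<open>Survival up to \<open>r + t\<close> is survival up to \<open>r\<close>, an event of the
  past that joins \<open>A\<close>, followed by survival of the path restarted from
  \<open>coord r\<close>, a function of \<open>coord r\<close> and \<open>shift r\<close>. These are
  independent in the sense of \<open>nn_integral_indep\<close>.\<close>

lemma wiener_markov_surviving:
  assumes Wx: "wiener_measure x Wx" and \<phi>: "\<phi> \<in> borel_measurable borel" and r: "0 \<le> r" and t: "0 \<le> t"
    and A: "A \<in> sets (nat_filtration r)"
  shows "(\<integral>\<^sup>+w. indicator A w * (\<phi> (coord (r + t) w) * indicator (stays 0 u (r + t)) w) \<partial>Wx) =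
    (\<integral>\<^sup>+w. indicator A w * (indicator (stays 0 u r) w * survival_kernel Wx u t \<phi> (coord r w)) \<partial>Wx)"
proof -
  note x = wiener_prob_space[OF Wx]
  let ?A = "A \<inter> stays 0 u r" and ?N = "distr Wx (filt {0..}) (shift 0)"
  have AF: "?A \<in> sets (nat_filtration r)" using A stays_in_nat_filtration by auto
  have "(\<integral>\<^sup>+w. indicator ?A w * surviving u t \<phi> (coord r w, shift r w) \<partial>Wx) =
    (\<integral>\<^sup>+w. indicator ?A w * (\<integral>\<^sup>+\<omega>. surviving u t \<phi> (coord r w, \<omega>) \<partial>?N) \<partial>Wx)"
  proof (rule nn_integral_indep[OF x(1)])
    show "prob_space ?N" by (rule prob_space.prob_space_distr[OF x(1) measurable_shift[OF order_refl x(2)]])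
    show "?A \<in> sets Wx" using AF x(2) sets_nat_filtration_subset by auto
    show "coord r \<in> borel_measurable Wx" using measurable_coord[OF r] x(2) by (simp cong: measurable_cong_sets)
    show "shift r \<in> measurable Wx ?N" using measurable_shift[OF r x(2)] by simp
    show "surviving u t \<phi> \<in> borel_measurable (borel \<Otimes>\<^sub>M ?N)"
      using measurable_surviving[OF \<phi> t] measurable_cong_sets[OF sets_pair_measure_cong[OF refl sets_distr] refl] by blast
    fix C E assume C: "C \<in> sets (borel :: real measure)" and "E \<in> sets ?N"
    then have E: "E \<in> sets (filt {0..})" by simp
    have ACF: "?A \<inter> coord r -` C \<in> sets (nat_filtration r)"
      using AF measurable_sets[OF measurable_coord_nat_filtration[OF r order_refl] C] by auto
    show "emeasure Wx (?A \<inter> (coord r -` C \<inter> space Wx) \<inter> (shift r -` E \<inter> space Wx)) =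
      emeasure Wx (?A \<inter> (coord r -` C \<inter> space Wx)) * emeasure ?N E"
      using wiener_increments_law[OF Wx Wx r ACF E] emeasure_distr[OF measurable_shift[OF order_refl x(2)] E] x(3) by simp
  qed
  moreover have "indicator ?A w * surviving u t \<phi> (coord r w, shift r w) =
    indicator A w * (\<phi> (coord (r + t) w) * indicator (stays 0 u (r + t)) w)" for w
  proof -
    have c: "coord r w + coord s (shift r w) = coord (r + s) w" if "0 \<le> s" for s
      using coord_shift[OF r that] by simp
    \<comment> \<open>A time beyond \<open>r\<close> is \<open>r + s\<close> with \<open>s\<close>
      in \<open>{0..t}\<close>.\<close>
    have "w \<in> stays 0 u (r + t) \<longleftrightarrow> w \<in> stays 0 u r \<and> (\<forall>s\<in>{0..t}. 0 < coord (r + s) w \<and> coord (r + s) w < u)"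
    proof safe
      assume *: "w \<in> stays 0 u r" "\<forall>s\<in>{0..t}. 0 < coord (r + s) w \<and> coord (r + s) w < u"
      have "0 < coord s w \<and> coord s w < u" if s: "s \<in> {0..r + t}" for s
      proof (cases "s \<le> r")
        case True
        then show ?thesis using *(1) s by (simp add: stays_def)
      next
        case False
        then show ?thesis using *(2)[rule_format, of "s - r"] s by simp
      qed
      then show "w \<in> stays 0 u (r + t)" by (simp add: stays_def)
    qed (use r t in \<open>auto simp: stays_def\<close>)
    then show ?thesis
      using c t by (auto simp: surviving_def indicator_def)
  qed
  ultimately show ?thesis
    by (simp add: survival_kernel_def indicator_inter_arith mult.assoc)
qed

text \<open>\<open>killed_density\<close> gives the law of \<open>coord t\<close> on the paths that
  survive, first on Borel sets; equality of measures then extends it to all nonnegative test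
  functions.\<close>

lemma survival_kernel_killed_density:
  assumes Wx: "wiener_measure x Wx" and W: "\<And>y. wiener_measure y (W y)" and p: "killed_density W u p"
    and y: "y \<in> {0<..<u}" and t: "0 < t" and \<phi>: "\<phi> \<in> borel_measurable borel"
  shows "survival_kernel Wx u t \<phi> y = (\<integral>\<^sup>+z. \<phi> z * (indicator {0<..<u} z * ennreal (p t y z)) \<partial>lborel)"
proof -
  note w = wiener_prob_space[OF W[of y]]
  have [measurable]: "p t y \<in> borel_measurable borel" and p0: "\<And>z. 0 \<le> p t y z"
    and pB: "\<And>B. B \<in> sets borel \<Longrightarrow> B \<subseteq> {0<..<u} \<Longrightarrow>
      emeasure (W y) {w. coord t w \<in> B \<and> ereal t < hit_time (\<lambda>_. {0, u}) w} = (\<integral>\<^sup>+z\<in>B. ennreal (p t y z) \<partial>lborel)"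
    using p y t unfolding killed_density_def by auto
  have st: "stays 0 u t \<in> sets (W y)"
    unfolding w(2) by (rule subsetD[OF sets_nat_filtration_subset stays_in_nat_filtration])
  have ct: "coord t \<in> borel_measurable (W y)" using measurable_coord[of t] t w(2) by (simp cong: measurable_cong_sets)
  let ?D = "distr (density (W y) (indicator (stays 0 u t))) borel (coord t)"
  let ?f = "\<lambda>z. indicator {0<..<u} z * ennreal (p t y z)"
  have eq: "?D = density lborel ?f"
  proof (rule measure_eqI)
    fix B assume "B \<in> sets ?D"
    then have B[measurable]: "B \<in> sets borel" by simp
    \<comment> \<open>\<open>killed_density\<close> speaks of subsets of the open interval only; a
      surviving path is inside it at time \<open>t\<close> anyway.\<close>
    let ?B = "B \<inter> {0<..<u}"
    have h: "{w. ereal t < hit_time (\<lambda>_. {0, u}) w} \<in> sets (nat_filtration t)"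
      using less_hit_time_in_nat_filtration[of t 0 u] t by simp
    have cB: "{w. coord t w \<in> ?B} \<in> sets (nat_filtration t)"
      using measurable_sets[OF measurable_coord_nat_filtration[of t t], of ?B] t by (simp add: vimage_def)
    have cB': "{w. coord t w \<in> B} \<in> sets (W y)"
      using measurable_sets[OF ct B] w(3) by (simp add: vimage_def)
    have "emeasure ?D B = emeasure (W y) (stays 0 u t \<inter> {w. coord t w \<in> B})"
      by (rule emeasure_distr_density_indicator[OF w(3) ct st B])
    also have "\<dots> = emeasure (W y) {w. coord t w \<in> ?B \<and> ereal t < hit_time (\<lambda>_. {0, u}) w}"
    proof (rule emeasure_eq_AE)
      show "AE w in W y. w \<in> stays 0 u t \<inter> {w. coord t w \<in> B} \<longleftrightarrow> w \<in> {w. coord t w \<in> ?B \<and> ereal t < hit_time (\<lambda>_. {0, u}) w}"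
        using w(4)
      proof eventually_elim
        case (elim w)
        have "ereal t < hit_time (\<lambda>_. {0, u}) w \<longleftrightarrow> w \<in> stays 0 u t"
          using less_hit_time_iff_stays[of t w u 0] t y elim by simp
        moreover have "w \<in> stays 0 u t \<Longrightarrow> coord t w \<in> {0<..<u}" using t by (auto simp: stays_def)
        ultimately show ?case by auto
      qed
      show "stays 0 u t \<inter> {w. coord t w \<in> B} \<in> sets (W y)" using st cB' by auto
      have "{w. coord t w \<in> ?B} \<inter> {w. ereal t < hit_time (\<lambda>_. {0, u}) w} \<in> sets (W y)"
        using cB h w(2) sets_nat_filtration_subset by auto
      then show "{w. coord t w \<in> ?B \<and> ereal t < hit_time (\<lambda>_. {0, u}) w} \<in> sets (W y)"
        by (simp add: Collect_conj_eq Int_assoc)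
    qed
    also have "\<dots> = (\<integral>\<^sup>+z\<in>?B. ennreal (p t y z) \<partial>lborel)" by (rule pB) auto
    also have "\<dots> = emeasure (density lborel ?f) B"
      by (subst emeasure_density) (auto intro!: nn_integral_cong simp: indicator_def)
    finally show "emeasure ?D B = emeasure (density lborel ?f) B" .
  qed simp
  have "survival_kernel Wx u t \<phi> y = (\<integral>\<^sup>+w. \<phi> (coord t w) * indicator (stays 0 u t) w \<partial>W y)"
    using survival_kernel_eq[OF Wx W \<phi>, of t u y] t by simp
  also have "\<dots> = (\<integral>\<^sup>+z. \<phi> z \<partial>?D)"
    using st ct \<phi> measurable_compose[OF ct \<phi>]
    by (simp add: nn_integral_distr nn_integral_density mult.commute)
  also have "\<dots> = (\<integral>\<^sup>+z. \<phi> z * ?f z \<partial>lborel)"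
    unfolding eq using \<phi> by (subst nn_integral_density) (simp_all add: mult.commute)
  finally show ?thesis .
qed

section \<open>The Doob transform\<close>

text \<open>Where the sine is negative, \<open>ennreal\<close> turns it into 0. The function is
  evaluated only at positions of surviving paths, which lie in the interval where the sine is
  positive.\<close>

definition sine_test :: "real \<Rightarrow> real set \<Rightarrow> real \<Rightarrow> ennreal" where
  "sine_test u B z = ennreal (sin (pi * z / u)) * indicator B z"

text \<open>The part of \<open>doob_density\<close> that depends on the starting point and the time
  but not on the endpoint.\<close>

definition doob_factor :: "real \<Rightarrow> real \<Rightarrow> real \<Rightarrow> real" where
  "doob_factor u t y = exp (pi\<^sup>2 / u\<^sup>2 * (t / 2)) / sin (pi * y / u)"

text \<open>Transition probabilities of the conditioned process, expressed through
  \<open>survival_kernel\<close> to be jointly usable under \<open>P\<close> and under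
  \<open>Wx\<close>. The indicator removes starting points where the sine in the denominator is not
  positive.\<close>

definition doob_kernel :: "path measure \<Rightarrow> real \<Rightarrow> real \<Rightarrow> real \<Rightarrow> real \<Rightarrow> real set \<Rightarrow> ennreal" where
  "doob_kernel Wx u s t y C =
     indicator {0<..<u} y * (ennreal (doob_factor u (t - s) y) * survival_kernel Wx u (t - s) (sine_test u C) y)"

lemma measurable_sine_test:
  assumes [measurable]: "B \<in> sets borel"
  shows "sine_test u B \<in> borel_measurable borel"
  unfolding sine_test_def[abs_def] by measurable

lemma sin_pi_div_pos: "y \<in> {0<..<u} \<Longrightarrow> 0 < sin (pi * y / u)"
  by (intro sin_gt_zero) (auto simp: field_simps)

lemma doob_factor_pos: "y \<in> {0<..<u} \<Longrightarrow> 0 < doob_factor u t y"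
  by (simp add: doob_factor_def sin_pi_div_pos)

lemma measurable_doob_kernel:
  assumes "wiener_measure x Wx" "s < t" "C \<in> sets borel"
  shows "(\<lambda>y. doob_kernel Wx u s t y C) \<in> borel_measurable borel"
proof -
  have [measurable]: "survival_kernel Wx u (t - s) (sine_test u C) \<in> borel_measurable borel"
    by (rule measurable_survival_kernel[OF assms(1) measurable_sine_test]) (use assms in auto)
  show ?thesis unfolding doob_kernel_def doob_factor_def by measurable
qed

lemma doob_density_integral:
  assumes Wx: "wiener_measure x Wx" and W: "\<And>y. wiener_measure y (W y)" and p: "killed_density W u p"
    and y: "y \<in> {0<..<u}" and t: "0 < t" and B[measurable]: "B \<in> sets borel"
  shows "ennreal (LINT z:B \<inter> {0<..<u}|lborel. doob_density u p t y z) =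
      ennreal (doob_factor u t y) * survival_kernel Wx u t (sine_test u B) y"
    and "0 \<le> (LINT z:B \<inter> {0<..<u}|lborel. doob_density u p t y z)"
proof -
  have [measurable]: "p t y \<in> borel_measurable borel" and p0: "\<And>z. 0 \<le> p t y z"
    using p y t unfolding killed_density_def by auto
  let ?S = "{0<..<u}" and ?c = "doob_factor u t y"
  let ?f = "\<lambda>z. indicator (B \<inter> ?S) z *\<^sub>R doob_density u p t y z"
  have c: "0 < ?c" by (rule doob_factor_pos[OF y])
  have f0: "0 \<le> ?f z" for z
    using sin_pi_div_pos[of z u] sin_pi_div_pos[OF y] p0[of z]
    by (cases "z \<in> ?S") (auto simp: doob_density_def intro!: mult_nonneg_nonneg)
  have fm: "?f \<in> borel_measurable lborel" unfolding doob_density_def by measurable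
  have fe: "ennreal (?f z) = ennreal ?c * (sine_test u B z * (indicator ?S z * ennreal (p t y z)))" for z
  proof (cases "z \<in> ?S \<and> z \<in> B")
    case True
    have "?f z = ?c * (sin (pi * z / u) * p t y z)" using True by (simp add: doob_density_def doob_factor_def)
    then show ?thesis
      using True c sin_pi_div_pos[of z u] p0[of z] by (simp add: sine_test_def ennreal_mult)
  qed (auto simp: sine_test_def indicator_def)
  have nn: "(\<integral>\<^sup>+z. ennreal (?f z) \<partial>lborel) = ennreal ?c * survival_kernel Wx u t (sine_test u B) y"
    unfolding fe survival_kernel_killed_density[OF Wx W p y t measurable_sine_test[OF B]]
    by (rule nn_integral_cmult) (use measurable_sine_test[OF B] in measurable)
  \<comment> \<open>The sine is at most 1, so the kernel is at most the mass of \<open>W y\<close>.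
    Finiteness excludes the default value 0 of the Bochner integral, and the real integral can be
    converted back.\<close>
  have "survival_kernel Wx u t (sine_test u B) y \<le> (\<integral>\<^sup>+w. 1 \<partial>W y)"
    unfolding survival_kernel_eq[OF Wx W measurable_sine_test[OF B] less_imp_le[OF t]]
    by (intro nn_integral_mono) (auto simp: sine_test_def indicator_def)
  also have "\<dots> = 1" using prob_space.emeasure_space_1[OF wiener_prob_space(1)[OF W]] by simp
  finally have fin: "survival_kernel Wx u t (sine_test u B) y < \<infinity>" by (simp add: le_less_trans)
  have L: "(LINT z:B \<inter> ?S|lborel. doob_density u p t y z) = enn2real (\<integral>\<^sup>+z. ennreal (?f z) \<partial>lborel)"
    unfolding set_lebesgue_integral_def by (rule integral_eq_nn_integral[OF fm]) (use f0 in auto)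
  show "ennreal (LINT z:B \<inter> ?S|lborel. doob_density u p t y z) = ennreal ?c * survival_kernel Wx u t (sine_test u B) y"
    unfolding L nn using fin by (intro ennreal_enn2real) (simp add: ennreal_mult_less_top)
  show "0 \<le> (LINT z:B \<inter> ?S|lborel. doob_density u p t y z)" unfolding L by simp
qed

text \<open>Integrate the conditional probability given \<open>nat_filtration s\<close> over
  \<open>A\<close>: the Markov property replaces it by the integral of \<open>doob_density\<close>,
  which is the real version of \<open>doob_kernel\<close>.\<close>

lemma markov_law_step:
  assumes Wx: "wiener_measure x Wx" and W: "\<And>y. wiener_measure y (W y)" and p: "killed_density W u p"
    and P: "markov_law {0<..<u} (doob_density u p) x P"
    and s: "0 \<le> s" "s < t" and A: "A \<in> sets (nat_filtration s)" and C: "C \<in> sets borel"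
  shows "emeasure P (A \<inter> {w. coord t w \<in> C}) = (\<integral>\<^sup>+w. indicator A w * doob_kernel Wx u s t (coord s w) C \<partial>P)"
proof -
  have P': "prob_space P" "sets P = sets borel" using P by (auto simp: markov_law_def)
  interpret P: prob_space P by fact
  interpret F: finite_measure_subalgebra P "nat_filtration s"
    by unfold_locales (rule subalgebra_nat_filtration[OF P'(2)])
  have sp: "space P = UNIV" using sets_eq_imp_space_eq[OF P'(2)] by simp
  have AP[measurable]: "A \<in> sets P" using A P'(2) sets_nat_filtration_subset by auto
  have Em: "{w. coord t w \<in> C} \<in> sets P"
    using measurable_sets[OF measurable_coord C, of t] s P'(2) by (simp add: vimage_def)
  let ?g = "indicator {w. coord t w \<in> C} :: path \<Rightarrow> real"
  let ?G = "\<lambda>w. LINT z:C \<inter> {0<..<u}|lborel. doob_density u p (t - s) (coord s w) z"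
  \<comment> \<open>The identities for \<open>doob_density\<close> hold for starting points in the
    open interval, where \<open>P\<close> places \<open>coord s\<close> almost surely.\<close>
  have S: "AE w in P. coord s w \<in> {0<..<u}"
    using P s unfolding markov_law_def by blast
  have ce: "AE w in P. real_cond_exp P (nat_filtration s) ?g w = ?G w"
  proof -
    have "\<forall>s\<ge>0. \<forall>t>0. \<forall>B\<in>sets borel. AE w in P.
        real_cond_exp P (nat_filtration s) (indicator {w. coord (s + t) w \<in> B}) w =
        (LINT z:B \<inter> {0<..<u}|lborel. doob_density u p t (coord s w) z)"
      using P unfolding markov_law_def by blast
    from this[rule_format, OF s(1), of "t - s", OF _ C] s show ?thesis by simp
  qed
  have ig: "integrable P ?g"
    by (rule integrable_real_indicator[OF Em]) (simp add: P.emeasure_eq_measure)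
  have "measure P (A \<inter> {w. coord t w \<in> C}) = (\<integral>w\<in>A. ?g w \<partial>P)"
    using Em unfolding set_lebesgue_integral_def
    by (simp add: indicator_inter_arith[symmetric] Int_commute)
  also have "\<dots> = (\<integral>w\<in>A. real_cond_exp P (nat_filtration s) ?g w \<partial>P)"
    by (rule F.real_cond_exp_intA[OF ig A])
  finally have m: "measure P (A \<inter> {w. coord t w \<in> C}) = (\<integral>w. indicator A w *\<^sub>R real_cond_exp P (nat_filtration s) ?g w \<partial>P)"
    by (simp only: set_lebesgue_integral_def)
  have nn: "AE w in P. 0 \<le> indicator A w *\<^sub>R real_cond_exp P (nat_filtration s) ?g w"
    using ce S by eventually_elim
      (use doob_density_integral(2)[OF Wx W p _ _ C, of _ "t - s"] s in \<open>simp add: indicator_def\<close>)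
  have ii: "integrable P (\<lambda>w. indicator A w *\<^sub>R real_cond_exp P (nat_filtration s) ?g w)"
    by (rule integrable_mult_indicator[OF AP F.real_cond_exp_int(1)[OF ig]])
  have "emeasure P (A \<inter> {w. coord t w \<in> C}) = (\<integral>\<^sup>+w. ennreal (indicator A w *\<^sub>R real_cond_exp P (nat_filtration s) ?g w) \<partial>P)"
    by (simp only: P.emeasure_eq_measure m nn_integral_eq_integral[OF ii nn])
  also have "\<dots> = (\<integral>\<^sup>+w. indicator A w * doob_kernel Wx u s t (coord s w) C \<partial>P)"
  proof (rule nn_integral_cong_AE)
    show "AE w in P. ennreal (indicator A w *\<^sub>R real_cond_exp P (nat_filtration s) ?g w) = indicator A w * doob_kernel Wx u s t (coord s w) C"
      using ce S
    proof eventually_elim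
      case (elim w)
      then show ?case
        using doob_density_integral(1)[OF Wx W p elim(2) _ C, of "t - s"] s
        by (simp add: doob_kernel_def indicator_def)
    qed
  qed
  finally show ?thesis .
qed

text \<open>A separate measure for each horizon \<open>t\<close>, meant for events of
  \<open>nat_filtration t\<close>; this is why \<open>fdd_unique\<close> admits measures that vary
  with the time.\<close>

definition doob_transform :: "path measure \<Rightarrow> real \<Rightarrow> real \<Rightarrow> real \<Rightarrow> path measure" where
  "doob_transform Wx x u t =
     density Wx (\<lambda>w. ennreal (doob_weight x u t w) * indicator (stays 0 u t) w)"

text \<open>The weight at time \<open>t\<close> is a constant times the sine of the final position,
  so the Markov property of the killed motion applies with \<open>sine_test\<close> as test
  function. The constant then splits into the weight at time \<open>s\<close> and the factor of the
  kernel.\<close>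

lemma doob_transform_step:
  assumes Wx: "wiener_measure x Wx" and x: "x \<in> {0<..<u}"
    and s: "0 \<le> s" "s < t" and A: "A \<in> sets (nat_filtration s)" and C: "C \<in> sets borel"
  shows "emeasure (doob_transform Wx x u t) (A \<inter> {w. coord t w \<in> C}) =
    (\<integral>\<^sup>+w. indicator A w * doob_kernel Wx u s t (coord s w) C \<partial>doob_transform Wx x u s)"
proof -
  note w = wiener_prob_space[OF Wx]
  have [measurable]: "A \<in> sets Wx" using A w(2) sets_nat_filtration_subset by auto
  have [measurable]: "coord r \<in> borel_measurable Wx" if "0 \<le> r" for r
    using measurable_coord[OF that] w(2) by (simp cong: measurable_cong_sets)
  have ct[measurable]: "coord t \<in> borel_measurable Wx" and cs[measurable]: "coord s \<in> borel_measurable Wx"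
    using s by simp_all
  have [measurable]: "stays 0 u r \<in> sets Wx" for r
    unfolding w(2) by (rule subsetD[OF sets_nat_filtration_subset stays_in_nat_filtration])
  have [measurable]: "(\<lambda>w. doob_weight x u t w) \<in> borel_measurable Wx" "(\<lambda>w. doob_weight x u s w) \<in> borel_measurable Wx"
    unfolding doob_weight_def by measurable
  have Cm[measurable]: "{w. coord t w \<in> C} \<in> sets Wx"
    using measurable_sets[OF ct C] w(3) by (simp add: vimage_def)
  have [measurable]: "sine_test u C \<in> borel_measurable borel" by (rule measurable_sine_test[OF C])
  have dk[measurable]: "(\<lambda>w. doob_kernel Wx u s t (coord s w) C) \<in> borel_measurable Wx"
    by (rule measurable_compose[OF cs measurable_doob_kernel[OF Wx s(2) C]])
  have sk[measurable]: "(\<lambda>w. survival_kernel Wx u (t - s) (sine_test u C) (coord s w)) \<in> borel_measurable Wx"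
    by (rule measurable_compose[OF cs measurable_survival_kernel[OF Wx measurable_sine_test[OF C]]]) (use s in simp)
  let ?c = "doob_factor u t x"
  have c: "0 < ?c" by (rule doob_factor_pos[OF x])
  have wt: "doob_weight x u r w = doob_factor u r x * sin (pi * coord r w / u)" for r w
    by (simp add: doob_weight_def doob_factor_def)
  have "emeasure (doob_transform Wx x u t) (A \<inter> {w. coord t w \<in> C}) =
    (\<integral>\<^sup>+w. ennreal (doob_weight x u t w) * indicator (stays 0 u t) w * indicator (A \<inter> {w. coord t w \<in> C}) w \<partial>Wx)"
    unfolding doob_transform_def by (rule emeasure_density) measurable
  also have "\<dots> = (\<integral>\<^sup>+w. ennreal ?c * (indicator A w * (sine_test u C (coord t w) * indicator (stays 0 u t) w)) \<partial>Wx)"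
  proof (rule nn_integral_cong)
    fix w
    show "ennreal (doob_weight x u t w) * indicator (stays 0 u t) w * indicator (A \<inter> {w. coord t w \<in> C}) w =
      ennreal ?c * (indicator A w * (sine_test u C (coord t w) * indicator (stays 0 u t) w))"
      using c unfolding wt by (auto simp: sine_test_def indicator_def ennreal_mult')
  qed
  also have "\<dots> = ennreal ?c * (\<integral>\<^sup>+w. indicator A w * (sine_test u C (coord t w) * indicator (stays 0 u t) w) \<partial>Wx)"
    by (rule nn_integral_cmult) measurable
  also have "(\<integral>\<^sup>+w. indicator A w * (sine_test u C (coord t w) * indicator (stays 0 u t) w) \<partial>Wx) =
    (\<integral>\<^sup>+w. indicator A w * (indicator (stays 0 u s) w * survival_kernel Wx u (t - s) (sine_test u C) (coord s w)) \<partial>Wx)"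
    using wiener_markov_surviving[OF Wx measurable_sine_test[OF C] s(1) _ A, of "t - s" u] s(2) by simp
  also have "ennreal ?c * \<dots> =
    (\<integral>\<^sup>+w. ennreal ?c * (indicator A w * (indicator (stays 0 u s) w * survival_kernel Wx u (t - s) (sine_test u C) (coord s w))) \<partial>Wx)"
    by (rule nn_integral_cmult[symmetric]) measurable
  also have "\<dots> = (\<integral>\<^sup>+w. ennreal (doob_weight x u s w) * indicator (stays 0 u s) w * (indicator A w * doob_kernel Wx u s t (coord s w) C) \<partial>Wx)"
  proof (rule nn_integral_cong)
    fix w
    let ?k = "survival_kernel Wx u (t - s) (sine_test u C) (coord s w)"
    show "ennreal ?c * (indicator A w * (indicator (stays 0 u s) w * ?k)) =
      ennreal (doob_weight x u s w) * indicator (stays 0 u s) w * (indicator A w * doob_kernel Wx u s t (coord s w) C)"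
    proof (cases "w \<in> stays 0 u s")
      case True
      then have cS: "coord s w \<in> {0<..<u}" using s by (auto simp: stays_def)
      \<comment> \<open>The sine of \<open>coord s w\<close> cancels between the two factors, and
        the exponential splits at time \<open>s\<close>.\<close>
      have "?c = doob_weight x u s w * doob_factor u (t - s) (coord s w)"
      proof -
        have "exp (pi\<^sup>2 / u\<^sup>2 * (t / 2)) = exp (pi\<^sup>2 / u\<^sup>2 * (s / 2)) * exp (pi\<^sup>2 / u\<^sup>2 * ((t - s) / 2))"
          unfolding exp_add[symmetric] by (simp add: algebra_simps diff_divide_distrib)
        then show ?thesis
          using sin_pi_div_pos[OF cS] by (simp add: doob_weight_def doob_factor_def)
      qed
      moreover have "0 \<le> doob_weight x u s w"
        using doob_factor_pos[OF x, of s] sin_pi_div_pos[OF cS] unfolding wt by (simp add: less_imp_le)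
      ultimately have "ennreal ?c = ennreal (doob_weight x u s w) * ennreal (doob_factor u (t - s) (coord s w))"
        by (simp add: ennreal_mult')
      then show ?thesis using True cS by (simp add: doob_kernel_def mult_ac)
    qed simp
  qed
  also have "\<dots> = (\<integral>\<^sup>+w. indicator A w * doob_kernel Wx u s t (coord s w) C \<partial>doob_transform Wx x u s)"
    unfolding doob_transform_def by (rule nn_integral_density[symmetric]) measurable
  finally show ?thesis .
qed

text \<open>\<open>P\<close> and the family of transforms have the same initial law and, by the two
  step lemmas, the same transition kernel; cylinders with times in \<open>{0..t}\<close> then
  determine the measure on \<open>nat_filtration t\<close>.\<close>

lemma markov_law_eq_doob_transform:
  assumes Wx: "wiener_measure x Wx" and W: "\<And>y. wiener_measure y (W y)" and p: "killed_density W u p"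
    and x: "x \<in> {0<..<u}" and P: "markov_law {0<..<u} (doob_density u p) x P"
    and t: "0 \<le> t" and A: "A \<in> sets (nat_filtration t)"
  shows "emeasure P A = emeasure (doob_transform Wx x u t) A"
proof -
  note w = wiener_prob_space[OF Wx]
  have P': "prob_space P" "sets P = sets borel" "AE w in P. coord 0 w = x" using P by (auto simp: markov_law_def)
  interpret P: prob_space P by fact
  have sp: "space P = UNIV" using sets_eq_imp_space_eq[OF P'(2)] by simp
  let ?D = "doob_transform Wx x u"
  have D: "sets (?D r) = sets borel" "space (?D r) = UNIV" for r
    using w by (simp_all add: doob_transform_def)
  have mc: "coord s \<in> borel_measurable P" "coord s \<in> borel_measurable (?D r)" "coord s \<in> borel_measurable Wx" if "0 \<le> s" for s r
    using measurable_coord[OF that] P'(2) D(1) w(2) by (simp_all cong: measurable_cong_sets)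
  have fdd: "emeasure P (cyl coord (insert 0 J) B) = emeasure (?D (Max (insert 0 J))) (cyl coord (insert 0 J) B)"
    if J: "finite J" "J \<subseteq> {0..}" and B: "\<And>j. B j \<in> sets borel" for J and B :: "real \<Rightarrow> real set"
  proof (rule fdd_unique[where \<mu> = "\<lambda>_. P" and \<nu> = ?D and X = coord and Y = coord and \<kappa> = "doob_kernel Wx u", OF _ _ _ _ _ _ _ _ J B])
    show "space P = UNIV" "space (?D r) = UNIV" for r using sp D by auto
    show "coord s \<in> borel_measurable P" "coord s \<in> borel_measurable (?D r)" if "0 \<le> s" for s r using mc that by auto
    show "(\<lambda>y. doob_kernel Wx u s t y C) \<in> borel_measurable borel" if "s < t" "C \<in> sets borel" for s t C
      by (rule measurable_doob_kernel[OF Wx that])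
    show "emeasure P {w. coord 0 w \<in> C} = emeasure (?D 0) {w. coord 0 w \<in> C}" if C: "C \<in> sets borel" for C
    proof -
      have CP: "{w. coord 0 w \<in> C} \<in> sets P" and CW: "{w. coord 0 w \<in> C} \<in> sets Wx"
        using measurable_sets[OF measurable_coord[OF order_refl] C] P'(2) w(2) by (simp_all add: vimage_def)
      have "emeasure P {w. coord 0 w \<in> C} = (\<integral>\<^sup>+w. indicator {w. coord 0 w \<in> C} w \<partial>P)" using CP by simp
      also have "\<dots> = (\<integral>\<^sup>+w. indicator C x \<partial>P)"
        by (rule nn_integral_cong_AE) (use P'(3) in eventually_elim, simp add: indicator_def)
      also have "\<dots> = (\<integral>\<^sup>+w. indicator C x \<partial>Wx)"
        using P.emeasure_space_1 prob_space.emeasure_space_1[OF w(1)] by simp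
      also have "\<dots> = (\<integral>\<^sup>+w. ennreal (doob_weight x u 0 w) * indicator (stays 0 u 0) w * indicator {w. coord 0 w \<in> C} w \<partial>Wx)"
      proof (rule nn_integral_cong_AE)
        show "AE w in Wx. indicator C x = ennreal (doob_weight x u 0 w) * indicator (stays 0 u 0) w * indicator {w. coord 0 w \<in> C} w"
          using w(4)
        proof eventually_elim
          case (elim w)
          then have "w \<in> stays 0 u 0" "doob_weight x u 0 w = 1"
            using x sin_pi_div_pos[OF x] by (auto simp: stays_def doob_weight_def)
          then show ?case using elim by (simp add: indicator_def)
        qed
      qed
      also have "\<dots> = emeasure (?D 0) {w. coord 0 w \<in> C}"
      proof -
        have [measurable]: "stays 0 u 0 \<in> sets Wx"
          unfolding w(2) by (rule subsetD[OF sets_nat_filtration_subset stays_in_nat_filtration])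
        have [measurable]: "coord 0 \<in> borel_measurable Wx" by (rule mc(3)) simp
        have "(\<lambda>w. ennreal (doob_weight x u 0 w) * indicator (stays 0 u 0) w) \<in> borel_measurable Wx"
          unfolding doob_weight_def by measurable
        then show ?thesis unfolding doob_transform_def using CW by (rule emeasure_density[symmetric])
      qed
      finally show ?thesis .
    qed
  next
    fix s t :: real and J :: "real set" and B :: "real \<Rightarrow> real set" and C :: "real set"
    assume st: "(0::real) \<le> s" "s < t" and J: "finite J" "J \<subseteq> {0..s}"
      and B: "\<And>j. B j \<in> sets borel" and C: "C \<in> sets borel"
    have cF: "cyl coord J B \<in> sets (nat_filtration s)"
      unfolding nat_filtration_eq_filt by (rule cyl_in_filt[OF J B])
    show "emeasure P (cyl coord J B \<inter> {w. coord t w \<in> C}) = (\<integral>\<^sup>+w. indicator (cyl coord J B) w * doob_kernel Wx u s t (coord s w) C \<partial>P)"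
      by (rule markov_law_step[OF Wx W p P st cF C])
    show "emeasure (?D t) (cyl coord J B \<inter> {w. coord t w \<in> C}) = (\<integral>\<^sup>+w. indicator (cyl coord J B) w * doob_kernel Wx u s t (coord s w) C \<partial>?D s)"
      by (rule doob_transform_step[OF Wx x st cF C])
  qed
  let ?F = "nat_filtration t"
  have sP: "subalgebra P ?F" and sD: "subalgebra (?D t) ?F"
    using subalgebra_nat_filtration[OF P'(2)] subalgebra_nat_filtration[OF D(1)] by auto
  have "restr_to_subalg P ?F = restr_to_subalg (?D t) ?F"
  proof (rule measure_eqI_cyl[where T = "{0..t}"])
    show "finite_measure (restr_to_subalg P ?F)"
      by (rule finite_measure_restr_to_subalg[OF sP]) (rule P.finite_measure_axioms)
    show "sets (restr_to_subalg P ?F) = sets (filt {0..t})" "sets (restr_to_subalg (?D t) ?F) = sets (filt {0..t})"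
      unfolding sets_restr_to_subalg[OF sP] sets_restr_to_subalg[OF sD] by (simp_all only: nat_filtration_eq_filt)
    fix J :: "real set" and B :: "real \<Rightarrow> real set"
    assume J: "finite J" "J \<subseteq> {0..t}" and B: "\<And>j. B j \<in> sets borel"
    \<comment> \<open>Adding \<open>t\<close> to the times, without constraint there, makes
      \<open>t\<close> the maximum, so that the comparison is with the transform of horizon
      \<open>t\<close>.\<close>
    let ?B = "\<lambda>j. if j \<in> J then B j else UNIV" and ?J = "insert 0 (insert t J)"
    have cJ: "cyl coord J B \<in> sets ?F" unfolding nat_filtration_eq_filt by (rule cyl_in_filt[OF J B])
    have e: "cyl coord J B = cyl coord ?J ?B" by (auto simp: cyl_def)
    have mx: "Max ?J = t" using J t by (intro Max_eqI) auto
    have "emeasure P (cyl coord J B) = emeasure (?D t) (cyl coord J B)"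
    proof -
      have "insert t J \<subseteq> {0..}" using J t by auto
      then have "emeasure P (cyl coord ?J ?B) = emeasure (?D (Max ?J)) (cyl coord ?J ?B)"
        using J(1) B by (intro fdd) auto
      then show ?thesis unfolding e mx .
    qed
    then show "emeasure (restr_to_subalg P ?F) (cyl coord J B) = emeasure (restr_to_subalg (?D t) ?F) (cyl coord J B)"
      by (simp add: emeasure_restr_to_subalg[OF sP cJ] emeasure_restr_to_subalg[OF sD cJ])
  qed
  then show ?thesis
    using emeasure_restr_to_subalg[OF sP A] emeasure_restr_to_subalg[OF sD A] by simp
qed

theorem theorem6p1:
  fixes x u :: real
    and W :: "real \<Rightarrow> path measure"
    and Q :: "real \<Rightarrow> path measure"
    and p :: "real \<Rightarrow> real \<Rightarrow> real \<Rightarrow> real"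
    and P :: "path measure"
  assumes "0 < x" and "x < u"
    and "\<And>y. wiener_measure y (W y)"
    and "\<And>c. 0 < c \<Longrightarrow> c < 1 \<Longrightarrow> is_Q (W x) c x u (Q c)"
    and "killed_density W u p"
    and "markov_law {0<..<u} (doob_density u p) x P"
  shows "weakly_converges Q P (at_right 0)"
proof (rule weakly_converges_Q[OF assms(1,2)])
  note w = wiener_prob_space[OF assms(3)[of x]]
  show "prob_space (W x)" "sets (W x) = sets borel" "AE w in W x. coord 0 w = x" by (fact w)+
  show P: "prob_space P" "sets P = sets borel" using assms(6) by (auto simp: markov_law_def)
  show "is_Q (W x) c x u (Q c)" if "0 < c" "c < 1" for c by (rule assms(4)[OF that])
  fix t A assume t: "(0::real) < t" and A: "A \<in> sets (nat_filtration t)"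
  interpret P: prob_space P by (rule P)
  interpret W: prob_space "W x" by (rule w)
  have xS: "x \<in> {0<..<u}" using assms by simp
  have [measurable]: "A \<in> sets (W x)" using A w(2) sets_nat_filtration_subset by auto
  have [measurable]: "stays 0 u t \<in> sets (W x)"
    unfolding w(2) by (rule subsetD[OF sets_nat_filtration_subset stays_in_nat_filtration])
  have [measurable]: "coord t \<in> borel_measurable (W x)"
    using measurable_coord[of t] t w(2) by (simp cong: measurable_cong_sets)
  have [measurable]: "(\<lambda>w. doob_weight x u t w) \<in> borel_measurable (W x)" unfolding doob_weight_def by measurable
  let ?f = "\<lambda>w. doob_weight x u t w * indicator (stays 0 u t) w * indicator A w"
  have nn: "0 \<le> ?f w" for w
  proof (cases "w \<in> stays 0 u t")
    case True
    then have "coord t w \<in> {0<..<u}" using t by (auto simp: stays_def)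
    from sin_pi_div_pos[OF this] sin_pi_div_pos[OF xS] show ?thesis by (simp add: doob_weight_def)
  qed simp
  have "measure P A = enn2real (emeasure (doob_transform (W x) x u t) A)"
    using markov_law_eq_doob_transform[OF assms(3,3,5) xS assms(6) less_imp_le[OF t] A] by (simp add: measure_def)
  also have "emeasure (doob_transform (W x) x u t) A =
    (\<integral>\<^sup>+w. ennreal (doob_weight x u t w) * indicator (stays 0 u t) w * indicator A w \<partial>W x)"
    unfolding doob_transform_def by (rule emeasure_density) measurable
  also have "\<dots> = (\<integral>\<^sup>+w. ennreal (?f w) \<partial>W x)"
    by (rule nn_integral_cong) (simp add: indicator_def)
  also have "enn2real \<dots> = (\<integral>w. ?f w \<partial>W x)"
    by (rule integral_eq_nn_integral[symmetric]) (use nn in auto)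
  finally show "measure P A = (\<integral>w. ?f w \<partial>W x)" .
qed


end
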